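(* There exists a constant $c>0$ such that for every integer $k \geq 1$ there exists a directed graph $G$ of pathwidth at most $k$ with at most $k^{c}$ vertices such that every tropical circuit calculating $DTSP_G$ has at least $2^{\Omega(k \log\log k)}$ gates (nodes).
   Context: For a directed graph $G$ on $N$ vertices, associate a variable $x_{u,v}$ with every arc $(u,v)\in E(G)$. Let $\mathcal{H}(G)$ be the family of sequences $(u_0,\dots,u_N)$ of vertices with $u_0=u_N$ such that $u_0\to u_1\to\dots\to u_N$ is a directed Hamiltonian cycle of $G$. $DTSP_G$ is the tropical $(\max,+)$ polynomial $\sum_{(u_i)\in\mathcal{H}(G)}\prod_{i\in[N]} x_{u_{i-1},u_i}$; on a valuation $\nu$ (assignment of reals to the variables) it evaluates to $\max_{(u_i)\in\mathcal{H}(G)}\sum_{i\in[N]}\nu(x_{u_{i-1},u_i})$. A tropical circuit is a directed acyclic graph whose nodes have in-degree $0$ or $2$; in-degree-$0$ nodes are labeled by a variable or by the constant $0$; in-degree-$2$ nodes are labeled by $+$ or $\max$; one node is the output. On a valuation, input nodes evaluate to the variable's value, constant nodes to $0$, and $+$/$\max$ nodes to the sum/maximum of their two predecessors' values; the circuit's value is the output node's value. A circuit calculates a polynomial $p$ if its value equals $p(\nu)$ for every valuation $\nu$; its size is its number of nodes. The pathwidth of a directed graph is that of its underlying undirected graph: the minimum over sequences of bags $\beta_1,\dots,\beta_\ell\subseteq V(G)$ (each edge inside some bag, bags containing any given vertex contiguous) of $\max_i|\beta_i|-1$. *)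

theory Defs
  imports Complex_Main "HOL-Library.Landau_Symbols" "Graph_Theory.Pair_Digraph"
begin

section \<open>Pathwidth\<close>

text \<open>
  For a directed graph the decompositions below are those of the underlying undirected graph:
  only the two end points of an arc matter, and a loop imposes no condition beyond coverage of
  its vertex.
\<close>

definition path_decomposition :: "'v pair_pre_digraph \<Rightarrow> 'v set list \<Rightarrow> bool" where
  "path_decomposition G bags \<longleftrightarrow>
     bags \<noteq> [] \<and>
     (\<Union>\<beta>\<in>set bags. \<beta>) = pverts G \<and>
     (\<forall>(u, v)\<in>parcs G. \<exists>\<beta>\<in>set bags. u \<in> \<beta> \<and> v \<in> \<beta>) \<and>
     (\<forall>i j l. i \<le> j \<and> j \<le> l \<and> l < length bags \<longrightarrow> bags ! i \<inter> bags ! l \<subseteq> bags ! j)"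

definition decomposition_width :: "'v set list \<Rightarrow> nat" where
  "decomposition_width bags = Max (card ` set bags) - 1"

definition pathwidth :: "'v pair_pre_digraph \<Rightarrow> nat" where
  "pathwidth G = (LEAST w. \<exists>bags. path_decomposition G bags \<and> decomposition_width bags = w)"


section \<open>The directed travelling salesman polynomial\<close>

text \<open>
  A Hamiltonian cycle is given as the list \<open>[u\<^sub>0, \<dots>, u\<^sub>N]\<close> with \<open>u\<^sub>0 = u\<^sub>N\<close>, so the same cycle
  occurs once for every choice of its starting vertex. In a graph with a single vertex the only
  possible cycle is a loop.
\<close>

definition hamiltonian_cycles :: "'v pair_pre_digraph \<Rightarrow> 'v list set" where
  "hamiltonian_cycles G =
     {us. length us = card (pverts G) + 1 \<and>
          us ! 0 = us ! card (pverts G) \<and>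
          (\<forall>i\<in>{1..card (pverts G)}. (us ! (i - 1), us ! i) \<in> parcs G) \<and>
          set us = pverts G \<and> distinct (tl us)}"

text \<open>
  The variable \<open>x\<^sub>u\<^sub>,\<^sub>v\<close> is identified with the arc \<open>(u, v)\<close>. The value is meaningful only if the
  graph has a Hamiltonian cycle: otherwise the polynomial has no monomials and the maximum below
  is unspecified.
\<close>

definition DTSP :: "'v pair_pre_digraph \<Rightarrow> ('v \<times> 'v \<Rightarrow> real) \<Rightarrow> real" where
  "DTSP G \<nu> =
     Max ((\<lambda>us. \<Sum>i\<in>{1..card (pverts G)}. \<nu> (us ! (i - 1), us ! i)) ` hamiltonian_cycles G)"


section \<open>Tropical circuits\<close>

text \<open>
  The two predecessors of a node of in-degree 2 may coincide (parallel wires).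
\<close>

datatype ('n, 'x) gate =
    Var_Gate 'x
  | Zero_Gate
  | Plus_Gate 'n 'n
  | Max_Gate 'n 'n

primrec preds :: "('n, 'x) gate \<Rightarrow> 'n set" where
  "preds (Var_Gate x) = {}"
| "preds Zero_Gate = {}"
| "preds (Plus_Gate a b) = {a, b}"
| "preds (Max_Gate a b) = {a, b}"

primrec gate_vars :: "('n, 'x) gate \<Rightarrow> 'x set" where
  "gate_vars (Var_Gate x) = {x}"
| "gate_vars Zero_Gate = {}"
| "gate_vars (Plus_Gate a b) = {}"
| "gate_vars (Max_Gate a b) = {}"

record ('n, 'x) circuit =
  nodes :: "'n set"
  gate_of :: "'n \<Rightarrow> ('n, 'x) gate"
  out_node :: 'n

definition wires :: "('n, 'x) circuit \<Rightarrow> 'n rel" where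
  "wires C = {(p, q). q \<in> nodes C \<and> p \<in> preds (gate_of C q)}"

definition tropical_circuit :: "'x set \<Rightarrow> ('n, 'x) circuit \<Rightarrow> bool" where
  "tropical_circuit X C \<longleftrightarrow>
     finite (nodes C) \<and> out_node C \<in> nodes C \<and>
     (\<forall>q\<in>nodes C. preds (gate_of C q) \<subseteq> nodes C \<and> gate_vars (gate_of C q) \<subseteq> X) \<and>
     acyclic (wires C)"

definition circuit_size :: "('n, 'x) circuit \<Rightarrow> nat" where
  "circuit_size C = card (nodes C)"

inductive evaluates :: "('n, 'x) circuit \<Rightarrow> ('x \<Rightarrow> real) \<Rightarrow> 'n \<Rightarrow> real \<Rightarrow> bool"
  for C :: "('n, 'x) circuit" and \<nu> :: "'x \<Rightarrow> real" where
  Var: "gate_of C q = Var_Gate x \<Longrightarrow> evaluates C \<nu> q (\<nu> x)"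
| Zero: "gate_of C q = Zero_Gate \<Longrightarrow> evaluates C \<nu> q 0"
| Plus: "gate_of C q = Plus_Gate a b \<Longrightarrow> evaluates C \<nu> a r \<Longrightarrow> evaluates C \<nu> b s
           \<Longrightarrow> evaluates C \<nu> q (r + s)"
| Max: "gate_of C q = Max_Gate a b \<Longrightarrow> evaluates C \<nu> a r \<Longrightarrow> evaluates C \<nu> b s
           \<Longrightarrow> evaluates C \<nu> q (max r s)"

lemma evaluates_unique:
  assumes "evaluates C \<nu> q r" and "evaluates C \<nu> q s"
  shows "r = s"
  using assms
proof (induction arbitrary: s rule: evaluates.induct)
  case (Var q x)
  from Var(2) show ?case by cases (use Var(1) in auto)
next
  case (Zero q)
  from Zero(2) show ?case by cases (use Zero(1) in auto)
next
  case (Plus q a b r r')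
  from Plus.prems obtain t t' where "evaluates C \<nu> a t" "evaluates C \<nu> b t'" "s = t + t'"
    by cases (use Plus.hyps(1) in simp_all)
  then show ?case using Plus.IH by simp
next
  case (Max q a b r r')
  from Max.prems obtain t t' where "evaluates C \<nu> a t" "evaluates C \<nu> b t'" "s = max t t'"
    by cases (use Max.hyps(1) in simp_all)
  then show ?case using Max.IH by metis
qed

lemma evaluates_exists:
  assumes "tropical_circuit X C" and "q \<in> nodes C"
  shows "\<exists>r. evaluates C \<nu> q r"
proof -
  have "wires C \<subseteq> nodes C \<times> nodes C"
    using assms(1) by (auto simp: wires_def tropical_circuit_def)
  moreover have "finite (nodes C)"
    using assms(1) by (simp add: tropical_circuit_def)
  ultimately have "finite (wires C)"
    by (meson finite_SigmaI finite_subset)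
  then have "wf (wires C)"
    using assms(1) by (simp add: finite_acyclic_wf tropical_circuit_def)
  then show ?thesis
    using assms(2)
  proof (induction q rule: wf_induct_rule)
    case (less q)
    have *: "\<exists>r. evaluates C \<nu> p r" if "p \<in> preds (gate_of C q)" for p
      using less assms(1) that by (auto simp: wires_def tropical_circuit_def)
    show ?case
    proof (cases "gate_of C q")
      case (Var_Gate x)
      from evaluates.Var[OF this] show ?thesis by (rule exI)
    next
      case Zero_Gate
      from evaluates.Zero[OF this] show ?thesis by (rule exI)
    next
      case (Plus_Gate a b)
      then obtain r s where "evaluates C \<nu> a r" "evaluates C \<nu> b s"
        using *[of a] *[of b] by auto
      from evaluates.Plus[OF Plus_Gate this] show ?thesis by (rule exI)
    next
      case (Max_Gate a b)
      then obtain r s where "evaluates C \<nu> a r" "evaluates C \<nu> b s"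
        using *[of a] *[of b] by auto
      from evaluates.Max[OF Max_Gate this] show ?thesis by (rule exI)
    qed
  qed
qed

definition circuit_value :: "('n, 'x) circuit \<Rightarrow> ('x \<Rightarrow> real) \<Rightarrow> real" where
  "circuit_value C \<nu> = (THE r. evaluates C \<nu> (out_node C) r)"

lemma circuit_value_eq_iff:
  assumes "tropical_circuit X C"
  shows "circuit_value C \<nu> = r \<longleftrightarrow> evaluates C \<nu> (out_node C) r"
proof -
  obtain s where s: "evaluates C \<nu> (out_node C) s"
    using evaluates_exists[OF assms] assms unfolding tropical_circuit_def by blast
  then have v: "circuit_value C \<nu> = s"
    unfolding circuit_value_def by (rule the_equality) (rule evaluates_unique[OF _ s])
  show ?thesis
  proof
    assume "circuit_value C \<nu> = r"
    with v s show "evaluates C \<nu> (out_node C) r" by simp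
  next
    assume "evaluates C \<nu> (out_node C) r"
    with s have "s = r" by (rule evaluates_unique)
    with v show "circuit_value C \<nu> = r" by simp
  qed
qed

definition calculates :: "('n, 'x) circuit \<Rightarrow> (('x \<Rightarrow> real) \<Rightarrow> real) \<Rightarrow> bool" where
  "calculates C p \<longleftrightarrow> (\<forall>\<nu>. circuit_value C \<nu> = p \<nu>)"

end

(* The graph consists of L = 3 n^2 cyclically arranged layers of n vertices each, n = k div 3, with
   all arcs from every layer to the next. Its Hamiltonian cycles are the tuples of L permutations
   whose composition around the cycle is a single n-cycle, and there are at least n!^L / n of them.

   A tropical circuit for the polynomial formally produces exactly the monomials of the polynomial,
   so a circuit with s nodes covers the Hamiltonian cycles by s rectangles A x B (any arc set in A
   together with any arc set in B is a Hamiltonian cycle) in which A contributes between one and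
   two thirds of the arcs. In a rectangle the arcs leaving a fixed vertex come all from A or all
   from B. If many layers are mixed, the rectangle is tiny. Otherwise some layer comes entirely from
   A and some other one entirely from B. Fixing the rest, one is left with sets P and R of
   permutations such that rho o pi is an n-cycle for all pi in P and rho in R.

   The heart of the matter is that then |P| |R| <= n!^2 / (log n)^(n/64), in substance a
   theorem of Raz and Spieker. If P and R were larger, pass to subsets Q and S at which a bounded potential cannot be
   decreased at small cost in cardinality. Conditioning on the images of a few points then hardly
   ever makes a probable edge improbable, so that almost all short sequences of probable edges are
   realised jointly. Take a random alternating walk i_0, j_0, i_1, j_1, ... with T = (log n)^(1/4)
   steps, up to a constant factor, and let C(i) and D(i) be the heads of the probable edges of Q out
   of i and the tails of the probable edges of S into i. As P and R are large, most of the sets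
   C(i_c) /\ D(i_(c+1)) have more than 4n/T elements, hence many x lie in two of them, say for
   b < b'. Then i_(b+1), ..., i_b', x closes to a cycle of length at most T < n of probable edges,
   and for some walk it is realised by some pi in Q and rho in S. *)

theory Submission
  imports Defs "HOL-Library.FuncSet" "HOL-Library.Multiset" "HOL-Combinatorics.Permutations"
    "HOL-Real_Asymp.Real_Asymp"
begin

section \<open>Conditional edge probabilities of sets of permutations\<close>

text \<open>The obstacle is dependence: each edge of a closed walk may be probable in a set of
  permutations although no member contains all of them. Independence is bought by stability. The
  potential is at most n^2 and is traded against n times the logarithm of the cardinality, so
  passing to the stable subset costs only a factor e^n, small beside (log n)^(n/64). In return,
  conditioning on k points, whose images have entropy at most k ln n, spoils on average at most 2 k
  n ln n edges, a vanishing fraction of all n^2. The double logarithm comes from two demands on T.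
  Write m^n for the density deficit. The common vertices of the sets C and D are plentiful only if
  ln T exceeds a fixed multiple of ln m, so T is at least a power of m. On the other hand, bounding
  the number of permutation sequences behind one walk requires a cap exp(O(T ln m)) on n times the
  edge probabilities; over 2T edges this loses exp(O(T^2 ln m)), which must stay below n. Both
  demands are met when m is a small power of ln n.\<close>

definition edge_prob :: "('a \<Rightarrow> 'b) set \<Rightarrow> 'a \<times> 'b \<Rightarrow> real" where
  "edge_prob Q e = real (card {\<pi>\<in>Q. \<pi> (fst e) = snd e}) / real (card Q)"

text \<open>The cap at 1 makes every term concave in the probability and the whole sum at most
  \<open>card E\<close>. An edge has the full value 1 exactly when its probability is at least
  \<open>\<tau>\<close>; such edges are called heavy below.\<close>

definition potential :: "('a \<times> 'b) set \<Rightarrow> real \<Rightarrow> ('a \<Rightarrow> 'b) set \<Rightarrow> real" where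
  "potential E \<tau> Q = (\<Sum>e\<in>E. min (edge_prob Q e / \<tau>) 1)"

text \<open>Rearranged: among its nonempty subsets, \<open>Q\<close> minimises
  \<open>potential E \<tau> Q' - \<gamma> * ln (real (card Q'))\<close>.\<close>

definition potential_stable :: "('a \<times> 'b) set \<Rightarrow> real \<Rightarrow> real \<Rightarrow> ('a \<Rightarrow> 'b) set \<Rightarrow> bool" where
  "potential_stable E \<tau> \<gamma> Q \<longleftrightarrow>
     (\<forall>Q'\<subseteq>Q. Q' \<noteq> {} \<longrightarrow>
        potential E \<tau> Q - \<gamma> * ln (real (card Q) / real (card Q')) \<le> potential E \<tau> Q')"

lemma edge_prob_nonneg: "0 \<le> edge_prob Q e"
  by (simp add: edge_prob_def)

lemma potential_nonneg: "0 < \<tau> \<Longrightarrow> 0 \<le> potential E \<tau> Q"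
  unfolding potential_def by (intro sum_nonneg) (simp add: edge_prob_nonneg)

lemma potential_le_card: "potential E \<tau> Q \<le> real (card E)"
  unfolding potential_def using sum_bounded_above[of E "\<lambda>e. min (edge_prob Q e / \<tau>) 1" 1] by simp

text \<open>Minimise the potential minus \<open>\<gamma>\<close> times the logarithm of the
  cardinality over all nonempty subsets of \<open>P\<close>; the subsets of the minimiser compete
  too, whence stability. Comparison with \<open>P\<close> itself bounds the loss, as potentials lie
  between 0 and \<open>card E\<close>.\<close>

lemma exists_stable_subset:
  assumes "finite P" "P \<noteq> {}" "0 < \<tau>" "0 < \<gamma>"
  obtains Q where "Q \<subseteq> P" "Q \<noteq> {}" "potential_stable E \<tau> \<gamma> Q"
    "real (card P) * exp (- (real (card E) / \<gamma>)) \<le> real (card Q)"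
proof -
  define \<Psi> where "\<Psi> Q = potential E \<tau> Q - \<gamma> * ln (real (card Q))" for Q
  define \<F> where "\<F> = {Q. Q \<subseteq> P \<and> Q \<noteq> {}}"
  have fin: "finite \<F>" and ne: "P \<in> \<F>"
    using assms by (auto simp: \<F>_def)
  define Q where "Q = arg_min_on \<Psi> \<F>"
  have Q: "Q \<in> \<F>" and Qmin: "\<And>Q'. Q' \<in> \<F> \<Longrightarrow> \<Psi> Q \<le> \<Psi> Q'"
    using arg_min_if_finite(1)[OF fin, of \<Psi>] arg_min_least[OF fin, of _ \<Psi>] ne by (auto simp: Q_def)
  have finQ: "finite Q" and pos: "0 < card Q"
    using Q assms(1) by (auto simp: \<F>_def card_gt_0_iff intro: finite_subset)
  have posP: "0 < card P" using assms by (simp add: card_gt_0_iff)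
  show ?thesis
  proof (rule that)
    show "Q \<subseteq> P" "Q \<noteq> {}" using Q by (auto simp: \<F>_def)
    show "potential_stable E \<tau> \<gamma> Q"
      unfolding potential_stable_def
    proof (intro allI impI)
      fix Q' assume Q': "Q' \<subseteq> Q" "Q' \<noteq> {}"
      then have "0 < card Q'" using finQ by (simp add: card_gt_0_iff finite_subset)
      moreover have "\<Psi> Q \<le> \<Psi> Q'" using Q Q' by (intro Qmin) (auto simp: \<F>_def)
      ultimately show "potential E \<tau> Q - \<gamma> * ln (real (card Q) / real (card Q')) \<le> potential E \<tau> Q'"
        using pos by (simp add: \<Psi>_def ln_div algebra_simps)
    qed
    have "\<gamma> * (ln (real (card P)) - ln (real (card Q))) \<le> real (card E)"
      using Qmin[OF ne] potential_nonneg[OF assms(3), of E Q] potential_le_card[of E \<tau> P]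
      by (simp add: \<Psi>_def algebra_simps)
    then have "ln (real (card P)) - real (card E) / \<gamma> \<le> ln (real (card Q))"
      using assms(4) by (simp add: field_simps)
    then have "exp (ln (real (card P)) - real (card E) / \<gamma>) \<le> real (card Q)"
      using pos by (simp add: ln_ge_iff)
    then show "real (card P) * exp (- (real (card E) / \<gamma>)) \<le> real (card Q)"
      using posP by (simp add: exp_diff exp_minus field_simps)
  qed
qed

text \<open>
  The potential is concave in the distribution, so conditioning on \<open>\<phi>\<close> decreases it on average,
  by at least a half for every heavy edge that becomes light. By stability the decrease is at most
  \<open>\<gamma>\<close> times the entropy of \<open>\<phi>\<close>.
\<close>

lemma stable_drop:
  fixes Q :: "('a \<Rightarrow> 'b) set" and \<phi> :: "('a \<Rightarrow> 'b) \<Rightarrow> 'y"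
  defines "cell \<equiv> \<lambda>y. {\<pi>\<in>Q. \<phi> \<pi> = y}"
  assumes Q: "finite Q" "Q \<noteq> {}" "potential_stable E \<tau> \<gamma> Q" and "finite E" "0 < \<tau>" "0 \<le> \<gamma>"
    and Y: "finite Y" "\<phi> ` Q \<subseteq> Y"
  shows "(\<Sum>y\<in>\<phi> ` Q. real (card (cell y)) *
            real (card {e\<in>E. \<tau> \<le> edge_prob Q e \<and> edge_prob (cell y) e < \<tau> / 2}))
         \<le> 2 * \<gamma> * ln (real (card Y)) * real (card Q)"
proof -
  define c where "c y = real (card (cell y))" for y
  define N where "N = real (card Q)"
  define drop where "drop y e \<longleftrightarrow> \<tau> \<le> edge_prob Q e \<and> edge_prob (cell y) e < \<tau> / 2" for y e
  have cell_sub: "cell y \<subseteq> Q" for y by (auto simp: cell_def)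
  have N: "0 < N" using Q by (simp add: N_def card_gt_0_iff)
  have c_pos: "0 < c y" if "y \<in> \<phi> ` Q" for y
    using that Q(1) by (auto simp: c_def cell_def card_gt_0_iff)
  have sum_c: "(\<Sum>y\<in>\<phi> ` Q. c y) = N"
    using sum.image_gen[OF Q(1), of "\<lambda>_. 1::real" \<phi>] by (simp add: c_def N_def cell_def)
  \<comment> \<open>The law of total probability over the cells of \<open>\<phi>\<close>.\<close>
  have sum_ep: "(\<Sum>y\<in>\<phi> ` Q. c y * edge_prob (cell y) e) = N * edge_prob Q e" for e
  proof -
    have "c y * edge_prob (cell y) e = real (card {\<pi>\<in>cell y. \<pi> (fst e) = snd e})" if "y \<in> \<phi> ` Q" for y
      using c_pos[OF that] by (simp add: edge_prob_def c_def)
    also have "\<dots> y = (\<Sum>\<pi>\<in>{\<pi>\<in>Q. \<phi> \<pi> = y}. of_bool (\<pi> (fst e) = snd e))" for y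
      using Q(1) by (simp add: cell_def Int_def sum_of_bool_eq[symmetric] flip: of_nat_sum)
    finally have "(\<Sum>y\<in>\<phi> ` Q. c y * edge_prob (cell y) e)
        = (\<Sum>\<pi>\<in>Q. of_bool (\<pi> (fst e) = snd e))"
      using sum.image_gen[OF Q(1), of "\<lambda>\<pi>. of_bool (\<pi> (fst e) = snd e) :: real" \<phi>] by simp
    also have "\<dots> = real (card {\<pi>\<in>Q. \<pi> (fst e) = snd e})"
      using Q(1) by (simp add: Int_def)
    finally show ?thesis using N by (simp add: edge_prob_def N_def)
  qed
  \<comment> \<open>Jensen's inequality for the logarithm, in the form
    \<open>ln t \<le> t - 1\<close> at \<open>t = N / c y / K\<close>.\<close>
  have entropy: "(\<Sum>y\<in>\<phi> ` Q. c y * ln (N / c y)) \<le> N * ln (real (card Y))"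
  proof -
    define K where "K = real (card (\<phi> ` Q))"
    have K: "0 < K" using Q by (simp add: K_def card_gt_0_iff)
    have "c y * ln (N / c y) \<le> c y * ln K + (N / K - c y)" if "y \<in> \<phi> ` Q" for y
    proof -
      have "ln (N / c y / K) \<le> N / c y / K - 1"
        using N K c_pos[OF that] by (intro ln_le_minus_one) simp
      then have "ln (N / c y) \<le> ln K + (N / c y / K - 1)"
        using N K c_pos[OF that] by (simp add: ln_div ln_mult)
      then have "c y * ln (N / c y) \<le> c y * (ln K + (N / c y / K - 1))"
        using c_pos[OF that] by (intro mult_left_mono) auto
      then show ?thesis using c_pos[OF that] by (simp add: field_simps)
    qed
    then have "(\<Sum>y\<in>\<phi> ` Q. c y * ln (N / c y)) \<le> (\<Sum>y\<in>\<phi> ` Q. c y * ln K + (N / K - c y))"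
      by (rule sum_mono)
    also have "\<dots> = N * ln K"
      using K by (simp add: sum.distrib sum_subtractf sum_c flip: sum_distrib_right K_def)
    also have "\<dots> \<le> N * ln (real (card Y))"
      using N K card_mono[OF Y] by (intro mult_left_mono) (simp_all add: K_def)
    finally show ?thesis .
  qed
  \<comment> \<open>For a heavy edge the minimum in \<open>Q\<close> is 1, and a cell in which the
    edge becomes light loses at least a half. For a light edge the minimum in \<open>Q\<close> is
    still linear, and in the cells the cap can only decrease the average.\<close>
  have edge: "(\<Sum>y\<in>\<phi> ` Q. c y * min (edge_prob (cell y) e / \<tau>) 1)
      \<le> N * min (edge_prob Q e / \<tau>) 1 - (\<Sum>y\<in>\<phi> ` Q. c y * of_bool (drop y e)) / 2" for e
  proof (cases "\<tau> \<le> edge_prob Q e")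
    case True
    have "c y * min (edge_prob (cell y) e / \<tau>) 1 \<le> c y - c y * of_bool (drop y e) / 2"
      if "y \<in> \<phi> ` Q" for y
    proof -
      have "min (edge_prob (cell y) e / \<tau>) 1 \<le> 1 - of_bool (drop y e) / 2"
        using \<open>0 < \<tau>\<close> by (auto simp: drop_def min_def field_simps)
      from mult_left_mono[OF this, of "c y"] show ?thesis
        using c_pos[OF that] by (simp add: algebra_simps)
    qed
    then have "(\<Sum>y\<in>\<phi> ` Q. c y * min (edge_prob (cell y) e / \<tau>) 1)
        \<le> (\<Sum>y\<in>\<phi> ` Q. c y - c y * of_bool (drop y e) / 2)" by (rule sum_mono)
    then show ?thesis using True \<open>0 < \<tau>\<close>
      by (simp add: sum_subtractf sum_c sum_divide_distrib)
  next
    case False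
    have "(\<Sum>y\<in>\<phi> ` Q. c y * min (edge_prob (cell y) e / \<tau>) 1)
        \<le> (\<Sum>y\<in>\<phi> ` Q. c y * edge_prob (cell y) e / \<tau>)"
    proof (rule sum_mono)
      fix y assume "y \<in> \<phi> ` Q"
      from mult_left_mono[OF min.cobounded1[of "edge_prob (cell y) e / \<tau>" 1] less_imp_le[OF c_pos[OF this]]]
      show "c y * min (edge_prob (cell y) e / \<tau>) 1 \<le> c y * edge_prob (cell y) e / \<tau>" by simp
    qed
    also have "\<dots> = N * edge_prob Q e / \<tau>" by (simp add: sum_ep flip: sum_divide_distrib)
    finally show ?thesis using False \<open>0 < \<tau>\<close> by (simp add: drop_def min_def)
  qed
  \<comment> \<open>Stability, applied to each cell and weighted by its size, bounds the average
    potential from below; the edgewise estimates bound it from above.\<close>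
  have "N * potential E \<tau> Q - \<gamma> * (N * ln (real (card Y)))
      \<le> N * potential E \<tau> Q - \<gamma> * (\<Sum>y\<in>\<phi> ` Q. c y * ln (N / c y))"
    using entropy \<open>0 \<le> \<gamma>\<close> by (simp add: mult_left_mono)
  also have "\<dots> = (\<Sum>y\<in>\<phi> ` Q. c y * (potential E \<tau> Q - \<gamma> * ln (N / c y)))"
    by (simp add: right_diff_distrib sum_subtractf sum_distrib_left sum_c mult_ac flip: sum_distrib_right) 
  also have "\<dots> \<le> (\<Sum>y\<in>\<phi> ` Q. c y * potential E \<tau> (cell y))"
  proof (intro sum_mono mult_left_mono)
    fix y assume y: "y \<in> \<phi> ` Q"
    then have "cell y \<noteq> {}" by (auto simp: cell_def)
    then show "potential E \<tau> Q - \<gamma> * ln (N / c y) \<le> potential E \<tau> (cell y)"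
      using Q(3) cell_sub[of y] unfolding potential_stable_def N_def c_def by blast
    show "0 \<le> c y" using c_pos[OF y] by simp
  qed
  also have "\<dots> = (\<Sum>e\<in>E. \<Sum>y\<in>\<phi> ` Q. c y * min (edge_prob (cell y) e / \<tau>) 1)"
    by (simp add: potential_def sum_distrib_left sum.swap[of _ _ E])
  also have "\<dots> \<le> (\<Sum>e\<in>E. N * min (edge_prob Q e / \<tau>) 1 - (\<Sum>y\<in>\<phi> ` Q. c y * of_bool (drop y e)) / 2)"
    by (intro sum_mono edge)
  also have "\<dots> = N * potential E \<tau> Q - (\<Sum>y\<in>\<phi> ` Q. c y * real (card {e\<in>E. drop y e})) / 2"
  proof -
    have "(\<Sum>e\<in>E. \<Sum>y\<in>\<phi> ` Q. c y * of_bool (drop y e)) = (\<Sum>y\<in>\<phi> ` Q. c y * real (card {e\<in>E. drop y e}))"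
      by (subst sum.swap) (simp add: \<open>finite E\<close> Int_def flip: sum_distrib_left)
    then show ?thesis
      by (simp add: potential_def sum_subtractf flip: sum_distrib_left sum_divide_distrib)
  qed
  finally show ?thesis by (simp add: c_def drop_def N_def algebra_simps)
qed

section \<open>Joint realisation of sequences of heavy edges\<close>

locale perm_family =
  fixes V :: "'a set" and Q :: "('a \<Rightarrow> 'a) set"
  assumes V: "finite V" "V \<noteq> {}"
    and Q: "finite Q" "Q \<noteq> {}" "\<And>\<pi>. \<pi> \<in> Q \<Longrightarrow> \<pi> permutes V"

locale stable_family = perm_family +
  fixes \<tau> \<gamma> :: real
  assumes stable: "potential_stable (V \<times> V) \<tau> \<gamma> Q" and \<tau>: "0 < \<tau>" and \<gamma>: "0 \<le> \<gamma>"

definition extending :: "('a \<Rightarrow> 'b) set \<Rightarrow> 'c set \<Rightarrow> ('c \<Rightarrow> 'a) \<Rightarrow> ('c \<Rightarrow> 'b) \<Rightarrow> ('a \<Rightarrow> 'b) set" where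
  "extending Q K I J = {\<pi>\<in>Q. \<forall>c\<in>K. \<pi> (I c) = J c}"

text \<open>Each further conditioning may halve a probability, hence \<open>\<tau> / 2\<close> per
  edge. The sequences need not be injective; contradictory requirements are simply unlikely. If
  \<open>\<tau>\<close> is positive and \<open>Q\<close> is finite and nonempty, a heavy sequence
  outside this set is realised by some member of \<open>Q\<close>.\<close>

definition unlikely_heavy ::
    "'a set \<Rightarrow> real \<Rightarrow> ('a \<Rightarrow> 'a) set \<Rightarrow> 'c set \<Rightarrow> (('c \<Rightarrow> 'a) \<times> ('c \<Rightarrow> 'a)) set" where
  "unlikely_heavy V \<tau> Q K =
     {(I, J) \<in> (K \<rightarrow>\<^sub>E V) \<times> (K \<rightarrow>\<^sub>E V). (\<forall>c\<in>K. \<tau> \<le> edge_prob Q (I c, J c)) \<and>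
        real (card (extending Q K I J)) < (\<tau> / 2) ^ card K * real (card Q)}"

text \<open>\<open>stable_drop\<close> for the map that records the images of the points
  \<open>I c\<close>. It has at most \<open>card V ^ card K\<close> values, which bounds the
  entropy. Every \<open>J\<close> counted here has weight at least
  \<open>(\<tau> / 2) ^ card K * real (card Q)\<close>, and this turns the weighted count into a
  plain one.\<close>

lemma (in stable_family) card_dropping_extensions:
  assumes K: "finite K" and I: "I \<in> K \<rightarrow>\<^sub>E V"
  shows "real (card {(J, e). J \<in> K \<rightarrow>\<^sub>E V \<and>
             (\<tau> / 2) ^ card K * real (card Q) \<le> real (card (extending Q K I J)) \<and>
             e \<in> V \<times> V \<and> \<tau> \<le> edge_prob Q e \<and> edge_prob (extending Q K I J) e < \<tau> / 2})
         \<le> (2 / \<tau>) ^ card K * (2 * \<gamma> * (real (card K) * ln (real (card V))))"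
proof -
  define \<phi> where "\<phi> \<pi> = (\<lambda>c\<in>K. \<pi> (I c))" for \<pi> :: "'a \<Rightarrow> 'a"
  define good where "good = {J \<in> K \<rightarrow>\<^sub>E V. (\<tau> / 2) ^ card K * real (card Q) \<le> real (card (extending Q K I J))}"
  define drops where "drops J = {e \<in> V \<times> V. \<tau> \<le> edge_prob Q e \<and> edge_prob (extending Q K I J) e < \<tau> / 2}" for J
  have finK: "finite (K \<rightarrow>\<^sub>E V)" using V K by (simp add: finite_PiE)
  have fin_good: "finite good" using finK by (simp add: good_def)
  have fin_drops: "finite (drops J)" for J using V by (simp add: drops_def)
  have posQ: "0 < card Q" using Q by (simp add: card_gt_0_iff)
  have thr: "0 < (\<tau> / 2) ^ card K * real (card Q)" using posQ \<tau> by simp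
  have \<phi>_in: "\<phi> ` Q \<subseteq> K \<rightarrow>\<^sub>E V"
    using Q(3) I by (fastforce simp: \<phi>_def permutes_in_image)
  have cell: "{\<pi>\<in>Q. \<phi> \<pi> = J} = extending Q K I J" if "J \<in> K \<rightarrow>\<^sub>E V" for J
    using that by (auto simp: extending_def \<phi>_def fun_eq_iff PiE_iff extensional_def)
  have good_sub: "good \<subseteq> \<phi> ` Q"
  proof
    fix J assume "J \<in> good"
    then have J: "J \<in> K \<rightarrow>\<^sub>E V" and "0 < card (extending Q K I J)"
      using thr by (auto simp: good_def)
    then obtain \<pi> where "\<pi> \<in> {\<pi>\<in>Q. \<phi> \<pi> = J}"
      unfolding cell[OF J] by (auto simp: card_gt_0_iff)
    then show "J \<in> \<phi> ` Q" by auto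
  qed
  have "((\<tau> / 2) ^ card K * real (card Q)) * real (card (Sigma good drops))
      = (\<Sum>J\<in>good. ((\<tau> / 2) ^ card K * real (card Q)) * real (card (drops J)))"
    using fin_good fin_drops by (simp add: card_SigmaI sum_distrib_left)
  also have "\<dots> \<le> (\<Sum>J\<in>good. real (card (extending Q K I J)) * real (card (drops J)))"
    by (intro sum_mono mult_right_mono) (auto simp: good_def)
  also have "\<dots> \<le> (\<Sum>J\<in>\<phi> ` Q. real (card (extending Q K I J)) * real (card (drops J)))"
    using good_sub Q(1) by (intro sum_mono2) auto
  also have "\<dots> = (\<Sum>J\<in>\<phi> ` Q. real (card {\<pi>\<in>Q. \<phi> \<pi> = J}) *
      real (card {e \<in> V \<times> V. \<tau> \<le> edge_prob Q e \<and> edge_prob {\<pi>\<in>Q. \<phi> \<pi> = J} e < \<tau> / 2}))"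
    using \<phi>_in by (intro sum.cong refl) (auto simp: cell drops_def subset_iff)
  also have "\<dots> \<le> 2 * \<gamma> * ln (real (card (K \<rightarrow>\<^sub>E V))) * real (card Q)"
    by (rule stable_drop) (use V Q stable \<tau> \<gamma> finK \<phi>_in in auto)
  also have "ln (real (card (K \<rightarrow>\<^sub>E V))) = real (card K) * ln (real (card V))"
    using K V by (simp add: card_PiE ln_realpow card_gt_0_iff)
  finally have "(\<tau> / 2) ^ card K * real (card (Sigma good drops))
      \<le> 2 * \<gamma> * (real (card K) * ln (real (card V)))"
    using posQ by (simp add: mult_ac)
  then have "real (card (Sigma good drops)) \<le> (2 / \<tau>) ^ card K * (2 * \<gamma> * (real (card K) * ln (real (card V))))"
    using \<tau> by (simp add: field_simps)
  moreover have "Sigma good drops = {(J, e). J \<in> K \<rightarrow>\<^sub>E V \<and>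
             (\<tau> / 2) ^ card K * real (card Q) \<le> real (card (extending Q K I J)) \<and>
             e \<in> V \<times> V \<and> \<tau> \<le> edge_prob Q e \<and> edge_prob (extending Q K I J) e < \<tau> / 2}"
    by (auto simp: good_def drops_def)
  ultimately show ?thesis by simp
qed

text \<open>Either the restriction to \<open>K\<close> is already unlikely and the new edge is
  arbitrary, or the restriction is realised often and conditioning on it has pushed the new edge,
  heavy in \<open>Q\<close>, below \<open>\<tau> / 2\<close>. The second kind is bounded separately
  for each of the \<open>card V ^ card K\<close> choices of \<open>I\<close>.\<close>

lemma (in stable_family) card_unlikely_heavy_insert:
  fixes K :: "'c set"
  assumes K: "finite K" "k \<notin> K"
  shows "real (card (unlikely_heavy V \<tau> Q (insert k K)))
     \<le> real (card (unlikely_heavy V \<tau> Q K)) * real (card V) ^ 2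
       + real (card V) ^ card K * ((2 / \<tau>) ^ card K * (2 * \<gamma> * (real (card K) * ln (real (card V)))))"
proof -
  define D where "D I = {(J, e). J \<in> K \<rightarrow>\<^sub>E V \<and>
             (\<tau> / 2) ^ card K * real (card Q) \<le> real (card (extending Q K I J)) \<and>
             e \<in> V \<times> V \<and> \<tau> \<le> edge_prob Q e \<and> edge_prob (extending Q K I J) e < \<tau> / 2}" for I
  define h where "h = (\<lambda>(I, J). ((restrict I K, restrict J K), (I k, J k)) :: (('c \<Rightarrow> 'a) \<times> ('c \<Rightarrow> 'a)) \<times> 'a \<times> 'a)"
  define assoc where "assoc = (\<lambda>(I, (J, e)). ((I, J), e) :: (('c \<Rightarrow> 'a) \<times> ('c \<Rightarrow> 'a)) \<times> 'a \<times> 'a)"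
  let ?A = "unlikely_heavy V \<tau> Q K \<times> (V \<times> V)"
  let ?B = "assoc ` (SIGMA I : K \<rightarrow>\<^sub>E V. D I)"
  have finK: "finite (K \<rightarrow>\<^sub>E V)" using V K by (simp add: finite_PiE)
  have finU: "finite (unlikely_heavy V \<tau> Q K)"
    by (rule finite_subset[of _ "(K \<rightarrow>\<^sub>E V) \<times> (K \<rightarrow>\<^sub>E V)"]) (use finK in \<open>auto simp: unlikely_heavy_def\<close>)
  have finD: "finite (D I)" for I
    by (rule finite_subset[of _ "(K \<rightarrow>\<^sub>E V) \<times> (V \<times> V)"]) (use finK V in \<open>auto simp: D_def\<close>)
  have finB: "finite ?B" using finK finD by (intro finite_imageI finite_SigmaI)
  have posQ: "0 < card Q" using Q by (simp add: card_gt_0_iff)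
  have inj: "inj_on h (unlikely_heavy V \<tau> Q (insert k K))"
  proof (rule inj_onI, clarify)
    fix I J I' J'
    assume "(I, J) \<in> unlikely_heavy V \<tau> Q (insert k K)" "(I', J') \<in> unlikely_heavy V \<tau> Q (insert k K)"
      and eq: "h (I, J) = h (I', J')"
    then have ext: "I \<in> extensional (insert k K)" "I' \<in> extensional (insert k K)"
      "J \<in> extensional (insert k K)" "J' \<in> extensional (insert k K)"
      by (auto simp: unlikely_heavy_def PiE_iff)
    have "I c = I' c \<and> J c = J' c" if "c \<in> insert k K" for c
      using eq that by (auto simp: h_def fun_eq_iff restrict_def split: if_splits)
    then show "I = I' \<and> J = J'" using ext by (auto intro: extensionalityI)
  qed
  have sub: "h ` unlikely_heavy V \<tau> Q (insert k K) \<subseteq> ?A \<union> ?B"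
  proof (rule subsetI, rule UnCI)
    fix x assume x: "x \<in> h ` unlikely_heavy V \<tau> Q (insert k K)" and nB: "x \<notin> ?B"
    from x obtain I J where IJ: "(I, J) \<in> unlikely_heavy V \<tau> Q (insert k K)" and h: "x = h (I, J)"
      by auto
    define a b c d where eqs: "a = restrict I K" "b = restrict J K" "c = I k" "d = J k"
    have x_eq: "x = ((a, b), (c, d))" by (simp add: h h_def eqs)
    from IJ have I: "I \<in> insert k K \<rightarrow>\<^sub>E V" and J: "J \<in> insert k K \<rightarrow>\<^sub>E V"
      and heavy: "\<And>c. c \<in> insert k K \<Longrightarrow> \<tau> \<le> edge_prob Q (I c, J c)"
      and small: "real (card (extending Q (insert k K) I J)) < (\<tau> / 2) ^ card (insert k K) * real (card Q)"
      by (auto simp: unlikely_heavy_def)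
    have I': "a \<in> K \<rightarrow>\<^sub>E V" and J': "b \<in> K \<rightarrow>\<^sub>E V" and e: "(c, d) \<in> V \<times> V"
      using I J by (auto simp: eqs)
    have heavy': "\<forall>c\<in>K. \<tau> \<le> edge_prob Q (a c, b c)" using heavy by (auto simp: eqs)
    have "(a, b) \<in> unlikely_heavy V \<tau> Q K"
    proof (rule ccontr)
      assume "(a, b) \<notin> unlikely_heavy V \<tau> Q K"
      then have large: "(\<tau> / 2) ^ card K * real (card Q) \<le> real (card (extending Q K a b))"
        using I' J' heavy' by (auto simp: unlikely_heavy_def)
      moreover have "0 < (\<tau> / 2) ^ card K * real (card Q)" using posQ \<tau> by simp
      ultimately have pos: "0 < real (card (extending Q K a b))" by linarith
      have "{\<pi> \<in> extending Q K a b. \<pi> c = d} = extending Q (insert k K) I J"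
        using K by (auto simp: extending_def eqs)
      then have "real (card {\<pi> \<in> extending Q K a b. \<pi> c = d}) < (\<tau> / 2) * ((\<tau> / 2) ^ card K * real (card Q))"
        using small K by simp
      also have "\<dots> \<le> (\<tau> / 2) * real (card (extending Q K a b))"
        using large \<tau> by (intro mult_left_mono) auto
      finally have "edge_prob (extending Q K a b) (c, d) < \<tau> / 2"
        using pos by (simp add: edge_prob_def field_simps)
      then have "(b, (c, d)) \<in> D a"
        using J' large e heavy by (auto simp: D_def eqs)
      then show False using nB I' unfolding x_eq by (force simp: assoc_def)
    qed
    then show "x \<in> ?A" using e by (simp add: x_eq)
  qed
  have "card (unlikely_heavy V \<tau> Q (insert k K)) \<le> card (?A \<union> ?B)"
    using card_inj_on_le[OF inj sub] finU V finB by simp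
  also have "\<dots> \<le> card ?A + card ?B" by (rule card_Un_le)
  also have "card ?B \<le> card (SIGMA I : K \<rightarrow>\<^sub>E V. D I)"
    using finK finD by (intro card_image_le finite_SigmaI)
  also have "\<dots> = (\<Sum>I\<in>K \<rightarrow>\<^sub>E V. card (D I))" using finK finD by simp
  finally have "real (card (unlikely_heavy V \<tau> Q (insert k K)))
      \<le> real (card ?A) + (\<Sum>I\<in>K \<rightarrow>\<^sub>E V. real (card (D I)))"
    by (simp flip: of_nat_sum of_nat_add)
  also have "(\<Sum>I\<in>K \<rightarrow>\<^sub>E V. real (card (D I)))
      \<le> (\<Sum>I\<in>K \<rightarrow>\<^sub>E V. (2 / \<tau>) ^ card K * (2 * \<gamma> * (real (card K) * ln (real (card V)))))"
    unfolding D_def by (intro sum_mono card_dropping_extensions K)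
  also have "\<dots> = real (card V) ^ card K * ((2 / \<tau>) ^ card K * (2 * \<gamma> * (real (card K) * ln (real (card V)))))"
    using K by (simp add: card_PiE)
  finally show ?thesis using V by (simp add: card_cartesian_product power2_eq_square)
qed

text \<open>In the recurrence the inherited term is multiplied by \<open>card V ^ 2\<close>, which
  is at most \<open>2 * card V / \<tau>\<close> as \<open>\<tau> * card V \<le> 1\<close>; the new
  terms add up to the factor \<open>card K ^ 2\<close>. The factor \<open>card V ^ 2\<close> on the
  left is the gain: for \<open>\<tau>\<close> of order 1/n and \<open>\<gamma>\<close> of order n,
  only about n^(2k-1) ln n of the n^(2k) pairs are unlikely, up to constants to the power k.\<close>

lemma (in stable_family) card_unlikely_heavy:
  fixes K :: "'c set"
  assumes small: "\<tau> * real (card V) \<le> 1" and K: "finite K"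
  shows "real (card (unlikely_heavy V \<tau> Q K)) * real (card V) ^ 2
     \<le> real (card K) ^ 2 * (2 * \<gamma> * ln (real (card V))) * (2 * real (card V) / \<tau>) ^ card K"
  using K
proof (induction K rule: finite_induct)
  case empty
  have "(\<lambda>_. undefined, \<lambda>_. undefined) \<notin> unlikely_heavy V \<tau> Q ({} :: 'c set)"
    by (simp add: unlikely_heavy_def extending_def)
  then have "unlikely_heavy V \<tau> Q ({} :: 'c set) = {}" by (auto simp: unlikely_heavy_def extending_def)
  then show ?case by simp
next
  case (insert k K)
  define N where "N = real (card V)"
  define G where "G = 2 * \<gamma> * ln N"
  define s where "s = real (card K)"
  define X where "X = (2 * N / \<tau>) ^ card K"
  have N: "1 \<le> N" using V by (simp add: N_def Suc_le_eq card_gt_0_iff)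
  have G: "0 \<le> G" using N \<gamma> by (simp add: G_def)
  have X: "0 \<le> X" using N \<tau> by (simp add: X_def)
  have ratio: "N ^ 2 \<le> 2 * N / \<tau>"
  proof -
    have "N * (\<tau> * N) \<le> N * 1" using N small by (intro mult_left_mono) (auto simp: N_def)
    then show ?thesis using N \<tau> by (simp add: field_simps power2_eq_square)
  qed
  have term_eq: "N ^ card K * ((2 / \<tau>) ^ card K * (2 * \<gamma> * (s * ln N))) = s * G * X"
    by (simp add: X_def G_def power_divide power_mult_distrib)
  have "real (card (unlikely_heavy V \<tau> Q (insert k K)))
     \<le> real (card (unlikely_heavy V \<tau> Q K)) * N ^ 2 + s * G * X"
    using card_unlikely_heavy_insert[OF insert.hyps]
    unfolding N_def[symmetric] s_def[symmetric] term_eq .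
  also have "\<dots> \<le> s ^ 2 * G * X + s * G * X"
    using insert.IH by (simp add: N_def G_def X_def s_def)
  also have "\<dots> \<le> (s + 1) ^ 2 * G * X"
    using G X by (simp add: algebra_simps power2_eq_square s_def)
  finally have "real (card (unlikely_heavy V \<tau> Q (insert k K))) * N ^ 2 \<le> (s + 1) ^ 2 * G * X * N ^ 2"
    by (intro mult_right_mono) auto
  also have "\<dots> \<le> (s + 1) ^ 2 * G * X * (2 * N / \<tau>)"
    using ratio G X by (intro mult_left_mono) auto
  finally show ?case using insert.hyps
    by (simp add: N_def G_def X_def s_def mult_ac add.commute)
qed

text \<open>The entries read through \<open>\<alpha>\<close> and \<open>\<beta>\<close> are those of
  an element of \<open>Z\<close>; the other \<open>card U - card K\<close> entries of either
  sequence are free. Two index maps are needed because closing a cycle redirects the last edge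
  differently in the two sequences.\<close>

lemma card_PiE_pairs_reindexed:
  fixes V :: "'a set" and U :: "'u set" and K :: "'c set"
  assumes "finite V" "finite U" and \<alpha>: "inj_on \<alpha> K" "\<alpha> ` K \<subseteq> U" and \<beta>: "inj_on \<beta> K" "\<beta> ` K \<subseteq> U"
    and Z: "finite Z"
  shows "card {(I, J) \<in> (U \<rightarrow>\<^sub>E V) \<times> (U \<rightarrow>\<^sub>E V). (\<lambda>c\<in>K. I (\<alpha> c), \<lambda>c\<in>K. J (\<beta> c)) \<in> Z}
         \<le> card Z * card V ^ (2 * (card U - card K))"
proof -
  let ?S = "{(I, J) \<in> (U \<rightarrow>\<^sub>E V) \<times> (U \<rightarrow>\<^sub>E V). (\<lambda>c\<in>K. I (\<alpha> c), \<lambda>c\<in>K. J (\<beta> c)) \<in> Z}"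
  let ?R = "Z \<times> ((U - \<alpha> ` K) \<rightarrow>\<^sub>E V) \<times> ((U - \<beta> ` K) \<rightarrow>\<^sub>E V)"
  let ?h = "\<lambda>(I, J). ((\<lambda>c\<in>K. I (\<alpha> c), \<lambda>c\<in>K. J (\<beta> c)), restrict I (U - \<alpha> ` K), restrict J (U - \<beta> ` K))"
  have inj: "inj_on ?h ?S"
  proof (rule inj_onI, clarify)
    fix I J I' J'
    assume "I \<in> U \<rightarrow>\<^sub>E V" "I' \<in> U \<rightarrow>\<^sub>E V" "J \<in> U \<rightarrow>\<^sub>E V" "J' \<in> U \<rightarrow>\<^sub>E V"
    then have ext: "I \<in> extensional U" "I' \<in> extensional U" "J \<in> extensional U" "J' \<in> extensional U"
      by (auto simp: PiE_iff)
    assume eqs: "(\<lambda>c\<in>K. I (\<alpha> c)) = (\<lambda>c\<in>K. I' (\<alpha> c))" "(\<lambda>c\<in>K. J (\<beta> c)) = (\<lambda>c\<in>K. J' (\<beta> c))"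
      "restrict I (U - \<alpha> ` K) = restrict I' (U - \<alpha> ` K)" "restrict J (U - \<beta> ` K) = restrict J' (U - \<beta> ` K)"
    have "I u = I' u" if "u \<in> U" for u
    proof (cases "u \<in> \<alpha> ` K")
      case True
      then obtain c where "c \<in> K" "u = \<alpha> c" by auto
      then show ?thesis using fun_cong[OF eqs(1), of c] by simp
    next
      case False
      then show ?thesis using fun_cong[OF eqs(3), of u] that by simp
    qed
    moreover have "J u = J' u" if "u \<in> U" for u
    proof (cases "u \<in> \<beta> ` K")
      case True
      then obtain c where "c \<in> K" "u = \<beta> c" by auto
      then show ?thesis using fun_cong[OF eqs(2), of c] by simp
    next
      case False
      then show ?thesis using fun_cong[OF eqs(4), of u] that by simp
    qed
    ultimately show "I = I' \<and> J = J'" using ext by (auto intro: extensionalityI)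
  qed
  have "card ?S \<le> card ?R"
    by (rule card_inj_on_le[OF inj]) (use assms in \<open>auto intro!: finite_PiE\<close>)
  also have "\<dots> = card Z * (card V ^ (card U - card K) * card V ^ (card U - card K))"
    using assms by (simp add: card_cartesian_product card_PiE card_Diff_subset finite_subset card_image)
  finally show ?thesis by (simp add: mult_2 power_add)
qed

text \<open>An exponential moment argument: if many values \<open>\<pi> i\<close> fell into the
  small sets \<open>X z i\<close>, then \<open>A\<close> would have to be small. The sets may depend
  on extra data \<open>z\<close>, at the price \<open>ln (card Z)\<close>.\<close>

lemma moment_bound:
  fixes A :: "('z \<times> ('a \<Rightarrow> 'a)) set" and X :: "'z \<Rightarrow> 'a \<Rightarrow> 'a set" and \<kappa> :: real
  assumes V: "finite V" "V \<noteq> {}" and Z: "finite Z" and A: "finite A" "A \<noteq> {}"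
    and maps: "\<And>z \<pi>. (z, \<pi>) \<in> A \<Longrightarrow> z \<in> Z \<and> \<pi> permutes V"
    and \<kappa>: "1 \<le> \<kappa>"
    and X: "\<And>z i. z \<in> Z \<Longrightarrow> i \<in> V \<Longrightarrow> X z i \<subseteq> V \<and> \<kappa> * real (card (X z i)) \<le> real (card V)"
  shows "(\<Sum>(z, \<pi>)\<in>A. real (card {i\<in>V. \<pi> i \<in> X z i})) * ln \<kappa>
     \<le> real (card A) * (ln (real (card Z)) + real (card V) * ln (2 * real (card V)) - ln (real (card A)))"
proof -
  define N where "N = real (card V)"
  define cnt where "cnt z \<pi> = card {i\<in>V. \<pi> i \<in> X z i}" for z and \<pi> :: "'a \<Rightarrow> 'a"
  define a where "a = (\<Sum>(z, \<pi>)\<in>A. real (cnt z \<pi>)) * ln \<kappa> / real (card A)"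
  have posA: "0 < real (card A)" using A by (simp add: card_gt_0_iff)
  have Zne: "Z \<noteq> {}" using A maps by fastforce
  have posZ: "0 < real (card Z)" using Z Zne by (simp add: card_gt_0_iff)
  have N: "0 < N" using V by (simp add: N_def card_gt_0_iff)
  have wt: "(\<Prod>i\<in>V. if \<pi> i \<in> X z i then \<kappa> else 1) = \<kappa> ^ cnt z \<pi>" for z \<pi>
    using V(1) by (simp add: prod.If_cases cnt_def Int_def)
  have inj: "inj_on (\<lambda>(z, \<pi>). (z, restrict \<pi> V)) A"
  proof (rule inj_onI)
    fix p p' assume pA: "p \<in> A" "p' \<in> A" and eq: "(case p of (z, \<pi>) \<Rightarrow> (z, restrict \<pi> V)) = (case p' of (z, \<pi>) \<Rightarrow> (z, restrict \<pi> V))"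
    obtain z \<pi> z' \<pi>' where p: "p = (z, \<pi>)" "p' = (z', \<pi>')" by fastforce
    have perm: "\<pi> permutes V" "\<pi>' permutes V" and eq': "restrict \<pi> V = restrict \<pi>' V" "z = z'"
      using pA eq maps by (auto simp: p)
    have "\<pi> i = \<pi>' i" for i
      using fun_cong[OF eq'(1), of i] perm by (cases "i \<in> V") (auto simp: permutes_not_in)
    then show "p = p'" using eq'(2) by (auto simp: p)
  qed
  have cnt_restrict: "cnt z (restrict \<pi> V) = cnt z \<pi>" for z \<pi>
    unfolding cnt_def by (rule arg_cong[of _ _ card]) auto
  have "(\<Sum>(z, \<pi>)\<in>A. \<kappa> ^ cnt z \<pi>) = (\<Sum>(z, f)\<in>(\<lambda>(z, \<pi>). (z, restrict \<pi> V)) ` A. \<kappa> ^ cnt z f)"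
    by (subst sum.reindex[OF inj]) (simp add: case_prod_unfold cnt_restrict)
  \<comment> \<open>Dropping bijectivity makes the sum factor over the points of \<open>V\<close>;
    each factor is at most \<open>\<kappa> * card (X z i) + card V\<close>, hence at most
    \<open>2 * N\<close>.\<close>
  also have "\<dots> \<le> (\<Sum>(z, f)\<in>Z \<times> (V \<rightarrow>\<^sub>E V). \<kappa> ^ cnt z f)"
    using Z V maps \<kappa> by (intro sum_mono2) (auto simp: finite_PiE permutes_in_image)
  also have "\<dots> = (\<Sum>z\<in>Z. \<Sum>f\<in>V \<rightarrow>\<^sub>E V. \<Prod>i\<in>V. if f i \<in> X z i then \<kappa> else 1)"
    by (simp add: wt sum.cartesian_product)
  also have "\<dots> = (\<Sum>z\<in>Z. \<Prod>i\<in>V. \<Sum>j\<in>V. if j \<in> X z i then \<kappa> else 1)"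
    using V by (subst prod_sum_PiE) auto
  also have "\<dots> \<le> (\<Sum>z\<in>Z. \<Prod>i\<in>V. 2 * N)"
  proof (rule sum_mono, rule prod_mono)
    fix z i assume z: "z \<in> Z" and i: "i \<in> V"
    have "(\<Sum>j\<in>V. if j \<in> X z i then \<kappa> else 1) = \<kappa> * real (card (X z i)) + real (card (V - X z i))"
      using V X[OF z i] by (simp add: sum.If_cases Int_absorb1 Diff_eq)
    also have "\<dots> \<le> N + N"
      using X[OF z i] V by (intro add_mono) (auto simp: N_def intro: card_mono)
    finally show "0 \<le> (\<Sum>j\<in>V. if j \<in> X z i then \<kappa> else 1) \<and>
        (\<Sum>j\<in>V. if j \<in> X z i then \<kappa> else 1) \<le> 2 * N"
      using \<kappa> by (auto intro!: sum_nonneg)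
  qed
  also have "\<dots> = real (card Z) * (2 * N) ^ card V" by simp
  finally have upper: "(\<Sum>(z, \<pi>)\<in>A. \<kappa> ^ cnt z \<pi>) \<le> real (card Z) * (2 * N) ^ card V" .
  \<comment> \<open>\<open>a\<close> is the mean of \<open>cnt z \<pi> * ln \<kappa>\<close> over
    \<open>A\<close>. The tangent of \<open>exp\<close> at \<open>a\<close> averages to
    \<open>exp a\<close> and lies below the moment: Jensen's inequality.\<close>
  have "real (card A) * exp a = (\<Sum>(z, \<pi>)\<in>A. exp a * (1 + (real (cnt z \<pi>) * ln \<kappa> - a)))"
  proof -
    have "(\<Sum>(z, \<pi>)\<in>A. exp a * (1 + (real (cnt z \<pi>) * ln \<kappa> - a)))
        = exp a * (real (card A) + ((\<Sum>(z, \<pi>)\<in>A. real (cnt z \<pi>)) * ln \<kappa> - real (card A) * a))"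
      by (simp add: case_prod_unfold sum.distrib sum_subtractf flip: sum_distrib_left sum_distrib_right)
    also have "real (card A) * a = (\<Sum>(z, \<pi>)\<in>A. real (cnt z \<pi>)) * ln \<kappa>"
      using posA by (simp add: a_def)
    finally show ?thesis by simp
  qed
  also have "\<dots> \<le> (\<Sum>(z, \<pi>)\<in>A. \<kappa> ^ cnt z \<pi>)"
  proof (rule sum_mono)
    fix p assume "p \<in> A"
    obtain z \<pi> where p: "p = (z, \<pi>)" by fastforce
    have "exp a * (1 + (real (cnt z \<pi>) * ln \<kappa> - a)) \<le> exp a * exp (real (cnt z \<pi>) * ln \<kappa> - a)"
      by (intro mult_left_mono exp_ge_add_one_self) auto
    also have "\<dots> = \<kappa> ^ cnt z \<pi>"
      using \<kappa> by (simp add: exp_of_nat_mult flip: exp_add)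
    finally show "(case p of (z, \<pi>) \<Rightarrow> exp a * (1 + (real (cnt z \<pi>) * ln \<kappa> - a))) \<le> (case p of (z, \<pi>) \<Rightarrow> \<kappa> ^ cnt z \<pi>)"
      by (simp add: p)
  qed
  also note upper
  finally have "ln (real (card A) * exp a) \<le> ln (real (card Z) * (2 * N) ^ card V)"
    using posA posZ N by (subst ln_le_cancel_iff) auto
  then have "a \<le> ln (real (card Z)) + real (card V) * ln (2 * N) - ln (real (card A))"
    using posA posZ N by (simp add: ln_mult ln_realpow algebra_simps)
  then have "real (card A) * a \<le> real (card A) * (ln (real (card Z)) + real (card V) * ln (2 * N) - ln (real (card A)))"
    using posA by (intro mult_left_mono) auto
  then show ?thesis using posA by (simp add: a_def cnt_def N_def)
qed

section \<open>Random alternating walks and the cycles they close\<close>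

lemma sum_PiE_coordinate:
  fixes g :: "'w \<Rightarrow> real"
  assumes "finite W" "c < T"
  shows "(\<Sum>\<omega>\<in>{..<T} \<rightarrow>\<^sub>E W. g (\<omega> c)) = real (card W) ^ (T - 1) * (\<Sum>w\<in>W. g w)"
proof -
  have "(\<Sum>\<omega>\<in>{..<T} \<rightarrow>\<^sub>E W. g (\<omega> c))
      = (\<Sum>\<omega>\<in>{..<T} \<rightarrow>\<^sub>E W. \<Prod>t<T. if t = c then g (\<omega> t) else 1)"
    using assms(2) by simp
  also have "\<dots> = (\<Prod>t<T. \<Sum>w\<in>W. if t = c then g w else 1)"
    using assms(1) by (subst prod_sum_PiE) auto
  also have "\<dots> = (\<Sum>w\<in>W. g w) * (\<Prod>t\<in>{..<T} - {c}. real (card W))"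
    using assms(2) by (subst prod.remove[of _ c]) auto
  finally show ?thesis using assms(2) by simp
qed

text \<open>The sizes add up to the total multiplicity of the points. A point covered at most once
  contributes at most 1, any other one at most \<open>T\<close>.\<close>

lemma card_multiply_covered:
  fixes Sl :: "nat \<Rightarrow> 'a set"
  assumes V: "finite V" and "\<And>c. c < T \<Longrightarrow> Sl c \<subseteq> V" and large: "2 * card V \<le> (\<Sum>c<T. card (Sl c))"
  shows "card V \<le> T * card {x\<in>V. \<exists>b b'. b < b' \<and> b' < T \<and> x \<in> Sl b \<and> x \<in> Sl b'}"
proof -
  define M where "M = {x\<in>V. \<exists>b b'. b < b' \<and> b' < T \<and> x \<in> Sl b \<and> x \<in> Sl b'}"
  have "(\<Sum>c<T. card (Sl c)) = (\<Sum>c<T. \<Sum>x\<in>V. of_bool (x \<in> Sl c))"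
    using assms by (intro sum.cong) (auto simp: Int_absorb1)
  also have "\<dots> = (\<Sum>x\<in>V. card {c\<in>{..<T}. x \<in> Sl c})"
    by (subst sum.swap) (simp add: Int_def)
  also have "\<dots> \<le> (\<Sum>x\<in>V. 1 + T * of_bool (x \<in> M))"
  proof (rule sum_mono)
    fix x assume x: "x \<in> V"
    show "card {c\<in>{..<T}. x \<in> Sl c} \<le> 1 + T * of_bool (x \<in> M)"
    proof (cases "x \<in> M")
      case True
      have "card {c\<in>{..<T}. x \<in> Sl c} \<le> card {..<T}" by (intro card_mono) auto
      then show ?thesis using True by simp
    next
      case False
      have "card {c\<in>{..<T}. x \<in> Sl c} \<le> 1"
      proof (rule ccontr)
        assume "\<not> card {c\<in>{..<T}. x \<in> Sl c} \<le> 1"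
        then obtain b b' where "b < T" "b' < T" "x \<in> Sl b" "x \<in> Sl b'" "b \<noteq> b'"
          by (auto simp: card_le_Suc0_iff_eq)
        then show False using False x by (cases b b' rule: linorder_cases) (auto simp: M_def)
      qed
      then show ?thesis by simp
    qed
  qed
  also have "\<dots> = card V + T * card M"
  proof -
    have "(\<Sum>x\<in>V. of_bool (x \<in> M)) = card M"
      using V by (simp add: M_def Int_def)
    then show ?thesis
      by (simp only: sum.distrib sum_distrib_left[symmetric] card_eq_sum)
  qed
  finally show ?thesis using large by (simp add: M_def)
qed

text \<open>Every step uses a fresh pair of permutations. The intermediate vertex after
  \<open>walk \<omega> i c\<close> is \<open>fst (\<omega> c) (walk \<omega> i c)\<close>.\<close>

primrec walk :: "(nat \<Rightarrow> ('a \<Rightarrow> 'b) \<times> ('b \<Rightarrow> 'a)) \<Rightarrow> 'a \<Rightarrow> nat \<Rightarrow> 'a" where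
  "walk \<omega> i 0 = i"
| "walk \<omega> i (Suc c) = snd (\<omega> c) (fst (\<omega> c) (walk \<omega> i c))"

lemma bij_betw_walk:
  assumes "\<And>t. t < c \<Longrightarrow> fst (\<omega> t) permutes V \<and> snd (\<omega> t) permutes V"
  shows "bij_betw (\<lambda>i. walk \<omega> i c) V V"
  using assms
proof (induction c)
  case 0
  show ?case by (simp add: bij_betw_def)
next
  case (Suc c)
  have "bij_betw (\<lambda>i. walk \<omega> i c) V V" using Suc by simp
  moreover have "bij_betw (fst (\<omega> c)) V V" "bij_betw (snd (\<omega> c)) V V"
    using Suc.prems by (auto intro: permutes_imp_bij)
  ultimately have "bij_betw (snd (\<omega> c) \<circ> (fst (\<omega> c) \<circ> (\<lambda>i. walk \<omega> i c))) V V"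
    by (intro bij_betw_trans)
  then show ?case by (simp add: comp_def)
qed

text \<open>For fixed \<open>\<omega>\<close> the position at time \<open>c\<close> is a bijective
  function of the start and is determined by the pairs before \<open>\<omega> c\<close>. So position
  and next pair are jointly uniform at every time.\<close>

lemma sum_walk_stationary:
  fixes h :: "'a \<Rightarrow> ('a \<Rightarrow> 'a) \<times> ('a \<Rightarrow> 'a) \<Rightarrow> real"
  assumes "finite W" "\<And>w. w \<in> W \<Longrightarrow> fst w permutes V \<and> snd w permutes V" "c < T"
  shows "(\<Sum>\<omega>\<in>{..<T} \<rightarrow>\<^sub>E W. \<Sum>i\<in>V. h (walk \<omega> i c) (\<omega> c))
       = real (card W) ^ (T - 1) * (\<Sum>w\<in>W. \<Sum>i\<in>V. h i w)"
proof -
  have "(\<Sum>i\<in>V. h (walk \<omega> i c) (\<omega> c)) = (\<Sum>i\<in>V. h i (\<omega> c))" if "\<omega> \<in> {..<T} \<rightarrow>\<^sub>E W" for \<omega>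
  proof -
    have "fst (\<omega> t) permutes V \<and> snd (\<omega> t) permutes V" if "t < c" for t
      using that \<open>\<omega> \<in> _\<close> assms(2,3) by (auto simp: PiE_iff)
    then show ?thesis by (intro sum.reindex_bij_betw[of "\<lambda>i. walk \<omega> i c"] bij_betw_walk)
  qed
  then show ?thesis using sum_PiE_coordinate[OF assms(1,3), of "\<lambda>w. \<Sum>i\<in>V. h i w"] by simp
qed

lemma walk_funpow:
  assumes "\<And>c. a \<le> c \<Longrightarrow> c < b \<Longrightarrow> g (x c) = x (Suc c)" "a \<le> b"
  shows "(g ^^ (b - a)) (x a) = x b"
  using assms(2,1)
proof (induction b rule: dec_induct)
  case base
  show ?case by simp
next
  case (step b)
  have "(g ^^ (Suc b - a)) (x a) = g ((g ^^ (b - a)) (x a))"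
    using step.hyps by (simp add: Suc_diff_le)
  also have "\<dots> = x (Suc b)" using step by simp
  finally show ?case .
qed

text \<open>If neither sequence were unlikely, some \<open>\<pi>\<close> and \<open>\<rho>\<close>
  would realise all edges, and \<open>\<rho> \<circ> \<pi>\<close> would have a cycle of length
  \<open>b - a + 1\<close>, at most \<open>T\<close>. The maps \<open>\<beta>\<close> and
  \<open>\<alpha>\<close> close the cycle at index \<open>b\<close>: the forward edge leads to the
  extra vertex \<open>J T\<close>, and from there back to \<open>I a\<close>.\<close>

lemma no_return_imp_unlikely:
  fixes Q S :: "('a \<Rightarrow> 'a) set"
  assumes \<tau>: "0 < \<tau>" and ne: "finite Q" "Q \<noteq> {}" "finite S" "S \<noteq> {}"
    and acyclic: "\<And>\<pi> \<rho> i s. \<pi> \<in> Q \<Longrightarrow> \<rho> \<in> S \<Longrightarrow> i \<in> V \<Longrightarrow> 0 < s \<Longrightarrow> s \<le> T \<Longrightarrow> ((\<rho> \<circ> \<pi>) ^^ s) i \<noteq> i"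
    and ab: "a \<le> b" "b < T" and I: "I \<in> {..T} \<rightarrow>\<^sub>E V" and J: "J \<in> {..T} \<rightarrow>\<^sub>E V"
    and heavyQ: "\<And>c. a \<le> c \<Longrightarrow> c < b \<Longrightarrow> \<tau> \<le> edge_prob Q (I c, J c)" "\<tau> \<le> edge_prob Q (I b, J T)"
    and heavyS: "\<And>c. a \<le> c \<Longrightarrow> c < b \<Longrightarrow> \<tau> \<le> edge_prob S (J c, I (Suc c))" "\<tau> \<le> edge_prob S (J T, I a)"
  defines "\<beta> \<equiv> \<lambda>c. if c = b then T else c" and "\<alpha> \<equiv> \<lambda>c. if c = b then a else Suc c"
  shows "(\<lambda>c\<in>{a..b}. I c, \<lambda>c\<in>{a..b}. J (\<beta> c)) \<in> unlikely_heavy V \<tau> Q {a..b} \<or>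
         (\<lambda>c\<in>{a..b}. J (\<beta> c), \<lambda>c\<in>{a..b}. I (\<alpha> c)) \<in> unlikely_heavy V \<tau> S {a..b}"
proof (rule ccontr)
  let ?I = "\<lambda>c\<in>{a..b}. I c" and ?J = "\<lambda>c\<in>{a..b}. J (\<beta> c)" and ?I' = "\<lambda>c\<in>{a..b}. I (\<alpha> c)"
  assume neg: "\<not> ((?I, ?J) \<in> unlikely_heavy V \<tau> Q {a..b} \<or> (?J, ?I') \<in> unlikely_heavy V \<tau> S {a..b})"
  have mem: "?I \<in> {a..b} \<rightarrow>\<^sub>E V" "?J \<in> {a..b} \<rightarrow>\<^sub>E V" "?I' \<in> {a..b} \<rightarrow>\<^sub>E V"
    using I J ab by (auto simp: \<alpha>_def \<beta>_def PiE_iff)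
  have "\<forall>c\<in>{a..b}. \<tau> \<le> edge_prob Q (?I c, ?J c)" "\<forall>c\<in>{a..b}. \<tau> \<le> edge_prob S (?J c, ?I' c)"
    using heavyQ heavyS by (auto simp: \<alpha>_def \<beta>_def)
  with neg mem have "(\<tau> / 2) ^ card {a..b} * real (card Q) \<le> real (card (extending Q {a..b} ?I ?J))"
    "(\<tau> / 2) ^ card {a..b} * real (card S) \<le> real (card (extending S {a..b} ?J ?I'))"
    unfolding unlikely_heavy_def by auto
  moreover have "0 < (\<tau> / 2) ^ card {a..b} * real (card Q)" "0 < (\<tau> / 2) ^ card {a..b} * real (card S)"
    using \<tau> ne by (auto simp: card_gt_0_iff)
  ultimately have "card (extending Q {a..b} ?I ?J) \<noteq> 0" "card (extending S {a..b} ?J ?I') \<noteq> 0"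
    by linarith+
  then obtain \<pi> \<rho> where "\<pi> \<in> extending Q {a..b} ?I ?J" "\<rho> \<in> extending S {a..b} ?J ?I'"
    by (metis card.empty equals0I)
  then have \<pi>: "\<pi> \<in> Q" "\<And>c. a \<le> c \<Longrightarrow> c \<le> b \<Longrightarrow> \<pi> (I c) = J (\<beta> c)"
    and \<rho>: "\<rho> \<in> S" "\<And>c. a \<le> c \<Longrightarrow> c \<le> b \<Longrightarrow> \<rho> (J (\<beta> c)) = I (\<alpha> c)"
    by (auto simp: extending_def)
  have "((\<rho> \<circ> \<pi>) ^^ (b - a)) (I a) = I b"
    by (rule walk_funpow) (use \<pi> \<rho> ab in \<open>auto simp: \<alpha>_def\<close>)
  moreover have "(\<rho> \<circ> \<pi>) (I b) = I a" using \<pi>(2)[of b] \<rho>(2)[of b] ab by (simp add: \<alpha>_def)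
  ultimately have "((\<rho> \<circ> \<pi>) ^^ Suc (b - a)) (I a) = I a" by simp
  moreover have "I a \<in> V" using I ab by auto
  moreover have "Suc (b - a) \<le> T" using ab by linarith
  ultimately show False using acyclic[OF \<pi>(1) \<rho>(1), of "I a" "Suc (b - a)"] by blast
qed

text \<open>To be compared with the \<open>card V ^ (2 * T + 2)\<close> pairs of sequences in all:
  the unlikely ones are fewer by about \<open>card V ^ 2 / (\<gamma> * ln (card V))\<close>, apart
  from factors depending on \<open>T\<close> and \<open>\<theta>\<close> only.\<close>

lemma card_closed_unlikely:
  assumes family: "stable_family V Q (\<theta> / real (card V)) \<gamma>" and \<theta>: "0 < \<theta>" "\<theta> \<le> 1"
    and ab: "a \<le> b" "b < T"
    and \<alpha>: "inj_on \<alpha> {a..b}" "\<alpha> ` {a..b} \<subseteq> {..T}" and \<beta>: "inj_on \<beta> {a..b}" "\<beta> ` {a..b} \<subseteq> {..T}"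
  shows "real (card {(I, J) \<in> ({..T} \<rightarrow>\<^sub>E V) \<times> ({..T} \<rightarrow>\<^sub>E V).
            (\<lambda>c\<in>{a..b}. I (\<alpha> c), \<lambda>c\<in>{a..b}. J (\<beta> c)) \<in> unlikely_heavy V (\<theta> / real (card V)) Q {a..b}})
        \<le> real T ^ 2 * (2 * \<gamma> * ln (real (card V))) * (2 / \<theta>) ^ T * real (card V) ^ (2 * T)"
    (is "real (card ?S) \<le> _")
proof -
  interpret stable_family V Q "\<theta> / real (card V)" \<gamma> by (rule family)
  define N where "N = real (card V)"
  define k where "k = card {a..b}"
  define Z where "Z = unlikely_heavy V (\<theta> / N) Q {a..b}"
  have k: "1 \<le> k" "k \<le> T" using ab by (auto simp: k_def)
  have N: "1 \<le> N" using V by (simp add: N_def Suc_le_eq card_gt_0_iff)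
  have finZ: "finite Z"
    by (rule finite_subset[of _ "({a..b} \<rightarrow>\<^sub>E V) \<times> ({a..b} \<rightarrow>\<^sub>E V)"])
       (use V in \<open>auto simp: Z_def unlikely_heavy_def finite_PiE\<close>)
  have "card ?S \<le> card Z * card V ^ (2 * (card {..T} - k))"
    unfolding Z_def N_def k_def
    by (rule card_PiE_pairs_reindexed) (use V \<alpha> \<beta> finZ in \<open>auto simp: Z_def N_def\<close>)
  then have "real (card ?S) \<le> real (card Z * card V ^ (2 * (card {..T} - k)))" by (rule of_nat_mono)
  \<comment> \<open>The sequences have \<open>T + 1\<close> entries, so \<open>T - k + 1\<close> of
    each are free. The resulting extra \<open>N ^ 2\<close> is just what
    \<open>card_unlikely_heavy\<close> absorbs.\<close>
  also have "\<dots> = real (card Z) * N ^ (2 * (T - k) + 2)"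
    using k by (simp add: N_def Suc_diff_le)
  also have "\<dots> = (real (card Z) * N ^ 2) * N ^ (2 * (T - k))"
    by (simp add: power_add power2_eq_square mult_ac)
  also have "\<dots> \<le> real k ^ 2 * (2 * \<gamma> * ln N) * (2 * N / (\<theta> / N)) ^ k * N ^ (2 * (T - k))"
    unfolding Z_def N_def k_def
    by (intro mult_right_mono card_unlikely_heavy) (use \<theta> N in \<open>auto simp: N_def\<close>)
  also have "(2 * N / (\<theta> / N)) ^ k = (2 / \<theta>) ^ k * N ^ (2 * k)"
    by (simp add: power_mult_distrib power_divide power2_eq_square power_mult)
  also have "real k ^ 2 * (2 * \<gamma> * ln N) * ((2 / \<theta>) ^ k * N ^ (2 * k)) * N ^ (2 * (T - k))
      = real k ^ 2 * (2 * \<gamma> * ln N) * (2 / \<theta>) ^ k * (N ^ (2 * k) * N ^ (2 * (T - k)))"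
    by simp
  also have "N ^ (2 * k) * N ^ (2 * (T - k)) = N ^ (2 * T)"
    using k by (simp flip: power_add add_mult_distrib2)
  also have "real k ^ 2 * (2 * \<gamma> * ln N) * (2 / \<theta>) ^ k * N ^ (2 * T)
      \<le> real T ^ 2 * (2 * \<gamma> * ln N) * (2 / \<theta>) ^ T * N ^ (2 * T)"
    using k N \<theta> \<gamma> by (intro mult_right_mono mult_mono power_mono power_increasing) auto
  finally show ?thesis by (simp only: N_def)
qed

section \<open>Short cycles through two dense sets of permutations\<close>

definition heavy_out :: "'a set \<Rightarrow> real \<Rightarrow> ('a \<Rightarrow> 'a) set \<Rightarrow> 'a \<Rightarrow> 'a set" where
  "heavy_out V \<tau> Q i = {x\<in>V. \<tau> \<le> edge_prob Q (i, x)}"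

definition heavy_in :: "'a set \<Rightarrow> real \<Rightarrow> ('a \<Rightarrow> 'a) set \<Rightarrow> 'a \<Rightarrow> 'a set" where
  "heavy_in V \<tau> S i = {x\<in>V. \<tau> \<le> edge_prob S (x, i)}"

text \<open>The lower bounds make the edges of the walk heavy. The upper bounds limit how many
  sequences of permutations can follow one and the same walk.\<close>

definition typical_step :: "real \<Rightarrow> real \<Rightarrow> ('a \<Rightarrow> 'a) set \<Rightarrow> ('a \<Rightarrow> 'a) set \<Rightarrow>
    ('a \<Rightarrow> 'a) \<times> ('a \<Rightarrow> 'a) \<Rightarrow> 'a \<Rightarrow> bool" where
  "typical_step \<tau> \<mu> Q S w i \<longleftrightarrow>
     edge_prob Q (i, fst w i) \<in> {\<tau>..\<mu>} \<and> edge_prob S (fst w i, snd w (fst w i)) \<in> {\<tau>..\<mu>}"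

text \<open>\<open>X\<close> holds the vertices joined by heavy edges to both end points of the
  step. Requiring \<open>fst w i\<close> to lie in it makes thinness the event of hitting a small
  set, which \<open>moment_bound\<close> controls; for a typical step this requirement holds
  anyway.\<close>

definition thin_step :: "'a set \<Rightarrow> real \<Rightarrow> nat \<Rightarrow> ('a \<Rightarrow> 'a) set \<Rightarrow> ('a \<Rightarrow> 'a) set \<Rightarrow>
    ('a \<Rightarrow> 'a) \<times> ('a \<Rightarrow> 'a) \<Rightarrow> 'a \<Rightarrow> bool" where
  "thin_step V \<tau> T Q S w i \<longleftrightarrow>
     (let X = heavy_out V \<tau> Q i \<inter> heavy_in V \<tau> S (snd w (fst w i))
      in T * card X \<le> 4 * card V \<and> fst w i \<in> X)"

lemma sum_of_bool_card:
  "finite A \<Longrightarrow> (\<Sum>x\<in>A. of_bool (P x)) = real (card {x\<in>A. P x})"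
  by (simp add: Int_def)

text \<open>Double counting of triples: a sequence of permutation pairs, a start, and a vertex
  closing a short cycle. Good walks have at least \<open>card V / T\<close> closing vertices each.
  Every closed walk is an unlikely sequence for \<open>Q\<close> or for \<open>S\<close>, so few
  closed walks occur, and each comes from few sequences of permutations.\<close>

lemma no_return_bound:
  fixes V :: "'a set" and Q S :: "('a \<Rightarrow> 'a) set"
  assumes families: "stable_family V Q (\<theta> / real (card V)) \<gamma>" "stable_family V S (\<theta> / real (card V)) \<gamma>"
    and \<theta>: "0 < \<theta>" "\<theta> \<le> 1" and \<kappa>: "0 < \<kappa>" and T: "1 \<le> T"
    and no_return: "\<And>\<pi> \<rho> i s. \<pi> \<in> Q \<Longrightarrow> \<rho> \<in> S \<Longrightarrow> i \<in> V \<Longrightarrow> 0 < s \<Longrightarrow> s \<le> T \<Longrightarrow> ((\<rho> \<circ> \<pi>) ^^ s) i \<noteq> i"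
    and untypical: "(\<Sum>w\<in>Q \<times> S. real (card {i\<in>V. \<not> typical_step (\<theta> / real (card V)) (\<kappa> / real (card V)) Q S w i}))
        \<le> real (card V) * real (card (Q \<times> S)) / (8 * real T)"
    and thin: "(\<Sum>w\<in>Q \<times> S. real (card {i\<in>V. thin_step V (\<theta> / real (card V)) T Q S w i}))
        \<le> real (card V) * real (card (Q \<times> S)) / 8"
  shows "real (card V) ^ 2 \<le> 8 * real T ^ 5 * \<gamma> * ln (real (card V)) * (2 / \<theta>) ^ T * \<kappa> ^ (2 * T)"
proof -
  interpret stable_family V Q "\<theta> / real (card V)" \<gamma> by (rule families)
  interpret S: stable_family V S "\<theta> / real (card V)" \<gamma> by (rule families)
  note S = S.Q
  define N where "N = real (card V)"
  define \<tau> where "\<tau> = \<theta> / N"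
  define \<mu> where "\<mu> = \<kappa> / N"
  define W where "W = Q \<times> S"
  define w where "w = real (card W)"
  define \<Omega> where "\<Omega> = {..<T} \<rightarrow>\<^sub>E W"
  define unt where "unt c \<omega> i \<longleftrightarrow> \<not> typical_step \<tau> \<mu> Q S (\<omega> c) (walk \<omega> i c)" for c and \<omega> :: "nat \<Rightarrow> ('a \<Rightarrow> 'a) \<times> ('a \<Rightarrow> 'a)" and i
  define thn where "thn c \<omega> i \<longleftrightarrow> thin_step V \<tau> T Q S (\<omega> c) (walk \<omega> i c)" for c and \<omega> :: "nat \<Rightarrow> ('a \<Rightarrow> 'a) \<times> ('a \<Rightarrow> 'a)" and i
  define B1 where "B1 = {(\<omega>, i) \<in> \<Omega> \<times> V. \<exists>c<T. unt c \<omega> i}"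
  define B2 where "B2 = {(\<omega>, i) \<in> \<Omega> \<times> V. T < 2 * card {c\<in>{..<T}. thn c \<omega> i}}"
  define G where "G = \<Omega> \<times> V - (B1 \<union> B2)"
  have N: "1 \<le> N" using V by (simp add: N_def Suc_le_eq card_gt_0_iff)
  have finW: "finite W" and W_perm: "\<And>v. v \<in> W \<Longrightarrow> fst v permutes V \<and> snd v permutes V"
    and w: "0 < w"
    using Q S by (auto simp: W_def w_def card_gt_0_iff)
  have fin\<Omega>: "finite \<Omega>" using finW by (simp add: \<Omega>_def finite_PiE)
  have card\<Omega>: "real (card \<Omega>) = w ^ T" by (simp add: \<Omega>_def w_def card_PiE)
  have w_pow: "w ^ (T - 1) * w = w ^ T" using T by (simp flip: power_Suc2)
  have walk_in: "walk \<omega> i c \<in> V" if "\<omega> \<in> \<Omega>" "i \<in> V" "c \<le> T" for \<omega> i c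
  proof -
    have "bij_betw (\<lambda>i. walk \<omega> i c) V V"
      using that W_perm by (intro bij_betw_walk) (auto simp: \<Omega>_def PiE_iff)
    then show ?thesis using that(2) by (auto simp: bij_betw_def)
  qed
  \<comment> \<open>By stationarity, a property of single steps has the same frequency at all times
    as for a uniform step.\<close>
  have step_count: "(\<Sum>c<T. real (card {(\<omega>, i) \<in> \<Omega> \<times> V. P (\<omega> c) (walk \<omega> i c)})) \<le> T * (w ^ (T - 1) * X)"
    if "(\<Sum>v\<in>W. real (card {i\<in>V. P v i})) \<le> X" for P X
  proof -
    have "real (card {(\<omega>, i) \<in> \<Omega> \<times> V. P (\<omega> c) (walk \<omega> i c)}) \<le> w ^ (T - 1) * X" if c: "c < T" for c
    proof -
      have "real (card {(\<omega>, i) \<in> \<Omega> \<times> V. P (\<omega> c) (walk \<omega> i c)})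
          = (\<Sum>(\<omega>, i)\<in>\<Omega> \<times> V. of_bool (P (\<omega> c) (walk \<omega> i c)))"
        using fin\<Omega> V by (simp add: case_prod_unfold Int_def mem_Times_iff)
      also have "\<dots> = (\<Sum>\<omega>\<in>\<Omega>. \<Sum>i\<in>V. of_bool (P (\<omega> c) (walk \<omega> i c)))"
        by (simp add: sum.cartesian_product)
      also have "\<dots> = w ^ (T - 1) * (\<Sum>v\<in>W. \<Sum>i\<in>V. of_bool (P v i))"
        unfolding \<Omega>_def w_def by (rule sum_walk_stationary[OF finW W_perm c])
      also have "\<dots> \<le> w ^ (T - 1) * X"
        using that V w \<open>(\<Sum>v\<in>W. real (card {i\<in>V. P v i})) \<le> X\<close>
        by (intro mult_left_mono) (simp_all add: Int_def)
      finally show ?thesis .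
    qed
    then have "(\<Sum>c<T. real (card {(\<omega>, i) \<in> \<Omega> \<times> V. P (\<omega> c) (walk \<omega> i c)})) \<le> (\<Sum>c<T. w ^ (T - 1) * X)"
      by (intro sum_mono) auto
    then show ?thesis by simp
  qed
  have finB: "finite B1" "finite B2" "finite G"
  proof -
    have fin: "finite (\<Omega> \<times> V)" using fin\<Omega> V by simp
    have "B1 \<subseteq> \<Omega> \<times> V" "B2 \<subseteq> \<Omega> \<times> V" "G \<subseteq> \<Omega> \<times> V"
      by (auto simp: B1_def B2_def G_def)
    then show "finite B1" "finite B2" "finite G" using fin by (meson finite_subset)+
  qed
  \<comment> \<open>A union bound over the \<open>T\<close> steps, which is why untypical steps are
    allowed the frequency 1/(8T) only.\<close>
  have cardB1: "8 * real (card B1) \<le> N * w ^ T"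
  proof -
    have "B1 = (\<Union>c\<in>{..<T}. {(\<omega>, i) \<in> \<Omega> \<times> V. unt c \<omega> i})" by (auto simp: B1_def)
    then have "card B1 \<le> (\<Sum>c<T. card {(\<omega>, i) \<in> \<Omega> \<times> V. unt c \<omega> i})"
      by (simp add: card_UN_le)
    then have "real (card B1) \<le> real (\<Sum>c<T. card {(\<omega>, i) \<in> \<Omega> \<times> V. unt c \<omega> i})" by (rule of_nat_mono)
    also have "\<dots> = (\<Sum>c<T. real (card {(\<omega>, i) \<in> \<Omega> \<times> V. unt c \<omega> i}))" by simp
    also have "\<dots> \<le> T * (w ^ (T - 1) * (N * w / (8 * real T)))"
      unfolding unt_def by (rule step_count) (use untypical in \<open>simp add: N_def W_def w_def \<tau>_def \<mu>_def\<close>)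
    also have "\<dots> = N * w ^ T / 8" using T by (simp add: w_pow[symmetric])
    finally show ?thesis by simp
  qed
  \<comment> \<open>Markov's inequality: thin steps have frequency at most 1/8, so at most a quarter
    of the walks have more than half of their steps thin.\<close>
  have cardB2: "4 * real (card B2) \<le> N * w ^ T"
  proof -
    have "real T * real (card B2) = (\<Sum>(\<omega>, i)\<in>B2. real T)" by (simp add: case_prod_unfold)
    also have "\<dots> \<le> (\<Sum>(\<omega>, i)\<in>B2. 2 * real (card {c\<in>{..<T}. thn c \<omega> i}))"
      by (intro sum_mono) (auto simp: B2_def)
    also have "\<dots> \<le> (\<Sum>(\<omega>, i)\<in>\<Omega> \<times> V. 2 * real (card {c\<in>{..<T}. thn c \<omega> i}))"
      using fin\<Omega> V by (intro sum_mono2) (auto simp: B2_def)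
    also have "\<dots> = 2 * (\<Sum>(\<omega>, i)\<in>\<Omega> \<times> V. \<Sum>c<T. of_bool (thn c \<omega> i))"
      by (simp only: case_prod_unfold sum_distrib_left sum_of_bool_card finite_lessThan)
    also have "\<dots> = 2 * (\<Sum>c<T. \<Sum>(\<omega>, i)\<in>\<Omega> \<times> V. of_bool (thn c \<omega> i))"
      by (simp only: case_prod_unfold sum.swap[of _ "\<Omega> \<times> V"])
    also have "\<dots> = 2 * (\<Sum>c<T. real (card {(\<omega>, i) \<in> \<Omega> \<times> V. thn c \<omega> i}))"
      using fin\<Omega> V by (simp add: case_prod_unfold Int_def mem_Times_iff)
    also have "(\<Sum>c<T. real (card {(\<omega>, i) \<in> \<Omega> \<times> V. thn c \<omega> i})) \<le> T * (w ^ (T - 1) * (N * w / 8))"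
      unfolding thn_def by (rule step_count) (use thin in \<open>simp add: N_def W_def w_def \<tau>_def\<close>)
    also have "\<dots> = T * (N * w ^ T / 8)" by (simp add: w_pow[symmetric])
    finally have "real T * real (card B2) \<le> real T * (N * w ^ T / 4)" by (simp add: mult_ac)
    then show ?thesis using T by simp
  qed
  have cardG: "N * w ^ T \<le> 2 * real (card G)"
  proof -
    have "card (\<Omega> \<times> V) \<le> card G + card (B1 \<union> B2)"
      using finB by (simp add: G_def) (metis card_Un_le Un_Diff_cancel2 card_mono finB finite_Un Un_upper1 G_def order_trans)
    also have "\<dots> \<le> card G + (card B1 + card B2)" by (intro add_left_mono card_Un_le)
    finally have "real (card (\<Omega> \<times> V)) \<le> real (card G) + real (card B1) + real (card B2)"
      by (simp flip: of_nat_add)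
    moreover have "real (card (\<Omega> \<times> V)) = N * w ^ T"
      by (simp add: card_cartesian_product card\<Omega> N_def)
    moreover have "0 \<le> N * w ^ T" using N w by simp
    ultimately show ?thesis using cardB1 cardB2 by linarith
  qed
  \<comment> \<open>The vertices that could replace the intermediate vertex of step \<open>c\<close>
    without leaving the heavy edges.\<close>
  define slice where "slice g c = heavy_out V \<tau> Q (walk (fst g) (snd g) c) \<inter> heavy_in V \<tau> S (walk (fst g) (snd g) (Suc c))"
    for g :: "(nat \<Rightarrow> ('a \<Rightarrow> 'a) \<times> ('a \<Rightarrow> 'a)) \<times> 'a" and c
  define M where "M g = {x\<in>V. \<exists>b b'. b < b' \<and> b' < T \<and> x \<in> slice g b \<and> x \<in> slice g b'}" for g
  have typical: "typical_step \<tau> \<mu> Q S (\<omega> c) (walk \<omega> i c)" if "(\<omega>, i) \<in> G" "c < T" for \<omega> i c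
    using that by (auto simp: G_def B1_def unt_def)
  have G_in: "\<omega> \<in> \<Omega>" "i \<in> V" if "(\<omega>, i) \<in> G" for \<omega> i using that by (auto simp: G_def)
  have step_in: "fst (\<omega> c) (walk \<omega> i c) \<in> V" if "(\<omega>, i) \<in> G" "c < T" for \<omega> i c
  proof -
    have "\<omega> c \<in> W" using G_in[OF that(1)] that(2) by (auto simp: \<Omega>_def)
    then show ?thesis using W_perm walk_in[OF G_in[OF that(1)], of c] that(2) by (simp add: permutes_in_image)
  qed
  \<comment> \<open>At least half of the steps are not thin, and their slices have more than
    \<open>4 * card V / T\<close> elements; the sizes of all slices add up to at least
    \<open>2 * card V\<close>.\<close>
  have cardM: "card V \<le> T * card (M g)" if g: "g \<in> G" for g
  proof -
    obtain \<omega> i where g_eq: "g = (\<omega>, i)" by fastforce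
    define th where "th = {c\<in>{..<T}. thn c \<omega> i}"
    have th: "2 * card th \<le> T" using g by (auto simp: G_def B2_def g_eq th_def)
    have "4 * card V \<le> T * card (slice g c)" if c: "c \<in> {..<T} - th" for c
    proof -
      have "c < T" using c by simp
      have "fst (\<omega> c) (walk \<omega> i c) \<in> slice g c"
        using typical[of \<omega> i c] step_in[of \<omega> i c] g \<open>c < T\<close>
        by (auto simp: slice_def g_eq heavy_out_def heavy_in_def typical_step_def)
      then show ?thesis using c by (auto simp: th_def thn_def thin_step_def slice_def g_eq Let_def)
    qed
    then have "(\<Sum>c\<in>{..<T} - th. 4 * card V) \<le> (\<Sum>c\<in>{..<T} - th. T * card (slice g c))"
      by (rule sum_mono)
    also have "\<dots> \<le> (\<Sum>c<T. T * card (slice g c))"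
      by (rule sum_mono2) auto
    moreover have "card ({..<T} - th) = T - card th"
      by (subst card_Diff_subset) (auto simp: th_def)
    ultimately have "(T - card th) * (4 * card V) \<le> T * (\<Sum>c<T. card (slice g c))"
      by (simp add: sum_distrib_left)
    moreover have "T * (2 * card V) \<le> (T - card th) * (4 * card V)"
    proof -
      have "T \<le> (T - card th) * 2" using th by linarith
      then have "T * (2 * card V) \<le> (T - card th) * 2 * (2 * card V)" by (rule mult_right_mono) simp
      then show ?thesis by simp
    qed
    ultimately have "T * (2 * card V) \<le> T * (\<Sum>c<T. card (slice g c))" by linarith
    then have "2 * card V \<le> (\<Sum>c<T. card (slice g c))" using T by simp
    moreover have "slice g c \<subseteq> V" for c by (auto simp: slice_def heavy_out_def)
    ultimately show ?thesis unfolding M_def by (intro card_multiply_covered V) auto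
  qed
  define Gx where "Gx = Sigma G M"
  have finM: "finite (M g)" for g using V by (simp add: M_def)
  have finGx: "finite Gx" using finB finM by (simp add: Gx_def)
  have cardGx: "N * real (card G) \<le> real T * real (card Gx)"
  proof -
    have "N * real (card G) = (\<Sum>g\<in>G. N)" by simp
    also have "\<dots> \<le> (\<Sum>g\<in>G. real T * real (card (M g)))"
      using cardM by (intro sum_mono) (simp add: N_def flip: of_nat_mult)
    finally show ?thesis using finB finM by (simp add: Gx_def sum_distrib_left)
  qed
  txt \<open>
    A walk and the vertex closing a cycle are encoded by two sequences, the closing vertex being the
    last entry of the second one.
  \<close>
  define h :: "((nat \<Rightarrow> ('a \<Rightarrow> 'a) \<times> ('a \<Rightarrow> 'a)) \<times> 'a) \<times> 'a \<Rightarrow> (nat \<Rightarrow> 'a) \<times> (nat \<Rightarrow> 'a)"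
    where "h = (\<lambda>((\<omega>, i), x). (\<lambda>c\<in>{..T}. walk \<omega> i c, \<lambda>c\<in>{..T}. if c = T then x else fst (\<omega> c) (walk \<omega> i c)))"
  define BadQ where "BadQ a b = {(I, J) \<in> ({..T} \<rightarrow>\<^sub>E V) \<times> ({..T} \<rightarrow>\<^sub>E V).
      (\<lambda>c\<in>{a..b}. I c, \<lambda>c\<in>{a..b}. J (if c = b then T else c)) \<in> unlikely_heavy V \<tau> Q {a..b}}" for a b :: nat
  define BadS where "BadS a b = {(J, I) \<in> ({..T} \<rightarrow>\<^sub>E V) \<times> ({..T} \<rightarrow>\<^sub>E V).
      (\<lambda>c\<in>{a..b}. J (if c = b then T else c), \<lambda>c\<in>{a..b}. I (if c = b then a else Suc c)) \<in> unlikely_heavy V \<tau> S {a..b}}" for a b :: nat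
  define X where "X = real T ^ 2 * (2 * \<gamma> * ln N) * (2 / \<theta>) ^ T * N ^ (2 * T)"
  define pairs where "pairs = {(a, b). a \<le> b \<and> b < T}"
  have h_in: "h y \<in> (\<Union>(a, b)\<in>pairs. BadQ a b \<union> prod.swap ` BadS a b)" if "y \<in> Gx" for y
  proof -
    obtain \<omega> i x where y: "y = ((\<omega>, i), x)" by (metis prod.collapse)
    have g: "(\<omega>, i) \<in> G" and x: "x \<in> M (\<omega>, i)" using that by (auto simp: Gx_def y)
    define I where "I = (\<lambda>c\<in>{..T}. walk \<omega> i c)"
    define J where "J = (\<lambda>c\<in>{..T}. if c = T then x else fst (\<omega> c) (walk \<omega> i c))"
    have hy: "h y = (I, J)" by (simp add: h_def y I_def J_def)
    from x obtain b b' where b: "b < b'" "b' < T" "x \<in> slice (\<omega>, i) b" "x \<in> slice (\<omega>, i) b'" and xV: "x \<in> V"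
      by (auto simp: M_def)
    \<comment> \<open>Slice \<open>b\<close> provides the heavy edge of \<open>S\<close> from
      \<open>x\<close> to position \<open>Suc b\<close>, and slice \<open>b'\<close> the heavy edge
      of \<open>Q\<close> from position \<open>b'\<close> to \<open>x\<close>. So the cycle starts
      at \<open>Suc b\<close>.\<close>
    define a where "a = Suc b"
    have ab: "a \<le> b'" "b' < T" using b by (auto simp: a_def)
    have I: "I \<in> {..T} \<rightarrow>\<^sub>E V" using walk_in[OF G_in[OF g]] by (auto simp: I_def)
    have J: "J \<in> {..T} \<rightarrow>\<^sub>E V" using step_in[OF g] xV by (auto simp: J_def)
    have "(\<lambda>c\<in>{a..b'}. I c, \<lambda>c\<in>{a..b'}. J (if c = b' then T else c)) \<in> unlikely_heavy V \<tau> Q {a..b'} \<or>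
          (\<lambda>c\<in>{a..b'}. J (if c = b' then T else c), \<lambda>c\<in>{a..b'}. I (if c = b' then a else Suc c))
            \<in> unlikely_heavy V \<tau> S {a..b'}"
    proof (rule no_return_imp_unlikely)
      show "0 < \<tau>" using \<theta> N by (simp add: \<tau>_def)
      show "((\<rho> \<circ> \<pi>) ^^ s) i \<noteq> i" if "\<pi> \<in> Q" "\<rho> \<in> S" "i \<in> V" "0 < s" "s \<le> T" for \<pi> \<rho> i s
        using no_return that by blast
      show "\<tau> \<le> edge_prob Q (I c, J c)" "\<tau> \<le> edge_prob S (J c, I (Suc c))" if "a \<le> c" "c < b'" for c
        using typical[OF g, of c] that ab by (auto simp: I_def J_def typical_step_def)
      show "\<tau> \<le> edge_prob Q (I b', J T)" "\<tau> \<le> edge_prob S (J T, I a)"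
        using b by (auto simp: I_def J_def slice_def heavy_out_def heavy_in_def a_def simp del: walk.simps)
    qed (use ab I J Q S in auto)
    then have "(I, J) \<in> BadQ a b' \<or> (J, I) \<in> BadS a b'" using I J by (auto simp: BadQ_def BadS_def)
    then have "(I, J) \<in> BadQ a b' \<union> prod.swap ` BadS a b'" by force
    then show ?thesis using ab by (auto simp: hy pairs_def)
  qed
  have finBad: "finite (BadQ a b)" "finite (BadS a b)" for a b
  proof -
    have fin: "finite (({..T} \<rightarrow>\<^sub>E V) \<times> ({..T} \<rightarrow>\<^sub>E V))" using V by (simp add: finite_PiE)
    have "BadQ a b \<subseteq> ({..T} \<rightarrow>\<^sub>E V) \<times> ({..T} \<rightarrow>\<^sub>E V)" "BadS a b \<subseteq> ({..T} \<rightarrow>\<^sub>E V) \<times> ({..T} \<rightarrow>\<^sub>E V)"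
      by (auto simp: BadQ_def BadS_def)
    then show "finite (BadQ a b)" "finite (BadS a b)" using fin by (meson finite_subset)+
  qed
  have cardBad: "real (card (BadQ a b \<union> prod.swap ` BadS a b)) \<le> 2 * X" if "(a, b) \<in> pairs" for a b
  proof -
    have ab: "a \<le> b" "b < T" using that by (auto simp: pairs_def)
    have "real (card (BadQ a b)) \<le> X"
      unfolding BadQ_def X_def \<tau>_def N_def
      by (rule card_closed_unlikely) (use families \<theta> ab in \<open>auto simp: inj_on_def split: if_splits\<close>)
    moreover have "real (card (BadS a b)) \<le> X"
      unfolding BadS_def X_def \<tau>_def N_def
      by (rule card_closed_unlikely) (use families \<theta> ab in \<open>auto simp: inj_on_def split: if_splits\<close>)
    moreover have "card (BadQ a b \<union> prod.swap ` BadS a b) \<le> card (BadQ a b) + card (BadS a b)"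
      by (intro order_trans[OF card_Un_le] add_left_mono card_image_le finBad)
    then have "real (card (BadQ a b \<union> prod.swap ` BadS a b)) \<le> real (card (BadQ a b)) + real (card (BadS a b))"
      by (simp flip: of_nat_add)
    ultimately show ?thesis by linarith
  qed
  have fin_pairs: "finite pairs" "card pairs \<le> T ^ 2"
  proof -
    have sub: "pairs \<subseteq> {..<T} \<times> {..<T}" by (auto simp: pairs_def)
    then show "finite pairs" by (rule finite_subset) auto
    show "card pairs \<le> T ^ 2" using card_mono[OF _ sub] by (simp add: power2_eq_square)
  qed
  have X0: "0 \<le> X" using N \<gamma> \<theta> by (simp add: X_def)
  have card_hGx: "real (card (h ` Gx)) \<le> real T ^ 2 * (2 * X)"
  proof -
    have "card (h ` Gx) \<le> card (\<Union>(a, b)\<in>pairs. BadQ a b \<union> prod.swap ` BadS a b)"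
      using h_in fin_pairs finBad by (intro card_mono) auto
    also have "\<dots> \<le> (\<Sum>p\<in>pairs. card (case p of (a, b) \<Rightarrow> BadQ a b \<union> prod.swap ` BadS a b))"
      by (rule card_UN_le[OF fin_pairs(1)])
    finally have "real (card (h ` Gx)) \<le> (\<Sum>p\<in>pairs. real (card (case p of (a, b) \<Rightarrow> BadQ a b \<union> prod.swap ` BadS a b)))"
      by (simp flip: of_nat_sum)
    also have "\<dots> \<le> (\<Sum>p\<in>pairs. 2 * X)"
      using cardBad by (intro sum_mono) (auto simp: case_prod_unfold)
    also have "\<dots> = real (card pairs) * (2 * X)" by simp
    also have "\<dots> \<le> real T ^ 2 * (2 * X)"
      using fin_pairs(2) X0 by (intro mult_right_mono) (simp_all flip: of_nat_power)
    finally show ?thesis .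
  qed
  \<comment> \<open>The code determines the start and the closing vertex. The pair at time
    \<open>c\<close> must contain two prescribed edges, and as these occur in a good walk their
    probabilities are at most \<open>\<mu>\<close>.\<close>
  have fiber: "real (card {y\<in>Gx. h y = z}) \<le> (\<mu> ^ 2 * w) ^ T" if z: "z \<in> h ` Gx" for z
  proof -
    obtain I J where zIJ: "z = (I, J)" by fastforce
    define F where "F c = {\<pi>\<in>Q. \<pi> (I c) = J c} \<times> {\<rho>\<in>S. \<rho> (J c) = I (Suc c)}" for c
    have finF: "finite (F c)" for c using Q S by (simp add: F_def)
    have cap: "edge_prob Q (I c, J c) \<le> \<mu>" "edge_prob S (J c, I (Suc c)) \<le> \<mu>" if c: "c < T" for c
    proof -
      from z obtain \<omega> i x where "((\<omega>, i), x) \<in> Gx" "h ((\<omega>, i), x) = (I, J)"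
        unfolding zIJ by (metis imageE prod.collapse)
      then have "(\<omega>, i) \<in> G" and "I = (\<lambda>c\<in>{..T}. walk \<omega> i c)"
        "J = (\<lambda>c\<in>{..T}. if c = T then x else fst (\<omega> c) (walk \<omega> i c))"
        by (auto simp: Gx_def h_def)
      then show "edge_prob Q (I c, J c) \<le> \<mu>" "edge_prob S (J c, I (Suc c)) \<le> \<mu>"
        using typical[of \<omega> i c] c by (auto simp: typical_step_def)
    qed
    have inj: "inj_on (\<lambda>y. fst (fst y)) {y\<in>Gx. h y = z}"
    proof (rule inj_onI)
      fix y y' assume "y \<in> {y\<in>Gx. h y = z}" "y' \<in> {y\<in>Gx. h y = z}"
      then have eq: "h y = h y'" by simp
      assume om: "fst (fst y) = fst (fst y')"
      obtain \<omega> i x where y: "y = ((\<omega>, i), x)" by (metis prod.collapse)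
      obtain \<omega>' i' x' where y': "y' = ((\<omega>', i'), x')" by (metis prod.collapse)
      have "fst (h y) 0 = i" "fst (h y') 0 = i'" "snd (h y) T = x" "snd (h y') T = x'"
        by (simp_all add: h_def y y')
      then show "y = y'" using om eq by (simp add: y y')
    qed
    have sub: "(\<lambda>y. fst (fst y)) ` {y\<in>Gx. h y = z} \<subseteq> PiE {..<T} F"
    proof
      fix \<omega> assume "\<omega> \<in> (\<lambda>y. fst (fst y)) ` {y\<in>Gx. h y = z}"
      then obtain i x where mem: "((\<omega>, i), x) \<in> Gx" and eq: "h ((\<omega>, i), x) = (I, J)" by (auto simp: zIJ)
      then have g: "(\<omega>, i) \<in> G" by (simp add: Gx_def)
      from eq have IJ: "I = (\<lambda>c\<in>{..T}. walk \<omega> i c)" "J = (\<lambda>c\<in>{..T}. if c = T then x else fst (\<omega> c) (walk \<omega> i c))"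
        by (auto simp: h_def)
      show "\<omega> \<in> PiE {..<T} F"
      proof (rule PiE_I)
        fix c assume "c \<in> {..<T}"
        then have c: "c < T" by simp
        then have "\<omega> c \<in> W" using G_in[OF g] by (auto simp: \<Omega>_def)
        then show "\<omega> c \<in> F c" using c by (auto simp: W_def F_def IJ mem_Times_iff)
      next
        fix c assume "c \<notin> {..<T}"
        then show "\<omega> c = undefined" using G_in[OF g] by (auto simp: \<Omega>_def PiE_iff extensional_def)
      qed
    qed
    have "card {y\<in>Gx. h y = z} \<le> card (PiE {..<T} F)"
      by (rule card_inj_on_le[OF inj sub]) (simp add: finite_PiE finF)
    then have "real (card {y\<in>Gx. h y = z}) \<le> (\<Prod>c<T. real (card (F c)))"
      by (simp add: card_PiE flip: of_nat_prod)
    also have "\<dots> \<le> (\<Prod>c<T. \<mu> ^ 2 * w)"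
    proof (rule prod_mono, intro conjI)
      fix c assume "c \<in> {..<T}"
      then have c: "c < T" by simp
      have "real (card (F c)) = (edge_prob Q (I c, J c) * real (card Q)) * (edge_prob S (J c, I (Suc c)) * real (card S))"
        using Q S by (simp add: F_def card_cartesian_product edge_prob_def card_gt_0_iff)
      also have "\<dots> \<le> (\<mu> * real (card Q)) * (\<mu> * real (card S))"
        using cap[OF c] \<kappa> N by (intro mult_mono mult_right_mono) (auto simp: edge_prob_nonneg \<mu>_def)
      also have "\<dots> = \<mu> ^ 2 * w" by (simp add: w_def W_def card_cartesian_product power2_eq_square)
      finally show "real (card (F c)) \<le> \<mu> ^ 2 * w" .
    qed simp
    finally show ?thesis by simp
  qed
  have "real (card Gx) = (\<Sum>z\<in>h ` Gx. real (card {y\<in>Gx. h y = z}))"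
    using sum.image_gen[OF finGx, of "\<lambda>_. 1::real" h] by simp
  also have "\<dots> \<le> (\<Sum>z\<in>h ` Gx. (\<mu> ^ 2 * w) ^ T)" by (intro sum_mono fiber)
  also have "\<dots> = real (card (h ` Gx)) * (\<mu> ^ 2 * w) ^ T" by simp
  also have "\<dots> \<le> real T ^ 2 * (2 * X) * (\<mu> ^ 2 * w) ^ T"
    using card_hGx w by (intro mult_right_mono) auto
  finally have up: "real (card Gx) \<le> real T ^ 2 * (2 * X) * (\<mu> ^ 2 * w) ^ T" .
  have "N ^ 2 * w ^ T = N * (N * w ^ T)" by (simp add: power2_eq_square)
  also have "\<dots> \<le> N * (2 * real (card G))" using cardG N by (intro mult_left_mono) auto
  also have "\<dots> \<le> 2 * (real T * real (card Gx))" using cardGx by simp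
  also have "\<dots> \<le> 2 * (real T * (real T ^ 2 * (2 * X) * (\<mu> ^ 2 * w) ^ T))"
    using up by (intro mult_left_mono) auto
  also have "\<dots> = (4 * real T ^ 3 * X * \<mu> ^ (2 * T)) * w ^ T"
    by (simp add: power_mult_distrib power_mult power2_eq_square power3_eq_cube)
  finally have "N ^ 2 \<le> 4 * real T ^ 3 * X * \<mu> ^ (2 * T)"
    using w by simp
  \<comment> \<open>The factor \<open>N ^ (2 * T)\<close> in \<open>X\<close> cancels against
    \<open>\<mu> ^ (2 * T)\<close> and leaves a power of \<open>\<kappa>\<close>.\<close>
  also have "\<dots> = 8 * real T ^ 5 * \<gamma> * ln N * (2 / \<theta>) ^ T * (N * \<mu>) ^ (2 * T)"
    by (simp add: X_def power_mult_distrib eval_nat_numeral)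
  also have "N * \<mu> = \<kappa>" using N by (simp add: \<mu>_def)
  finally show ?thesis by (simp add: N_def)
qed

lemma ln_fact_ge: "real n * ln (real n) - real n \<le> ln (fact n)"
proof (induction n)
  case (Suc n)
  show ?case
  proof (cases "n = 0")
    case False
    then have n: "0 < real n" by simp
    have "real n * ln ((real n + 1) / real n) = real n * ln (1 + 1 / real n)"
      using n by (simp add: field_simps)
    also have "\<dots> \<le> real n * (1 / real n)"
      using n by (intro mult_left_mono ln_add_one_self_le_self) auto
    finally have "real n * ln (real n + 1) \<le> real n * ln (real n) + 1"
      using n by (simp add: ln_div algebra_simps)
    moreover have "ln (fact (Suc n) :: real) = ln (real n + 1) + ln (fact n)"
      by (simp add: ln_mult add.commute)
    ultimately show ?thesis using Suc.IH by (simp add: algebra_simps del: fact_Suc)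
  qed simp
qed simp

section \<open>Frequencies of light, overfull and thin steps\<close>

context perm_family
begin

text \<open>A light pair is used by fewer than \<open>\<tau> * card Q\<close> members of
  \<open>Q\<close>, and there are \<open>card V ^ 2\<close> pairs.\<close>

lemma card_light_edges:
  assumes \<tau>: "0 \<le> \<tau>"
  shows "(\<Sum>\<pi>\<in>Q. real (card {i\<in>V. edge_prob Q (i, \<pi> i) < \<tau>})) \<le> \<tau> * real (card V) ^ 2 * real (card Q)"
proof -
  have posQ: "0 < real (card Q)" using Q by (simp add: card_gt_0_iff)
  have "(\<Sum>\<pi>\<in>Q. real (card {i\<in>V. edge_prob Q (i, \<pi> i) < \<tau>}))
      = (\<Sum>\<pi>\<in>Q. \<Sum>i\<in>V. \<Sum>j\<in>V. of_bool (\<pi> i = j) * of_bool (edge_prob Q (i, j) < \<tau>))"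
  proof (rule sum.cong[OF refl])
    fix \<pi> assume "\<pi> \<in> Q"
    then have p: "\<pi> permutes V" using Q by simp
    have "(\<Sum>j\<in>V. of_bool (\<pi> i = j) * of_bool (edge_prob Q (i, j) < \<tau>)) = (of_bool (edge_prob Q (i, \<pi> i) < \<tau>) :: real)"
      if "i \<in> V" for i
    proof -
      have "(\<Sum>j\<in>V. of_bool (\<pi> i = j) * of_bool (edge_prob Q (i, j) < \<tau>))
          = (\<Sum>j\<in>V. if \<pi> i = j then of_bool (edge_prob Q (i, j) < \<tau>) else (0::real))"
        by (intro sum.cong) auto
      then show ?thesis using that V p by (simp add: permutes_in_image)
    qed
    then show "real (card {i\<in>V. edge_prob Q (i, \<pi> i) < \<tau>})
        = (\<Sum>i\<in>V. \<Sum>j\<in>V. of_bool (\<pi> i = j) * of_bool (edge_prob Q (i, j) < \<tau>))"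
      using V by (simp add: Int_def)
  qed
  also have "\<dots> = (\<Sum>i\<in>V. \<Sum>j\<in>V. \<Sum>\<pi>\<in>Q. of_bool (\<pi> i = j) * of_bool (edge_prob Q (i, j) < \<tau>))"
    by (subst sum.swap) (simp only: sum.swap[of _ Q V])
  also have "\<dots> \<le> (\<Sum>i\<in>V. \<Sum>j\<in>V. \<tau> * real (card Q))"
  proof (intro sum_mono)
    fix i j
    have "(\<Sum>\<pi>\<in>Q. of_bool (\<pi> i = j) * of_bool (edge_prob Q (i, j) < \<tau>))
        = real (card {\<pi>\<in>Q. \<pi> i = j}) * of_bool (edge_prob Q (i, j) < \<tau>)"
      using Q by (simp add: Int_def flip: sum_distrib_right)
    also have "\<dots> \<le> \<tau> * real (card Q)"
      using posQ \<tau> by (auto simp: edge_prob_def field_simps)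
    finally show "(\<Sum>\<pi>\<in>Q. of_bool (\<pi> i = j) * of_bool (edge_prob Q (i, j) < \<tau>)) \<le> \<tau> * real (card Q)" .
  qed
  also have "\<dots> = \<tau> * real (card V) ^ 2 * real (card Q)" by (simp add: power2_eq_square)
  finally show ?thesis .
qed

lemma sum_edge_prob:
  assumes i: "i \<in> V"
  shows "(\<Sum>j\<in>V. edge_prob Q (i, j)) = 1"
proof -
  have "(\<Sum>j\<in>V. card {\<pi>\<in>Q. \<pi> i = j}) = card (\<Union>j\<in>V. {\<pi>\<in>Q. \<pi> i = j})"
    using V Q by (intro card_UN_disjoint[symmetric]) auto
  also have "(\<Union>j\<in>V. {\<pi>\<in>Q. \<pi> i = j}) = Q"
    using Q(3) i permutes_in_image by fastforce
  finally have "(\<Sum>j\<in>V. real (card {\<pi>\<in>Q. \<pi> i = j})) = real (card Q)" by (simp flip: of_nat_sum)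
  then show ?thesis using Q by (simp add: edge_prob_def card_gt_0_iff flip: sum_divide_distrib)
qed

text \<open>The probabilities out of \<open>i\<close> add up to 1, so at most
  \<open>card V / \<kappa>\<close> targets are overfull. By \<open>moment_bound\<close> a large
  \<open>Q\<close> rarely hits such small sets.\<close>

lemma card_overfull_edges:
  assumes \<kappa>: "1 \<le> \<kappa>"
  shows "(\<Sum>\<pi>\<in>Q. real (card {i\<in>V. \<kappa> / real (card V) < edge_prob Q (i, \<pi> i)})) * ln \<kappa>
     \<le> real (card Q) * (real (card V) * ln (2 * real (card V)) - ln (real (card Q)))"
proof -
  define X where "X = (\<lambda>(_ :: unit) i. {j\<in>V. \<kappa> / real (card V) < edge_prob Q (i, j)})"
  have posV: "0 < real (card V)" using V by (simp add: card_gt_0_iff)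
  have X: "X z i \<subseteq> V \<and> \<kappa> * real (card (X z i)) \<le> real (card V)" if "i \<in> V" for z i
  proof
    show "X z i \<subseteq> V" by (auto simp: X_def)
    have "\<kappa> / real (card V) * real (card (X z i)) = (\<Sum>j\<in>X z i. \<kappa> / real (card V))" by simp
    also have "\<dots> \<le> (\<Sum>j\<in>X z i. edge_prob Q (i, j))" by (intro sum_mono) (auto simp: X_def)
    also have "\<dots> \<le> (\<Sum>j\<in>V. edge_prob Q (i, j))"
      using V by (intro sum_mono2) (auto simp: X_def edge_prob_nonneg)
    also have "\<dots> = 1" by (rule sum_edge_prob[OF that])
    finally show "\<kappa> * real (card (X z i)) \<le> real (card V)" using posV by (simp add: field_simps)
  qed
  have "(\<Sum>(z, \<pi>)\<in>{()} \<times> Q. real (card {i\<in>V. \<pi> i \<in> X z i})) * ln \<kappa>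
     \<le> real (card ({()} \<times> Q)) * (ln (real (card {()})) + real (card V) * ln (2 * real (card V)) - ln (real (card ({()} \<times> Q))))"
    by (rule moment_bound) (use V Q \<kappa> X in auto)
  also have "(\<Sum>(z, \<pi>)\<in>{()} \<times> Q. real (card {i\<in>V. \<pi> i \<in> X z i}))
      = (\<Sum>\<pi>\<in>Q. real (card {i\<in>V. \<kappa> / real (card V) < edge_prob Q (i, \<pi> i)}))"
  proof -
    have "{i\<in>V. \<pi> i \<in> X z i} = {i\<in>V. \<kappa> / real (card V) < edge_prob Q (i, \<pi> i)}" if "\<pi> \<in> Q" for \<pi> z
      using Q(3)[OF that] by (auto simp: X_def permutes_in_image)
    then show ?thesis by (simp add: sum.cartesian_product[symmetric])
  qed
  finally show ?thesis by (simp add: card_cartesian_product)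
qed

text \<open>The pair \<open>(\<pi>, \<rho>)\<close> is encoded as
  \<open>(\<rho> \<circ> \<pi>, \<pi>)\<close>. The composition alone determines the end point of
  the step and with it the small set which \<open>\<pi> i\<close> has to hit, so
  \<open>moment_bound\<close> applies with all permutations as extra data; this is the summand
  \<open>ln (fact (card V))\<close>.\<close>

lemma card_thin_steps:
  assumes S: "perm_family V S" and T: "4 \<le> T"
  shows "(\<Sum>w\<in>Q \<times> S. real (card {i\<in>V. thin_step V \<tau> T Q S w i})) * ln (real T / 4)
     \<le> real (card (Q \<times> S)) * (ln (fact (card V)) + real (card V) * ln (2 * real (card V))
         - ln (real (card Q)) - ln (real (card S)))"
proof -
  note S = perm_family.Q[OF S]
  define Y where "Y z i = heavy_out V \<tau> Q i \<inter> heavy_in V \<tau> S (z i)" for z :: "'a \<Rightarrow> 'a" and i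
  define X where "X z i = (if T * card (Y z i) \<le> 4 * card V then Y z i else {})" for z i
  define Z where "Z = {z. z permutes V}"
  define f :: "('a \<Rightarrow> 'a) \<times> ('a \<Rightarrow> 'a) \<Rightarrow> ('a \<Rightarrow> 'a) \<times> ('a \<Rightarrow> 'a)" where "f = (\<lambda>(\<pi>, \<rho>). (\<rho> \<circ> \<pi>, \<pi>))"
  have cardZ: "card Z = fact (card V)" using V by (simp add: Z_def card_permutations)
  have finZ: "finite Z" using V by (simp add: Z_def finite_permutations)
  have inj: "inj_on f (Q \<times> S)"
  proof (rule inj_onI)
    fix p p' assume p: "p \<in> Q \<times> S" "p' \<in> Q \<times> S" "f p = f p'"
    obtain \<pi> \<rho> \<pi>' \<rho>' where pp: "p = (\<pi>, \<rho>)" "p' = (\<pi>', \<rho>')" by fastforce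
    have "\<pi>' = \<pi>" "\<rho> \<circ> \<pi> = \<rho>' \<circ> \<pi>" using p by (auto simp: f_def pp)
    moreover have "surj \<pi>" using p(1) permutes_surj[OF Q(3), of \<pi>] by (simp add: pp)
    ultimately show "p = p'" by (simp add: pp surj_fun_eq)
  qed
  have card_A: "card (f ` (Q \<times> S)) = card (Q \<times> S)" using inj by (rule card_image)
  have Y_sub: "Y z i \<subseteq> V" for z i by (auto simp: Y_def heavy_out_def)
  have "(\<Sum>(z, \<pi>)\<in>f ` (Q \<times> S). real (card {i\<in>V. \<pi> i \<in> X z i})) * ln (real T / 4)
     \<le> real (card (f ` (Q \<times> S))) * (ln (real (card Z)) + real (card V) * ln (2 * real (card V)) - ln (real (card (f ` (Q \<times> S)))))"
  proof (rule moment_bound)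
    show "z \<in> Z \<and> \<pi> permutes V" if "(z, \<pi>) \<in> f ` (Q \<times> S)" for z \<pi>
      using that Q(3) S(3) by (auto simp: f_def Z_def intro: permutes_compose)
    show "X z i \<subseteq> V \<and> real T / 4 * real (card (X z i)) \<le> real (card V)" if "z \<in> Z" "i \<in> V" for z i
    proof -
      have "real T * real (card (Y z i)) \<le> 4 * real (card V)" if "T * card (Y z i) \<le> 4 * card V"
      proof -
        have "real (T * card (Y z i)) \<le> real (4 * card V)" using that by (rule of_nat_mono)
        then show ?thesis by simp
      qed
      then show ?thesis using Y_sub by (auto simp: X_def)
    qed
  qed (use V finZ Q S T in auto)
  also have "(\<Sum>(z, \<pi>)\<in>f ` (Q \<times> S). real (card {i\<in>V. \<pi> i \<in> X z i}))
      = (\<Sum>w\<in>Q \<times> S. real (card {i\<in>V. thin_step V \<tau> T Q S w i}))"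
  proof -
    have "(\<Sum>(z, \<pi>)\<in>f ` (Q \<times> S). real (card {i\<in>V. \<pi> i \<in> X z i}))
        = (\<Sum>w\<in>Q \<times> S. real (card {i\<in>V. fst w i \<in> X (snd w \<circ> fst w) i}))"
      by (subst sum.reindex[OF inj]) (simp add: f_def case_prod_unfold)
    also have "\<dots> = (\<Sum>w\<in>Q \<times> S. real (card {i\<in>V. thin_step V \<tau> T Q S w i}))"
      by (intro sum.cong refl arg_cong[of _ _ "\<lambda>A. real (card A)"])
         (auto simp: X_def Y_def thin_step_def Let_def split: if_splits)
    finally show ?thesis .
  qed
  finally show ?thesis
    using Q S unfolding card_A cardZ by (simp add: card_cartesian_product ln_mult card_gt_0_iff algebra_simps)
qed

text \<open>Four ways to fail, two for each edge of the step; the failures of the second edge are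
  pulled back along \<open>\<pi>\<close>.\<close>

lemma sum_untypical_steps:
  assumes S: "perm_family V S"
    and Qb: "(\<Sum>\<pi>\<in>Q. real (card {i\<in>V. edge_prob Q (i, \<pi> i) < \<tau>})) \<le> q * real (card Q)"
      "(\<Sum>\<pi>\<in>Q. real (card {i\<in>V. \<mu> < edge_prob Q (i, \<pi> i)})) \<le> q * real (card Q)"
    and Sb: "(\<Sum>\<pi>\<in>S. real (card {i\<in>V. edge_prob S (i, \<pi> i) < \<tau>})) \<le> q * real (card S)"
      "(\<Sum>\<pi>\<in>S. real (card {i\<in>V. \<mu> < edge_prob S (i, \<pi> i)})) \<le> q * real (card S)"
  shows "(\<Sum>w\<in>Q \<times> S. real (card {i\<in>V. \<not> typical_step \<tau> \<mu> Q S w i})) \<le> 4 * q * real (card (Q \<times> S))"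
proof -
  note S = perm_family.Q[OF S]
  define l where "l R \<pi> = {i\<in>V. edge_prob R (i, \<pi> i) < \<tau>}" for R and \<pi> :: "'a \<Rightarrow> 'a"
  define u where "u R \<pi> = {i\<in>V. \<mu> < edge_prob R (i, \<pi> i)}" for R and \<pi> :: "'a \<Rightarrow> 'a"
  have fin: "finite (l R \<pi>)" "finite (u R \<pi>)" for R \<pi> using V by (auto simp: l_def u_def)
  have "card {i\<in>V. \<not> typical_step \<tau> \<mu> Q S (\<pi>, \<rho>) i} \<le> card (l Q \<pi>) + card (u Q \<pi>) + (card (l S \<rho>) + card (u S \<rho>))"
    if "\<pi> \<in> Q" for \<pi> \<rho>
  proof -
    have p: "\<pi> permutes V" using Q that by simp
    have "{i\<in>V. \<not> typical_step \<tau> \<mu> Q S (\<pi>, \<rho>) i} \<subseteq> (l Q \<pi> \<union> u Q \<pi>) \<union> inv \<pi> ` (l S \<rho> \<union> u S \<rho>)"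
    proof
      fix i assume i: "i \<in> {i\<in>V. \<not> typical_step \<tau> \<mu> Q S (\<pi>, \<rho>) i}"
      then have "i \<in> l Q \<pi> \<union> u Q \<pi> \<or> \<pi> i \<in> l S \<rho> \<union> u S \<rho>"
        using p by (auto simp: typical_step_def l_def u_def permutes_in_image)
      moreover have "inv \<pi> (\<pi> i) = i" using p by (simp add: permutes_inverses)
      ultimately show "i \<in> (l Q \<pi> \<union> u Q \<pi>) \<union> inv \<pi> ` (l S \<rho> \<union> u S \<rho>)" by (metis UnCI image_eqI)
    qed
    then have "card {i\<in>V. \<not> typical_step \<tau> \<mu> Q S (\<pi>, \<rho>) i} \<le> card ((l Q \<pi> \<union> u Q \<pi>) \<union> inv \<pi> ` (l S \<rho> \<union> u S \<rho>))"
      using fin by (intro card_mono) auto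
    also have "\<dots> \<le> card (l Q \<pi> \<union> u Q \<pi>) + card (inv \<pi> ` (l S \<rho> \<union> u S \<rho>))" by (rule card_Un_le)
    also have "\<dots> \<le> (card (l Q \<pi>) + card (u Q \<pi>)) + (card (l S \<rho>) + card (u S \<rho>))"
      using fin by (intro add_mono card_Un_le order_trans[OF card_image_le card_Un_le]) auto
    finally show ?thesis by simp
  qed
  then have "(\<Sum>w\<in>Q \<times> S. real (card {i\<in>V. \<not> typical_step \<tau> \<mu> Q S w i}))
      \<le> (\<Sum>w\<in>Q \<times> S. real (card (l Q (fst w)) + card (u Q (fst w)) + (card (l S (snd w)) + card (u S (snd w)))))"
    by (intro sum_mono of_nat_mono) auto
  also have "\<dots> = (\<Sum>\<pi>\<in>Q. \<Sum>\<rho>\<in>S. real (card (l Q \<pi>)) + real (card (u Q \<pi>)) + (real (card (l S \<rho>)) + real (card (u S \<rho>))))"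
    by (simp add: sum.cartesian_product case_prod_unfold)
  also have "\<dots> = real (card S) * ((\<Sum>\<pi>\<in>Q. real (card (l Q \<pi>))) + (\<Sum>\<pi>\<in>Q. real (card (u Q \<pi>))))
      + real (card Q) * ((\<Sum>\<rho>\<in>S. real (card (l S \<rho>))) + (\<Sum>\<rho>\<in>S. real (card (u S \<rho>))))"
    by (simp add: sum.distrib flip: sum_distrib_left)
  also have "\<dots> \<le> real (card S) * (q * real (card Q) + q * real (card Q)) + real (card Q) * (q * real (card S) + q * real (card S))"
    using Qb Sb unfolding l_def u_def by (intro add_mono mult_left_mono) auto
  also have "\<dots> = 4 * q * real (card (Q \<times> S))" by (simp add: card_cartesian_product algebra_simps)
  finally show ?thesis .
qed

end

text \<open>On a finite nonempty \<open>V\<close> this says that every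
  \<open>\<rho> \<circ> \<pi>\<close> is one cycle of length \<open>card V\<close>, in the form that
  a short cycle contradicts.\<close>

definition no_return_rectangle :: "'a set \<Rightarrow> ('a \<Rightarrow> 'a) set \<Rightarrow> ('a \<Rightarrow> 'a) set \<Rightarrow> bool" where
  "no_return_rectangle V P R \<longleftrightarrow> (\<forall>\<pi>\<in>P. \<pi> permutes V) \<and> (\<forall>\<rho>\<in>R. \<rho> permutes V) \<and>
     (\<forall>\<pi>\<in>P. \<forall>\<rho>\<in>R. \<forall>i\<in>V. \<forall>s. 0 < s \<and> s < card V \<longrightarrow> ((\<rho> \<circ> \<pi>) ^^ s) i \<noteq> i)"

lemma no_return_rectangle_bound:
  fixes V :: "'a set" and P R :: "('a \<Rightarrow> 'a) set"
  assumes V: "finite V" "V \<noteq> {}" and rect: "no_return_rectangle V P R"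
    and m: "1 \<le> m" and T: "5 \<le> T" "T < card V"
    and T_large: "8 * (ln 2 + 3 + 2 * ln m) \<le> ln (real T / 4)"
    and V_large: "8 * real T ^ 5 * ln (real (card V)) * (64 * real T) ^ T * exp (64 * real T ^ 2 * (ln 2 + 2 + ln m))
        < real (card V)"
  shows "real (card P) * real (card R) * m ^ card V \<le> fact (card V) ^ 2"
proof (rule ccontr)
  define N where "N = real (card V)"
  define F where "F = (fact (card V) :: real)"
  assume "\<not> real (card P) * real (card R) * m ^ card V \<le> fact (card V) ^ 2"
  then have big: "F ^ 2 < real (card P) * real (card R) * m ^ card V" by (simp add: F_def)
  have F: "0 < F" by (simp add: F_def)
  have N: "1 \<le> N" using V by (simp add: N_def Suc_le_eq card_gt_0_iff)
  have sub: "P \<subseteq> {\<pi>. \<pi> permutes V}" "R \<subseteq> {\<pi>. \<pi> permutes V}"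
    and no_return: "\<And>\<pi> \<rho> i s. \<pi> \<in> P \<Longrightarrow> \<rho> \<in> R \<Longrightarrow> i \<in> V \<Longrightarrow> 0 < s \<Longrightarrow> s < card V \<Longrightarrow> ((\<rho> \<circ> \<pi>) ^^ s) i \<noteq> i"
    using rect unfolding no_return_rectangle_def by blast+
  have finPR: "finite P" "finite R" using sub finite_permutations[OF V(1)] by (auto intro: finite_subset)
  have le_F: "real (card A) \<le> F" if "A \<subseteq> {\<pi>. \<pi> permutes V}" for A
  proof -
    have "card A \<le> fact (card V)"
      using card_mono[OF finite_permutations[OF V(1)] that] V by (simp add: card_permutations)
    then have "real (card A) \<le> real (fact (card V))" by (rule of_nat_mono)
    then show ?thesis by (simp add: F_def)
  qed
  have "0 < real (card P) * real (card R) * m ^ card V" using F by (intro less_trans[OF _ big]) simp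
  then have "card P \<noteq> 0" "card R \<noteq> 0"
    by (metis less_irrefl mult_zero_left mult_zero_right of_nat_0)+
  then have pos: "0 < real (card P)" "0 < real (card R)" by simp_all
  \<comment> \<open>Neither set exceeds the number of all permutations, so each of them alone has to
    be larger than \<open>F / m ^ card V\<close>.\<close>
  have "real (card P) * real (card R) * m ^ card V \<le> real (card P) * F * m ^ card V"
    using le_F[OF sub(1)] le_F[OF sub(2)] pos m by (intro mult_right_mono mult_left_mono) auto
  with big have "F * F < (real (card P) * m ^ card V) * F" by (simp add: power2_eq_square mult_ac)
  then have P_large: "F < real (card P) * m ^ card V" using F by simp
  have "real (card P) * real (card R) * m ^ card V \<le> F * real (card R) * m ^ card V"
    using le_F[OF sub(1)] le_F[OF sub(2)] pos m by (intro mult_right_mono) auto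
  with big have "F * F < (real (card R) * m ^ card V) * F" by (simp add: power2_eq_square mult_ac)
  then have R_large: "F < real (card R) * m ^ card V" using F by simp
  \<comment> \<open>The allowance for untypical steps is N/(8T), shared by four kinds of failure. So
    \<open>\<theta>\<close> and \<open>\<kappa>\<close> are chosen such that light and overfull
    edges account for at most N/(32T) each.\<close>
  define \<theta> where "\<theta> = 1 / (32 * real T)"
  \<comment> \<open>\<open>N * L\<close> bounds \<open>N * ln (2 * N)\<close> minus the logarithm of
    either stable subset: one unit is lost in the bound for the factorial and one in passing to the
    subset.\<close>
  define L where "L = ln 2 + 2 + ln m"
  define \<kappa> where "\<kappa> = exp (32 * real T * L)"
  have \<theta>: "0 < \<theta>" "\<theta> \<le> 1" using T by (auto simp: \<theta>_def field_simps)
  have L: "0 < L" using m ln_ge_zero[of m] ln_gt_zero[of 2] unfolding L_def by linarith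
  have \<kappa>: "1 \<le> \<kappa>" using L by (simp add: \<kappa>_def)
  have \<tau>: "0 < \<theta> / N" using \<theta> N by simp
  have card_VV: "real (card (V \<times> V)) / N = N"
    using N by (simp add: card_cartesian_product N_def)
  have lnF: "N * ln N - N \<le> ln F" unfolding N_def F_def by (rule ln_fact_ge)
  \<comment> \<open>Here \<open>\<gamma>\<close> is \<open>N\<close>: as \<open>V \<times> V\<close>
    has \<open>N ^ 2\<close> elements, the loss is the factor \<open>exp (- N)\<close>.\<close>
  have stable: "\<exists>Q\<subseteq>A. Q \<noteq> {} \<and> potential_stable (V \<times> V) (\<theta> / N) N Q \<and>
      ln F - N * ln m - N \<le> ln (real (card Q))"
    if A: "finite A" "0 < real (card A)" "F < real (card A) * m ^ card V" for A
  proof -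
    have "A \<noteq> {}" using A by auto
    from exists_stable_subset[OF A(1) this \<tau>, of N "V \<times> V"] N
    obtain Q where Q: "Q \<subseteq> A" "Q \<noteq> {}" "potential_stable (V \<times> V) (\<theta> / N) N Q"
      "real (card A) * exp (- N) \<le> real (card Q)"
      by (auto simp: card_VV)
    have "ln F \<le> ln (real (card A) * m ^ card V)" using A(3) F by (subst ln_le_cancel_iff) auto
    also have "\<dots> = ln (real (card A)) + N * ln m" using A(2) m by (subst ln_mult) (auto simp: ln_realpow N_def)
    finally have "ln F - N * ln m - N \<le> ln (real (card A) * exp (- N))" using A \<open>A \<noteq> {}\<close> by (simp add: ln_mult)
    also have "\<dots> \<le> ln (real (card Q))"
    proof -
      have "0 < real (card A) * exp (- N)" using A(2) by simp
      from ln_le_cancel_iff[THEN iffD2, OF this less_le_trans[OF this Q(4)] Q(4)] show ?thesis .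
    qed
    finally show ?thesis using Q by blast
  qed
  obtain Q where QP: "Q \<subseteq> P" "Q \<noteq> {}" and Q_stable: "potential_stable (V \<times> V) (\<theta> / N) N Q"
    and lnQ: "ln F - N * ln m - N \<le> ln (real (card Q))"
    using stable[OF finPR(1) pos(1) P_large] by blast
  obtain S where SR: "S \<subseteq> R" "S \<noteq> {}" and S_stable: "potential_stable (V \<times> V) (\<theta> / N) N S"
    and lnS: "ln F - N * ln m - N \<le> ln (real (card S))"
    using stable[OF finPR(2) pos(2) R_large] by blast
  have family: "perm_family V A" if "A \<subseteq> P \<or> A \<subseteq> R" "A \<noteq> {}" for A
    using that V sub finPR by unfold_locales (auto intro: finite_subset)
  interpret perm_family V Q by (rule family) (use QP in auto)
  interpret S: perm_family V S by (rule family) (use SR in auto)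
  have light: "(\<Sum>\<pi>\<in>A. real (card {i\<in>V. edge_prob A (i, \<pi> i) < \<theta> / N})) \<le> N / (32 * real T) * real (card A)"
    if "perm_family V A" for A
  proof -
    have "(\<Sum>\<pi>\<in>A. real (card {i\<in>V. edge_prob A (i, \<pi> i) < \<theta> / N})) \<le> \<theta> / N * real (card V) ^ 2 * real (card A)"
      by (rule perm_family.card_light_edges[OF that]) (use \<tau> in simp)
    also have "\<theta> / N * real (card V) ^ 2 = N / (32 * real T)"
      using N by (simp add: \<theta>_def N_def[symmetric] power2_eq_square)
    finally show ?thesis .
  qed
  have over: "(\<Sum>\<pi>\<in>A. real (card {i\<in>V. \<kappa> / N < edge_prob A (i, \<pi> i)})) \<le> N / (32 * real T) * real (card A)"
    if A: "perm_family V A" and lnA: "ln F - N * ln m - N \<le> ln (real (card A))" for A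
  proof -
    define s where "s = (\<Sum>\<pi>\<in>A. real (card {i\<in>V. \<kappa> / N < edge_prob A (i, \<pi> i)}))"
    have "s * ln \<kappa> \<le> real (card A) * (N * ln (2 * N) - ln (real (card A)))"
      unfolding s_def N_def by (rule perm_family.card_overfull_edges[OF A \<kappa>])
    also have "N * ln (2 * N) - ln (real (card A)) \<le> N * L"
      using lnA lnF N by (simp add: ln_mult L_def algebra_simps)
    finally have "s * (32 * real T * L) \<le> real (card A) * (N * L)" by (simp add: \<kappa>_def mult_left_mono)
    then have "(s * (32 * real T)) * L \<le> (real (card A) * N) * L" by (simp add: mult_ac)
    then have "s * (32 * real T) \<le> real (card A) * N" using L by simp
    then show ?thesis using T by (simp add: s_def field_simps)
  qed
  have untypical: "(\<Sum>w\<in>Q \<times> S. real (card {i\<in>V. \<not> typical_step (\<theta> / N) (\<kappa> / N) Q S w i}))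
      \<le> 4 * (N / (32 * real T)) * real (card (Q \<times> S))"
    by (intro sum_untypical_steps light over lnQ lnS) unfold_locales
  have thin: "(\<Sum>w\<in>Q \<times> S. real (card {i\<in>V. thin_step V (\<theta> / N) T Q S w i})) \<le> N * real (card (Q \<times> S)) / 8"
  proof -
    define s where "s = (\<Sum>w\<in>Q \<times> S. real (card {i\<in>V. thin_step V (\<theta> / N) T Q S w i}))"
    \<comment> \<open>The same deficit for both subsets together: two units for the subsets, but
      only one for the factorial.\<close>
    define L' where "L' = ln 2 + 3 + 2 * ln m"
    have L': "0 < L'" using m ln_ge_zero[of m] ln_gt_zero[of 2] unfolding L'_def by linarith
    have "s \<ge> 0" by (simp add: s_def sum_nonneg)
    then have "s * (8 * L') \<le> s * ln (real T / 4)" using T_large by (intro mult_left_mono) (auto simp: L'_def)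
    also have "\<dots> \<le> real (card (Q \<times> S)) * (ln F + N * ln (2 * N) - ln (real (card Q)) - ln (real (card S)))"
      unfolding s_def N_def F_def by (rule card_thin_steps) (use T in \<open>auto intro: S.perm_family_axioms\<close>)
    also have "\<dots> \<le> real (card (Q \<times> S)) * (N * L')"
    proof (rule mult_left_mono)
      have "N * ln (2 * N) = N * ln 2 + N * ln N" using N by (simp add: ln_mult algebra_simps)
      moreover have "N * L' = N * ln 2 + 3 * N + 2 * (N * ln m)" by (simp add: L'_def algebra_simps)
      ultimately show "ln F + N * ln (2 * N) - ln (real (card Q)) - ln (real (card S)) \<le> N * L'"
        using lnQ lnS lnF by linarith
    qed simp
    finally have "(s * 8) * L' \<le> (real (card (Q \<times> S)) * N) * L'" by (simp add: mult_ac)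
    then have "s * 8 \<le> real (card (Q \<times> S)) * N" using L' by simp
    then show ?thesis by (simp add: s_def mult_ac)
  qed
  have "N ^ 2 \<le> 8 * real T ^ 5 * N * ln N * (2 / \<theta>) ^ T * \<kappa> ^ (2 * T)"
    unfolding N_def
  proof (rule no_return_bound)
    show "((\<rho> \<circ> \<pi>) ^^ s) i \<noteq> i" if "\<pi> \<in> Q" "\<rho> \<in> S" "i \<in> V" "0 < s" "s \<le> T" for \<pi> \<rho> i s
      using no_return that QP SR T by fastforce
    show "(\<Sum>w\<in>Q \<times> S. real (card {i\<in>V. \<not> typical_step (\<theta> / real (card V)) (\<kappa> / real (card V)) Q S w i}))
        \<le> real (card V) * real (card (Q \<times> S)) / (8 * real T)"
      using untypical by (simp add: N_def)
    show "(\<Sum>w\<in>Q \<times> S. real (card {i\<in>V. thin_step V (\<theta> / real (card V)) T Q S w i}))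
        \<le> real (card V) * real (card (Q \<times> S)) / 8"
      using thin by (simp add: N_def)
    show "stable_family V Q (\<theta> / real (card V)) (real (card V))" "stable_family V S (\<theta> / real (card V)) (real (card V))"
      using Q_stable S_stable \<tau> by unfold_locales (auto simp: N_def)
  qed (use T \<theta> \<kappa> in auto)
  also have "2 / \<theta> = 64 * real T" by (simp add: \<theta>_def)
  also have "\<kappa> ^ (2 * T) = exp (64 * real T ^ 2 * L)"
    by (simp add: \<kappa>_def power2_eq_square mult_ac flip: exp_of_nat_mult)
  finally have "N * N \<le> N * (8 * real T ^ 5 * ln N * (64 * real T) ^ T * exp (64 * real T ^ 2 * L))"
    by (simp add: power2_eq_square mult_ac)
  then have "N \<le> 8 * real T ^ 5 * ln N * (64 * real T) ^ T * exp (64 * real T ^ 2 * L)" using N by simp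
  then show False using V_large by (simp add: N_def L_def)
qed

text \<open>Here \<open>l\<close> is the logarithm of n, and \<open>C * l powr (1 / 4) + 6\<close>
  an upper bound for the length of the walk. The last inequality is the logarithm of
  \<open>V_large\<close> for \<open>m = l powr (1 / 64)\<close>; its left side grows like the square
  root of \<open>l\<close> times \<open>ln l\<close>.\<close>

lemma eventually_walk_length_small:
  assumes "0 < (C :: real)"
  shows "eventually (\<lambda>l :: real. 1 \<le> l powr (1 / 64) \<and> C * l powr (1 / 4) + 6 < exp l \<and>
     ln 8 + 5 * ln (C * l powr (1 / 4) + 6) + ln l + (C * l powr (1 / 4) + 6) * ln (64 * (C * l powr (1 / 4) + 6))
       + 64 * (C * l powr (1 / 4) + 6) ^ 2 * (ln 2 + 2 + ln l / 64) < l) at_top"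
  using assms by (intro eventually_conj; real_asymp)

theorem eventually_no_return_rectangle_bound:
  "eventually (\<lambda>n. \<forall>(V :: 'a set) P R. finite V \<and> card V = n \<and> no_return_rectangle V P R
      \<longrightarrow> real (card P) * real (card R) * (ln (real n) powr (1 / 64)) ^ n \<le> fact n ^ 2) at_top"
proof -
  \<comment> \<open>For \<open>m = l powr (1 / 64)\<close> the number \<open>16 * ln m\<close> is
    \<open>ln l / 4\<close>, so walks of length \<open>C * l powr (1 / 4)\<close> would satisfy
    \<open>T_large\<close> with equality.\<close>
  define C where "C = 4 * exp (8 * (ln 2 + 3) :: real)"
  define t where "t l = C * l powr (1 / 4) + 6" for l :: real
  have C: "0 < C" by (simp add: C_def)
  have "eventually (\<lambda>n :: nat. 1 \<le> ln (real n) powr (1 / 64) \<and> t (ln (real n)) < exp (ln (real n)) \<and>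
     ln 8 + 5 * ln (t (ln (real n))) + ln (ln (real n)) + t (ln (real n)) * ln (64 * t (ln (real n)))
       + 64 * t (ln (real n)) ^ 2 * (ln 2 + 2 + ln (ln (real n)) / 64) < ln (real n)) at_top"
    unfolding t_def
    by (rule eventually_compose_filterlim[OF eventually_walk_length_small[OF C]]) real_asymp
  moreover have "eventually (\<lambda>n :: nat. 3 \<le> n) at_top" by (rule eventually_ge_at_top)
  ultimately show ?thesis
  proof eventually_elim
    case (elim n)
    define l where "l = ln (real n)"
    define m where "m = l powr (1 / 64)"
    define T where "T = nat \<lceil>C * l powr (1 / 4)\<rceil> + 5"
    have n: "3 \<le> n" and m1: "1 \<le> m" and tn: "t l < real n"
      and ineq: "ln 8 + 5 * ln (t l) + ln l + t l * ln (64 * t l) + 64 * t l ^ 2 * (ln 2 + 2 + ln l / 64) < l"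
      using elim by (auto simp: l_def m_def)
    have l1: "1 \<le> l"
    proof -
      have "exp 1 \<le> (3 :: real)" using exp_le by simp
      then have "exp 1 \<le> real n" using n by linarith
      then show ?thesis using n by (simp add: l_def ln_ge_iff)
    qed
    have lnm: "ln m = ln l / 64" using l1 by (simp add: m_def ln_powr)
    have y0: "0 \<le> C * l powr (1 / 4)" using C by simp
    have T_le: "real T \<le> t l" using y0 by (simp add: T_def t_def) linarith
    have T_ge: "C * l powr (1 / 4) \<le> real T" using y0 by (simp add: T_def) linarith
    have T5: "5 \<le> T" by (simp add: T_def)
    have posT: "0 < real T" using T5 by simp
    have "8 * (ln 2 + 3 + 2 * ln m) = ln (C * l powr (1 / 4) / 4)"
      using l1 by (simp add: C_def ln_mult ln_powr lnm algebra_simps)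
    also have "\<dots> \<le> ln (real T / 4)" using T_ge C l1 posT by (subst ln_le_cancel_iff) auto
    finally have T_large: "8 * (ln 2 + 3 + 2 * ln m) \<le> ln (real T / 4)" .
    have lnm0: "0 \<le> ln m" using m1 by simp
    define L where "L = ln 2 + 2 + ln m"
    have L: "0 < L" using lnm0 ln_gt_zero[of 2] unfolding L_def by linarith
    have "ln (8 * real T ^ 5 * l * (64 * real T) ^ T * exp (64 * real T ^ 2 * L))
        = ln 8 + 5 * ln (real T) + ln l + real T * ln (64 * real T) + 64 * real T ^ 2 * L"
      using posT l1 by (simp add: ln_mult ln_realpow algebra_simps)
    also have "\<dots> \<le> ln 8 + 5 * ln (t l) + ln l + t l * ln (64 * t l) + 64 * t l ^ 2 * L"
      using posT T5 T_le L by (intro add_mono mult_mono mult_left_mono mult_right_mono power_mono) auto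
    also have "\<dots> < ln (real n)" using ineq by (simp add: L_def lnm l_def)
    finally have V_large: "8 * real T ^ 5 * l * (64 * real T) ^ T * exp (64 * real T ^ 2 * L) < real n"
      using posT l1 n by (subst (asm) ln_less_cancel_iff) auto
    have "T < n" using T_le tn by linarith
    show ?case
    proof (intro allI impI)
      fix V :: "'a set" and P R
      assume H: "finite V \<and> card V = n \<and> no_return_rectangle V P R"
      then have V: "card V = n" by simp
      have "real (card P) * real (card R) * m ^ card V \<le> fact (card V) ^ 2"
      proof (rule no_return_rectangle_bound)
        show "finite V" "V \<noteq> {}" using H n by auto
        show "8 * (ln 2 + 3 + 2 * ln m) \<le> ln (real T / 4)" by (rule T_large)
        show "8 * real T ^ 5 * ln (real (card V)) * (64 * real T) ^ T * exp (64 * real T ^ 2 * (ln 2 + 2 + ln m)) < real (card V)"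
          using V_large by (simp add: V l_def L_def)
      qed (use H m1 T5 \<open>T < n\<close> in auto)
      then show "real (card P) * real (card R) * (ln (real n) powr (1 / 64)) ^ n \<le> fact n ^ 2"
        by (simp add: V m_def l_def)
    qed
  qed
qed

section \<open>Monomials produced by a tropical circuit\<close>

text \<open>The monomials of the formal polynomial of a node, before any are dropped for never
  attaining the maximum. Multisets are used since a formal product may repeat a variable.\<close>

inductive produces :: "('n, 'x) circuit \<Rightarrow> 'n \<Rightarrow> 'x multiset \<Rightarrow> bool" for C :: "('n, 'x) circuit" where
  Var: "gate_of C q = Var_Gate x \<Longrightarrow> produces C q {#x#}"
| Zero: "gate_of C q = Zero_Gate \<Longrightarrow> produces C q {#}"
| Plus: "gate_of C q = Plus_Gate a b \<Longrightarrow> produces C a m \<Longrightarrow> produces C b m' \<Longrightarrow> produces C q (m + m')"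
| Max_left: "gate_of C q = Max_Gate a b \<Longrightarrow> produces C a m \<Longrightarrow> produces C q m"
| Max_right: "gate_of C q = Max_Gate a b \<Longrightarrow> produces C b m \<Longrightarrow> produces C q m"

text \<open>The cofactors of a node: what the rest of a parse tree of the output contributes around
  an occurrence of the node.\<close>

inductive completes :: "('n, 'x) circuit \<Rightarrow> 'n \<Rightarrow> 'x multiset \<Rightarrow> bool" for C :: "('n, 'x) circuit" where
  Out: "completes C (out_node C) {#}"
| Plus_left: "gate_of C q = Plus_Gate a b \<Longrightarrow> completes C q c \<Longrightarrow> produces C b m \<Longrightarrow> completes C a (c + m)"
| Plus_right: "gate_of C q = Plus_Gate a b \<Longrightarrow> completes C q c \<Longrightarrow> produces C a m \<Longrightarrow> completes C b (c + m)"
| Max_left: "gate_of C q = Max_Gate a b \<Longrightarrow> completes C q c \<Longrightarrow> completes C a c"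
| Max_right: "gate_of C q = Max_Gate a b \<Longrightarrow> completes C q c \<Longrightarrow> completes C b c"

text \<open>This makes every node a rectangle: any monomial of the node fits any of its
  cofactors.\<close>

lemma produces_completes:
  "completes C q c \<Longrightarrow> produces C q m \<Longrightarrow> produces C (out_node C) (m + c)"
proof (induction arbitrary: m rule: completes.induct)
  case Out
  then show ?case by simp
next
  case (Plus_left q a b c m')
  have "produces C q (m + m')" by (rule produces.Plus) (use Plus_left in auto)
  from Plus_left.IH[OF this] show ?case by (simp add: ac_simps)
next
  case (Plus_right q a b c m')
  have "produces C q (m' + m)" by (rule produces.Plus) (use Plus_right in auto)
  from Plus_right.IH[OF this] show ?case by (simp add: ac_simps)
qed (auto intro: produces.intros)

lemma produces_le_value:
  "produces C q m \<Longrightarrow> evaluates C \<nu> q r \<Longrightarrow> (\<Sum>x\<in>#m. \<nu> x) \<le> r"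
proof (induction arbitrary: r rule: produces.induct)
  case (Var q x)
  then show ?case by (auto elim: evaluates.cases)
next
  case (Zero q)
  then show ?case by (auto elim: evaluates.cases)
next
  case (Plus q a b m m')
  from Plus.prems Plus.hyps(1) obtain s t where "evaluates C \<nu> a s" "evaluates C \<nu> b t" "r = s + t"
    by (auto elim: evaluates.cases)
  then show ?case using Plus.IH by (simp add: add_mono)
next
  case (Max_left q a b m)
  from Max_left.prems Max_left.hyps(1) obtain s t where "evaluates C \<nu> a s" "r = max s t"
    by (auto elim: evaluates.cases)
  then show ?case using Max_left.IH by (simp add: le_max_iff_disj)
next
  case (Max_right q a b m)
  from Max_right.prems Max_right.hyps(1) obtain s t where "evaluates C \<nu> b t" "r = max s t"
    by (auto elim: evaluates.cases)
  then show ?case using Max_right.IH by (simp add: le_max_iff_disj)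
qed

lemma value_attained:
  "evaluates C \<nu> q r \<Longrightarrow> \<exists>m. produces C q m \<and> (\<Sum>x\<in>#m. \<nu> x) = r"
proof (induction rule: evaluates.induct)
  case (Var q x)
  from produces.Var[OF this] show ?case by fastforce
next
  case (Zero q)
  from produces.Zero[OF this] show ?case by fastforce
next
  case (Plus q a b r s)
  then obtain m m' where m: "produces C a m" "produces C b m'" "(\<Sum>x\<in>#m. \<nu> x) = r" "(\<Sum>x\<in>#m'. \<nu> x) = s"
    by auto
  from produces.Plus[OF Plus.hyps(1) m(1,2)] m(3,4) show ?case by (intro exI[of _ "m + m'"]) simp
next
  case (Max q a b r s)
  then show ?case by (auto simp: max_def intro: produces.Max_left produces.Max_right)
qed

definition balanced_products :: "('n, 'x) circuit \<Rightarrow> nat \<Rightarrow> 'n \<Rightarrow> 'x multiset set" where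
  "balanced_products C N q =
     {m. \<exists>a c. produces C q a \<and> completes C q c \<and> a + c = m \<and> N \<le> 3 * size a \<and> 3 * size a \<le> 2 * N}"

text \<open>Descend in the parse tree as long as a child has more than two thirds of the arcs. Since
  \<open>N\<close> is at least 2, the descent ends before a single variable is reached.\<close>

lemma produces_balanced_split:
  assumes C: "tropical_circuit X C" and N: "2 \<le> N"
  shows "produces C q m \<Longrightarrow> q \<in> nodes C \<Longrightarrow> completes C q c \<Longrightarrow> 2 * N < 3 * size m \<Longrightarrow>
    \<exists>q'\<in>nodes C. \<exists>m' c'. produces C q' m' \<and> completes C q' c' \<and> m' + c' = m + c \<and>
      N \<le> 3 * size m' \<and> 3 * size m' \<le> 2 * N"
proof (induction arbitrary: c rule: produces.induct)
  case (Var q x)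
  then show ?case using N by simp
next
  case (Zero q)
  then show ?case by simp
next
  case (Plus q a b m m')
  have ab: "a \<in> nodes C" "b \<in> nodes C"
    using C Plus.prems(1) Plus.hyps(1) by (auto simp: tropical_circuit_def)
  have ca: "completes C a (c + m')" and cb: "completes C b (c + m)"
    using completes.Plus_left[OF Plus.hyps(1) Plus.prems(2)] completes.Plus_right[OF Plus.hyps(1) Plus.prems(2)]
      Plus.hyps by auto
  show ?case
  proof (cases "2 * N < 3 * size m")
    case True
    from Plus.IH(1)[OF ab(1) ca True] show ?thesis by (simp add: ac_simps)
  next
    case False
    note small_m = this
    show ?thesis
    proof (cases "2 * N < 3 * size m'")
      case True
      from Plus.IH(2)[OF ab(2) cb True] show ?thesis by (simp add: ac_simps)
    next
      case False
      \<comment> \<open>Together the two parts exceed two thirds of \<open>N\<close>, so one of them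
        exceeds one third.\<close>
      with small_m Plus.prems(3) consider "N \<le> 3 * size m" | "N \<le> 3 * size m'" by fastforce
      then show ?thesis
      proof cases
        case 1
        then show ?thesis using ab ca Plus.hyps small_m
          by (intro bexI[of _ a] exI[of _ m] exI[of _ "c + m'"]) (auto simp: ac_simps)
      next
        case 2
        then show ?thesis using ab cb Plus.hyps False
          by (intro bexI[of _ b] exI[of _ m'] exI[of _ "c + m"]) (auto simp: ac_simps)
      qed
    qed
  qed
next
  case (Max_left q a b m)
  have "a \<in> nodes C" using C Max_left.prems(1) Max_left.hyps(1) by (auto simp: tropical_circuit_def)
  moreover have "completes C a c" using Max_left.hyps(1) Max_left.prems(2) by (rule completes.Max_left)
  ultimately show ?case using Max_left.IH Max_left.prems(3) by blast
next
  case (Max_right q a b m)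
  have "b \<in> nodes C" using C Max_right.prems(1) Max_right.hyps(1) by (auto simp: tropical_circuit_def)
  moreover have "completes C b c" using Max_right.hyps(1) Max_right.prems(2) by (rule completes.Max_right)
  ultimately show ?case using Max_right.IH Max_right.prems(3) by blast
qed

lemma card_produced_le:
  assumes C: "tropical_circuit X C" and N: "2 \<le> N" and H: "finite H"
    and produced: "\<And>m. m \<in> H \<Longrightarrow> produces C (out_node C) m \<and> size m = N"
    and bound: "\<And>q. q \<in> nodes C \<Longrightarrow>
      real (card (H \<inter> balanced_products C N q)) \<le> B"
  shows "real (card H) \<le> real (circuit_size C) * B"
proof -
  define R where "R q = H \<inter> balanced_products C N q" for q
  have fin: "finite (nodes C)" and out: "out_node C \<in> nodes C"
    using C by (auto simp: tropical_circuit_def)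
  have "H \<subseteq> (\<Union>q\<in>nodes C. R q)"
  proof
    fix m assume m: "m \<in> H"
    then have "2 * N < 3 * size m" using produced N by simp
    from produces_balanced_split[OF C N _ out completes.Out this] produced[OF m]
    obtain q a c where "q \<in> nodes C" "produces C q a" "completes C q c" "a + c = m" "N \<le> 3 * size a" "3 * size a \<le> 2 * N"
      by auto
    then show "m \<in> (\<Union>q\<in>nodes C. R q)" using m by (auto simp: R_def balanced_products_def)
  qed
  then have "card H \<le> card (\<Union>q\<in>nodes C. R q)"
    using fin H by (intro card_mono) (auto simp: R_def)
  also have "\<dots> \<le> (\<Sum>q\<in>nodes C. card (R q))" by (rule card_UN_le[OF fin])
  finally have "real (card H) \<le> (\<Sum>q\<in>nodes C. real (card (R q)))" by (simp flip: of_nat_sum)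
  also have "\<dots> \<le> (\<Sum>q\<in>nodes C. B)" using bound by (intro sum_mono) (simp add: R_def)
  finally show ?thesis by (simp add: circuit_size_def)
qed

section \<open>Monomials of the travelling salesman polynomial\<close>

definition cycle_arcs :: "'v list \<Rightarrow> ('v \<times> 'v) multiset" where
  "cycle_arcs us = {#(us ! (i - 1), us ! i). i \<in># mset_set {1..length us - 1}#}"

lemma finite_hamiltonian_cycles:
  assumes "finite (pverts G)"
  shows "finite (hamiltonian_cycles G)"
proof (rule finite_subset)
  show "hamiltonian_cycles G \<subseteq> {us. set us \<subseteq> pverts G \<and> length us = card (pverts G) + 1}"
    by (auto simp: hamiltonian_cycles_def)
  show "finite {us. set us \<subseteq> pverts G \<and> length us = card (pverts G) + 1}"
    using assms by (rule finite_lists_length_eq)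
qed

lemma cycle_weight:
  assumes "us \<in> hamiltonian_cycles G"
  shows "(\<Sum>i\<in>{1..card (pverts G)}. \<nu> (us ! (i - 1), us ! i)) = (\<Sum>x\<in>#cycle_arcs us. \<nu> x)"
  using assms by (simp add: cycle_arcs_def hamiltonian_cycles_def sum_unfold_sum_mset image_mset.compositionality comp_def)

lemma size_cycle_arcs: "us \<in> hamiltonian_cycles G \<Longrightarrow> size (cycle_arcs us) = card (pverts G)"
  by (simp add: cycle_arcs_def hamiltonian_cycles_def)

text \<open>The heads of the arcs are the entries of \<open>tl us\<close>, which are
  distinct.\<close>

lemma count_cycle_arcs_le_1:
  assumes "us \<in> hamiltonian_cycles G"
  shows "cycle_arcs us = mset_set (set_mset (cycle_arcs us))"
proof -
  have len: "length us = card (pverts G) + 1" and d: "distinct (tl us)"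
    using assms by (auto simp: hamiltonian_cycles_def)
  have "inj_on (\<lambda>i. (us ! (i - 1), us ! i)) {1..length us - 1}"
  proof (rule inj_onI)
    fix i j assume ij: "i \<in> {1..length us - 1}" "j \<in> {1..length us - 1}"
      and eq: "(us ! (i - 1), us ! i) = (us ! (j - 1), us ! j)"
    have "tl us ! (k - 1) = us ! k" if "k \<in> {1..length us - 1}" for k
      using that nth_tl[of "k - 1" us] by auto
    then have "tl us ! (i - 1) = tl us ! (j - 1)" using ij eq by simp
    then have "i - 1 = j - 1" using ij len d by (subst (asm) nth_eq_iff_index_eq) auto
    then show "i = j" using ij by auto
  qed
  then show ?thesis by (simp add: cycle_arcs_def image_mset_mset_set)
qed

lemma sum_mset_signs:
  fixes m :: "'x multiset"
  assumes "(\<Sum>x\<in>#m. if x \<in> A then 1 else -1 :: real) \<ge> real (size m)"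
  shows "set_mset m \<subseteq> A"
  using assms
proof (induction m)
  case (add x m)
  have le: "(\<Sum>x\<in>#m. if x \<in> A then 1 else -1 :: real) \<le> real (size m)" for m :: "'x multiset"
    by (induction m) auto
  have "x \<in> A" using add.prems le[of m] by (auto split: if_splits)
  then show ?case using add by auto
qed simp

text \<open>All real valuations are available, negative ones included, so the values determine the
  monomials. Constant valuations fix the degree, and valuations 1 on a set and -1 off it compare
  supports. All Hamiltonian cycles have the same degree and no repeated arc, so containment of
  supports already gives equality.\<close>

lemma DTSP_circuit_produces:
  fixes C :: "('n, 'v \<times> 'v) circuit"
  assumes C: "tropical_circuit X C" "calculates C (DTSP G)"
    and G: "finite (pverts G)" "hamiltonian_cycles G \<noteq> {}"
  shows "produces C (out_node C) m \<longleftrightarrow> (\<exists>us\<in>hamiltonian_cycles G. m = cycle_arcs us)"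
proof -
  let ?N = "card (pverts G)"
  let ?sg = "\<lambda>A x. if x \<in> A then 1 else -1 :: real"
  have eval: "evaluates C \<nu> (out_node C) (DTSP G \<nu>)" for \<nu>
    using C circuit_value_eq_iff by (fastforce simp: calculates_def)
  have DTSP_eq: "DTSP G \<nu> = Max ((\<lambda>us. \<Sum>x\<in>#cycle_arcs us. \<nu> x) ` hamiltonian_cycles G)" for \<nu>
    unfolding DTSP_def by (rule arg_cong[of _ _ Max], rule image_cong[OF refl], rule cycle_weight)
  have fin: "finite ((\<lambda>us. \<Sum>x\<in>#cycle_arcs us. \<nu> x) ` hamiltonian_cycles G)" for \<nu> :: "'v \<times> 'v \<Rightarrow> real"
    using finite_hamiltonian_cycles[OF G(1)] by simp
  have attained: "\<exists>us\<in>hamiltonian_cycles G. DTSP G \<nu> = (\<Sum>x\<in>#cycle_arcs us. \<nu> x)" for \<nu>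
    using Max_in[OF fin[of \<nu>]] G(2) by (auto simp: DTSP_eq)
  have le: "(\<Sum>x\<in>#m. \<nu> x) \<le> DTSP G \<nu>" if "produces C (out_node C) m" for m \<nu>
    using produces_le_value[OF that eval] .
  have only: "\<exists>us\<in>hamiltonian_cycles G. m = cycle_arcs us" if m: "produces C (out_node C) m" for m
  proof -
    from attained[of "\<lambda>_. 1"] obtain us where "us \<in> hamiltonian_cycles G" "DTSP G (\<lambda>_. 1) = real ?N"
      by (auto simp: size_cycle_arcs)
    with le[OF m, of "\<lambda>_. 1"] have "size m \<le> ?N" by simp
    moreover from attained[of "\<lambda>_. -1"] obtain us' where "us' \<in> hamiltonian_cycles G" "DTSP G (\<lambda>_. -1) = - real ?N"
      by (auto simp: size_cycle_arcs)
    with le[OF m, of "\<lambda>_. -1"] have "?N \<le> size m" by simp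
    ultimately have size: "size m = ?N" by simp
    obtain us where us: "us \<in> hamiltonian_cycles G"
      and D: "DTSP G (?sg (set_mset m)) = (\<Sum>x\<in>#cycle_arcs us. ?sg (set_mset m) x)"
      using attained by blast
    have "(\<Sum>x\<in>#m. ?sg (set_mset m) x) = (\<Sum>x\<in>#m. 1)"
      by (rule arg_cong[of _ _ sum_mset], rule image_mset_cong) simp
    then have "real (size (cycle_arcs us)) \<le> (\<Sum>x\<in>#cycle_arcs us. ?sg (set_mset m) x)"
      using le[OF m, of "?sg (set_mset m)"] D size us by (simp add: size_cycle_arcs)
    then have "set_mset (cycle_arcs us) \<subseteq> set_mset m" by (rule sum_mset_signs)
    \<comment> \<open>A cycle inside the support of \<open>m\<close> is contained in
      \<open>m\<close> as a multiset; equal sizes leave no room for a repeated variable in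
      \<open>m\<close>.\<close>
    then have "mset_set (set_mset (cycle_arcs us)) \<subseteq># m"
      using subset_imp_msubset_mset_set mset_set_set_mset_msubset subset_mset.order_trans
      by (metis finite_set_mset)
    then have "cycle_arcs us \<subseteq># m" using count_cycle_arcs_le_1[OF us] by simp
    then have "cycle_arcs us = m"
      using size us by (metis mset_subset_size nat_neq_iff size_cycle_arcs subset_mset.le_neq_trans)
    then show ?thesis using us by auto
  qed
  moreover have "produces C (out_node C) (cycle_arcs us)" if us: "us \<in> hamiltonian_cycles G" for us
  proof -
    let ?\<nu> = "?sg (set_mset (cycle_arcs us))"
    \<comment> \<open>The given cycle makes the optimum at least the number of vertices. A monomial
      attaining it has the same degree, so all of its arcs have value 1 and lie on the given
      cycle.\<close>
    obtain m where m: "produces C (out_node C) m" "(\<Sum>x\<in>#m. ?\<nu> x) = DTSP G ?\<nu>"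
      using value_attained[OF eval] by blast
    obtain us' where us': "us' \<in> hamiltonian_cycles G" "m = cycle_arcs us'" using only[OF m(1)] by auto
    have "(\<Sum>x\<in>#cycle_arcs us. ?\<nu> x) = (\<Sum>x\<in>#cycle_arcs us. 1)"
      by (rule arg_cong[of _ _ sum_mset], rule image_mset_cong) simp
    then have "real ?N = (\<Sum>x\<in>#cycle_arcs us. ?\<nu> x)" using us by (simp add: size_cycle_arcs)
    also have "\<dots> \<le> DTSP G ?\<nu>" unfolding DTSP_eq using us fin by (intro Max_ge) auto
    finally have "real (size m) \<le> (\<Sum>x\<in>#m. ?\<nu> x)" using m us' by (simp add: size_cycle_arcs)
    then have "set_mset m \<subseteq> set_mset (cycle_arcs us)" by (rule sum_mset_signs)
    then have "m \<subseteq># cycle_arcs us"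
      using count_cycle_arcs_le_1[OF us] count_cycle_arcs_le_1[OF us'(1)] us'(2)
      by (metis finite_set_mset subset_imp_msubset_mset_set)
    then have "m = cycle_arcs us"
      using us us' by (metis mset_subset_size nat_neq_iff size_cycle_arcs subset_mset.le_neq_trans)
    then show ?thesis using m by simp
  qed
  ultimately show ?thesis by auto
qed

section \<open>Hamiltonian cycles of layered graphs\<close>

text \<open>Vertex \<open>l * n + i\<close> is the \<open>i\<close>-th vertex of layer
  \<open>l\<close>, so \<open>div\<close> and \<open>mod\<close> read off layer and
  position.\<close>

definition layered_graph :: "nat \<Rightarrow> nat \<Rightarrow> nat pair_pre_digraph" where
  "layered_graph n L = \<lparr>pverts = {..<L * n},
     parcs = {(u, v). u < L * n \<and> v < L * n \<and> v div n = Suc (u div n) mod L}\<rparr>"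

definition layer_step :: "nat \<Rightarrow> nat \<Rightarrow> (nat \<Rightarrow> nat \<Rightarrow> nat) \<Rightarrow> nat \<Rightarrow> nat" where
  "layer_step n L \<sigma> u = (Suc (u div n) mod L) * n + \<sigma> (u div n) (u mod n)"

definition step_arcs :: "nat \<Rightarrow> nat \<Rightarrow> (nat \<Rightarrow> nat \<Rightarrow> nat) \<Rightarrow> nat set \<Rightarrow> (nat \<times> nat) multiset" where
  "step_arcs n L \<sigma> D = mset_set ((\<lambda>u. (u, layer_step n L \<sigma> u)) ` D)"

text \<open>The first index is the starting layer, reduced modulo \<open>L\<close> only at use, so
  that compositions can run around the cycle. With \<open>c = L\<close> this is the return map of
  layer \<open>l\<close>.\<close>

primrec layers_comp :: "nat \<Rightarrow> (nat \<Rightarrow> nat \<Rightarrow> nat) \<Rightarrow> nat \<Rightarrow> nat \<Rightarrow> nat \<Rightarrow> nat" where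
  "layers_comp L \<sigma> l 0 = id"
| "layers_comp L \<sigma> l (Suc c) = \<sigma> ((l + c) mod L) \<circ> layers_comp L \<sigma> l c"

lemma layer_div_mod:
  fixes l i n :: nat
  assumes "i < n"
  shows "(l * n + i) div n = l" "(l * n + i) mod n = i"
  using assms by simp_all

lemma layer_index_less:
  fixes l i n :: nat
  assumes "i < n" "l < L"
  shows "l * n + i < L * n"
proof -
  have "l * n + i < Suc l * n" using assms by simp
  also have "\<dots> \<le> L * n" using assms by (intro mult_right_mono) auto
  finally show ?thesis .
qed

lemma layer_div_less: "u < L * n \<Longrightarrow> u div n < (L::nat)"
  by (simp add: less_mult_imp_div_less)

lemma layer_mod_less: "u < L * n \<Longrightarrow> u mod n < (n::nat)"
  by (cases n) auto

context
  fixes n L :: nat and \<sigma> :: "nat \<Rightarrow> nat \<Rightarrow> nat"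
  assumes perm: "\<And>l. l < L \<Longrightarrow> \<sigma> l permutes {..<n}" and L: "0 < L"
begin

lemma layers_comp_permutes: "layers_comp L \<sigma> l c permutes {..<n}"
  using perm L by (induction c) (auto intro: permutes_compose permutes_id)

lemma layers_comp_less: "i < n \<Longrightarrow> layers_comp L \<sigma> l c i < n"
  using permutes_in_image[OF layers_comp_permutes] by simp

lemma funpow_layer_step:
  assumes "i < n" "l < L"
  shows "(layer_step n L \<sigma> ^^ c) (l * n + i) = ((l + c) mod L) * n + layers_comp L \<sigma> l c i"
proof (induction c)
  case 0
  then show ?case using assms by simp
next
  case (Suc c)
  have "(layer_step n L \<sigma> ^^ Suc c) (l * n + i) = layer_step n L \<sigma> (((l + c) mod L) * n + layers_comp L \<sigma> l c i)"
    using Suc by simp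
  also have "\<dots> = (Suc ((l + c) mod L) mod L) * n + \<sigma> ((l + c) mod L) (layers_comp L \<sigma> l c i)"
    unfolding layer_step_def layer_div_mod[OF layers_comp_less[OF assms(1)]] ..
  finally show ?case by (simp add: mod_Suc_eq)
qed

lemma layer_step_less: "u < L * n \<Longrightarrow> layer_step n L \<sigma> u < L * n"
  unfolding layer_step_def
  using permutes_in_image[OF perm[OF layer_div_less[of u L n]], of "u mod n"] layer_mod_less[of u L n] L
  by (intro layer_index_less) auto

end

lemma layers_comp_add: "layers_comp L \<sigma> l (a + b) = layers_comp L \<sigma> (l + a) b \<circ> layers_comp L \<sigma> l a"
  by (induction b) (simp_all add: comp_assoc add.assoc)

lemma layers_comp_cong:
  "(\<And>t. t < c \<Longrightarrow> \<sigma> ((l + t) mod L) = \<sigma>' ((l + t) mod L)) \<Longrightarrow> layers_comp L \<sigma> l c = layers_comp L \<sigma>' l c"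
  by (induction c) simp_all

lemma layers_comp_periodic: "layers_comp L \<sigma> (l + k * L) c = layers_comp L \<sigma> l c"
proof (induction c)
  case (Suc c)
  have "(l + k * L + c) mod L = (l + c) mod L" by (metis add.assoc add.commute mod_mult_self1)
  then show ?case using Suc by simp
qed simp

lemma layers_comp_times: "layers_comp L \<sigma> l (s * L) = layers_comp L \<sigma> l L ^^ s"
proof (induction s)
  case (Suc s)
  have "layers_comp L \<sigma> (l + L) (s * L) = layers_comp L \<sigma> l (s * L)"
    using layers_comp_periodic[of L \<sigma> l 1] by simp
  then have "layers_comp L \<sigma> l (L + s * L) = layers_comp L \<sigma> l L ^^ s \<circ> layers_comp L \<sigma> l L"
    using Suc by (simp only: layers_comp_add)
  then show ?case by (simp add: funpow_Suc_right del: funpow.simps)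
qed simp

text \<open>The heads are \<open>tl us\<close> and the tails are \<open>butlast us\<close>; the
  latter is a rearrangement of the former because first and last entry agree.\<close>

lemma hamiltonian_fst_snd:
  assumes "us \<in> hamiltonian_cycles G" "finite (pverts G)"
  shows "image_mset fst (cycle_arcs us) = mset_set (pverts G)"
    and "image_mset snd (cycle_arcs us) = mset_set (pverts G)"
proof -
  let ?N = "card (pverts G)"
  have len: "length us = ?N + 1" and last: "us ! 0 = us ! ?N" and set: "set us = pverts G" and d: "distinct (tl us)"
    using assms by (auto simp: hamiltonian_cycles_def)
  obtain x xs where us: "us = x # xs" using len by (cases us) auto
  have xs: "length xs = ?N" "distinct xs" using len d us by auto
  have nonempty: "xs \<noteq> []"
  proof
    assume "xs = []"
    then have "pverts G = {x}" "?N = 0" using set us xs by auto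
    then show False by simp
  qed
  have x_last: "x = last xs" using last us xs nonempty by (simp add: last_conv_nth nth_Cons' split: if_splits)
  have "last xs \<in> set xs" using nonempty by simp
  moreover have "insert x (set xs) = pverts G" using set us by simp
  ultimately have set_xs: "set xs = pverts G" using x_last by (simp add: insert_absorb)
  have tl_eq: "mset xs = mset_set (pverts G)" using mset_set_set[OF xs(2)] set_xs by simp
  have shift: "mset_set {1..?N} = image_mset Suc (mset_set {0..<?N})"
    by (simp add: image_mset_mset_set image_Suc_atLeastLessThan atLeastLessThanSuc_atLeastAtMost)
  have len1: "length us - 1 = ?N" using len by simp
  have arcs: "cycle_arcs us = image_mset (\<lambda>i. (us ! i, us ! Suc i)) (mset_set {0..<?N})"
    unfolding cycle_arcs_def len1 shift by (simp add: image_mset.compositionality comp_def)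
  have "image_mset snd (cycle_arcs us) = mset (map ((!) xs) [0..<?N])"
    unfolding arcs by (simp add: us image_mset.compositionality comp_def)
  also have "map ((!) xs) [0..<?N] = xs" using map_nth[of xs] xs by simp
  finally show "image_mset snd (cycle_arcs us) = mset_set (pverts G)" using tl_eq by simp
  have "image_mset fst (cycle_arcs us) = mset (map ((!) us) [0..<?N])"
    unfolding arcs by (simp add: image_mset.compositionality comp_def)
  also have "map ((!) us) [0..<?N] = butlast us"
    using len by (simp add: list_eq_iff_nth_eq nth_butlast)
  also have "butlast us = x # butlast xs" using us nonempty by simp
  also have "mset (x # butlast xs) = mset (butlast xs @ [last xs])" using x_last by simp
  also have "\<dots> = mset xs" using nonempty by (subst append_butlast_last_id) auto
  finally show "image_mset fst (cycle_arcs us) = mset_set (pverts G)" using tl_eq by simp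
qed

text \<open>Iterating \<open>g\<close> moves along the cycle, whose vertices do not repeat before
  the full length.\<close>

lemma hamiltonian_no_return:
  assumes us: "us \<in> hamiltonian_cycles G" and arcs: "set_mset (cycle_arcs us) \<subseteq> {(u, g u) | u. True}"
    and v: "v \<in> pverts G" and s: "0 < s" "s < card (pverts G)"
  shows "(g ^^ s) v \<noteq> v"
proof
  assume ret: "(g ^^ s) v = v"
  let ?N = "card (pverts G)"
  have len: "length us = ?N + 1" and last: "us ! 0 = us ! ?N" and set: "set us = pverts G" and d: "distinct (tl us)"
    using us by (auto simp: hamiltonian_cycles_def)
  have step: "us ! Suc i = g (us ! i)" if "i < ?N" for i
  proof -
    have "Suc i \<in> {1..length us - 1}" using that len by simp
    then have "(us ! (Suc i - 1), us ! Suc i) \<in> set_mset (cycle_arcs us)"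
      by (simp only: cycle_arcs_def set_image_mset finite_set_mset_mset_set finite_atLeastAtMost image_eqI)
    then show ?thesis using arcs by auto
  qed
  have pow: "us ! (i + t) = (g ^^ t) (us ! i)" if "i + t \<le> ?N" for i t
    using that by (induction t) (simp_all add: step)
  have inj: "i = j" if "us ! i = us ! j" "1 \<le> i" "i \<le> ?N" "1 \<le> j" "j \<le> ?N" for i j
  proof -
    have "tl us ! (i - 1) = tl us ! (j - 1)" using that len nth_tl[of "i - 1" us] nth_tl[of "j - 1" us] by simp
    then have "i - 1 = j - 1" using that len d by (subst (asm) nth_eq_iff_index_eq) auto
    then show ?thesis using that by simp
  qed
  obtain i0 where "i0 \<le> ?N" "us ! i0 = v" using v set len by (metis add.commute in_set_conv_nth less_Suc_eq_le plus_1_eq_Suc)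
  \<comment> \<open>Index 0 is replaced by the last index, which carries the same vertex and lies in
    the part of the list known to be distinct.\<close>
  then have "1 \<le> (if i0 = 0 then ?N else i0)" "(if i0 = 0 then ?N else i0) \<le> ?N"
    "us ! (if i0 = 0 then ?N else i0) = v" using last s by auto
  then obtain i where i: "1 \<le> i" "i \<le> ?N" "us ! i = v" by blast
  show False
  proof (cases "i + s \<le> ?N")
    case True
    then have "us ! (i + s) = us ! i" using pow ret i by simp
    then show False using inj[of "i + s" i] True i s by auto
  next
    case False
    \<comment> \<open>The walk passes the end of the list and continues from index 0.\<close>
    define j where "j = i + s - ?N"
    have j: "1 \<le> j" "j < i" "j + (?N - i) = s" using False s i by (auto simp: j_def)
    have "us ! j = (g ^^ j) (us ! ?N)" using pow[of 0 j] j i last by simp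
    also have "us ! ?N = (g ^^ (?N - i)) v" using pow[of i "?N - i"] i by simp
    also have "(g ^^ j) ((g ^^ (?N - i)) v) = (g ^^ s) v" using funpow_add[of j "?N - i" g] j by simp
    finally have "us ! j = us ! i" using ret i by simp
    then show False using inj[of j i] i j by auto
  qed
qed

lemma orbit_hamiltonian:
  assumes fin: "finite (pverts G)" and N: "0 < card (pverts G)"
    and arcs: "\<And>v. v \<in> pverts G \<Longrightarrow> (v, g v) \<in> parcs G" and closed: "\<And>v. v \<in> pverts G \<Longrightarrow> g v \<in> pverts G"
    and v: "v \<in> pverts G" and ret: "(g ^^ card (pverts G)) v = v"
    and cover: "\<And>u. u \<in> pverts G \<Longrightarrow> \<exists>t<card (pverts G). (g ^^ t) v = u"
  shows "\<exists>us\<in>hamiltonian_cycles G. cycle_arcs us = mset_set ((\<lambda>u. (u, g u)) ` pverts G)"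
proof -
  let ?N = "card (pverts G)"
  define us where "us = map (\<lambda>t. (g ^^ t) v) [0..<Suc ?N]"
  have us_nth: "us ! t = (g ^^ t) v" if "t \<le> ?N" for t
    using that unfolding us_def by (subst nth_map) (auto simp del: upt_Suc)
  have len: "length us = Suc ?N" by (simp add: us_def)
  have in_V: "(g ^^ t) v \<in> pverts G" for t using v closed by (induction t) auto
  have img: "(\<lambda>t. (g ^^ t) v) ` {..<?N} = pverts G" using cover in_V by force
  have inj: "inj_on (\<lambda>t. (g ^^ t) v) {..<?N}" by (rule eq_card_imp_inj_on) (simp_all add: img)
  have img_Suc: "(\<lambda>t. (g ^^ t) v) ` {1..?N} = pverts G"
  proof -
    have "{1..?N} = insert ?N ({..<?N} - {0})" using N by auto
    moreover have "pverts G = insert v ((\<lambda>t. (g ^^ t) v) ` ({..<?N} - {0}))"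
    proof -
      have "{..<?N} = insert 0 ({..<?N} - {0})" using N by auto
      then show ?thesis using img by (metis (no_types, lifting) funpow_0 image_insert)
    qed
    ultimately show ?thesis using ret by (metis (no_types, lifting) image_insert)
  qed
  have inj_Suc: "inj_on (\<lambda>t. (g ^^ t) v) {1..?N}" by (rule eq_card_imp_inj_on) (simp_all only: img_Suc finite_atLeastAtMost card_atLeastAtMost diff_Suc_1)
  have tl_us: "tl us = map (\<lambda>t. (g ^^ t) v) [1..<Suc ?N]"
    unfolding us_def map_tl[symmetric] by (simp add: tl_upt del: upt_Suc)
  have "distinct (tl us)" unfolding tl_us distinct_map
    using inj_Suc by (simp add: atLeastLessThanSuc_atLeastAtMost del: upt_Suc)
  moreover have "set us = pverts G"
  proof
    show "set us \<subseteq> pverts G" using in_V by (auto simp: us_def)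
    show "pverts G \<subseteq> set us"
    proof
      fix u assume "u \<in> pverts G"
      then obtain t where "t < ?N" "(g ^^ t) v = u" using cover by blast
      then show "u \<in> set us" using us_nth[of t] len by (metis less_SucI less_imp_le nth_mem)
    qed
  qed
  moreover have "(us ! (i - 1), us ! i) \<in> parcs G" if "i \<in> {1..?N}" for i
  proof -
    obtain t where "i = Suc t" using \<open>i \<in> _\<close> by (cases i) auto
    then show ?thesis using \<open>i \<in> _\<close> us_nth[of t] us_nth[of i] arcs[OF in_V[of t]] by simp
  qed
  ultimately have ham: "us \<in> hamiltonian_cycles G"
    using len us_nth[of 0] us_nth[of ?N] ret by (simp add: hamiltonian_cycles_def)
  have "set_mset (cycle_arcs us) = (\<lambda>u. (u, g u)) ` pverts G"
  proof -
    have "set_mset (cycle_arcs us) = (\<lambda>i. (us ! (i - 1), us ! i)) ` {1..?N}"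
      using len by (simp add: cycle_arcs_def)
    also have "\<dots> = (\<lambda>t. (us ! t, us ! Suc t)) ` {..<?N}"
    proof -
      have "{1..?N} = Suc ` {..<?N}" by (auto simp: image_iff Suc_le_eq gr0_conv_Suc intro: Suc_leI)
      then show ?thesis by (simp add: image_image)
    qed
    also have "\<dots> = (\<lambda>t. ((g ^^ t) v, g ((g ^^ t) v))) ` {..<?N}"
      by (rule image_cong) (simp_all add: us_nth)
    also have "\<dots> = (\<lambda>u. (u, g u)) ` ((\<lambda>t. (g ^^ t) v) ` {..<?N})"
      by (simp only: image_image)
    also have "\<dots> = (\<lambda>u. (u, g u)) ` pverts G" by (simp only: img)
    finally show ?thesis .
  qed
  then show ?thesis using ham count_cycle_arcs_le_1[OF ham] by auto
qed

section \<open>Size and pathwidth of the layered graph; its cycles as tuples of permutations\<close>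

lemma finite_verts_layered_graph: "finite (pverts (layered_graph n L))"
  by (simp add: layered_graph_def)

lemma card_verts_layered_graph: "card (pverts (layered_graph n L)) = L * n"
  by (simp add: layered_graph_def)

lemma pair_fin_digraph_layered_graph: "pair_fin_digraph (layered_graph n L)"
proof
  show "finite (parcs (layered_graph n L))"
    by (rule finite_subset[of _ "{..<L * n} \<times> {..<L * n}"]) (auto simp: layered_graph_def)
qed (auto simp: layered_graph_def)

lemma card_layer_le: "card {x \<in> X. x div n = t} \<le> (n::nat)" if "0 < n"
proof -
  have "{x \<in> X. x div n = t} \<subseteq> {t * n..<t * n + n}"
    using that by (auto simp: dividend_less_times_div div_times_less_eq_dividend)
       (metis add.commute dividend_less_times_div mult.commute)
  then have "card {x \<in> X. x div n = t} \<le> card {t * n..<t * n + n}" by (intro card_mono) auto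
  then show ?thesis by simp
qed

text \<open>Layer 0 is kept in every bag, which cuts the cyclic arrangement open; then two
  consecutive layers at a time suffice. A bag thus holds at most three layers.\<close>

lemma pathwidth_layered_graph:
  assumes n: "0 < n" and L: "2 \<le> L"
  shows "pathwidth (layered_graph n L) \<le> 3 * n - 1"
proof -
  define V where "V = {..<L * n}"
  define bag where "bag l = {x \<in> V. x div n = 0 \<or> x div n = l \<or> x div n = Suc l}" for l
  define bags where "bags = map bag [0..<L - 1]"
  have len: "length bags = L - 1" by (simp add: bags_def)
  have nth: "bags ! l = bag l" if "l < L - 1" for l using that by (simp add: bags_def)
  have set: "set bags = bag ` {..<L - 1}" by (auto simp: bags_def)
  have ne: "bags \<noteq> []" using L by (simp add: bags_def)
  have layer: "x div n < L" if "x \<in> V" for x using that layer_div_less by (auto simp: V_def)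
  have "path_decomposition (layered_graph n L) bags"
    unfolding path_decomposition_def
  proof (intro conjI)
    show "bags \<noteq> []" by (rule ne)
    show "(\<Union>\<beta>\<in>set bags. \<beta>) = pverts (layered_graph n L)"
    proof
      show "(\<Union>\<beta>\<in>set bags. \<beta>) \<subseteq> pverts (layered_graph n L)"
        by (auto simp: set bag_def V_def layered_graph_def)
      show "pverts (layered_graph n L) \<subseteq> (\<Union>\<beta>\<in>set bags. \<beta>)"
      proof
        fix x assume "x \<in> pverts (layered_graph n L)"
        then have x: "x \<in> V" by (simp add: layered_graph_def V_def)
        \<comment> \<open>By truncated subtraction a vertex of layer 0 is sent to
          \<open>bag 0\<close>, which contains it like every other bag.\<close>
        have "x \<in> bag (x div n - 1)" using x by (auto simp: bag_def)
        moreover have "x div n - 1 < L - 1" using layer[OF x] L by linarith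
        ultimately show "x \<in> (\<Union>\<beta>\<in>set bags. \<beta>)" by (auto simp: set)
      qed
    qed
    show "\<forall>(u, v)\<in>parcs (layered_graph n L). \<exists>\<beta>\<in>set bags. u \<in> \<beta> \<and> v \<in> \<beta>"
    proof clarify
      fix u v assume "(u, v) \<in> parcs (layered_graph n L)"
      then have u: "u \<in> V" and v: "v \<in> V" and uv: "v div n = Suc (u div n) mod L"
        by (auto simp: layered_graph_def V_def)
      show "\<exists>\<beta>\<in>set bags. u \<in> \<beta> \<and> v \<in> \<beta>"
      proof (cases "Suc (u div n) = L")
        case True
        then have "u \<in> bag (u div n - 1)" "v \<in> bag (u div n - 1)" "u div n - 1 < L - 1"
          using u v uv L by (auto simp: bag_def)
        then show ?thesis by (auto simp: set)
      next
        case False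
        then have "Suc (u div n) < L" using layer[OF u] by simp
        then have "u \<in> bag (u div n)" "v \<in> bag (u div n)" "u div n < L - 1"
          using u v uv by (auto simp: bag_def)
        then show ?thesis by (auto simp: set)
      qed
    qed
    show "\<forall>i j l. i \<le> j \<and> j \<le> l \<and> l < length bags \<longrightarrow> bags ! i \<inter> bags ! l \<subseteq> bags ! j"
    proof (intro allI impI subsetI)
      fix i j l x assume ijl: "i \<le> j \<and> j \<le> l \<and> l < length bags" and x: "x \<in> bags ! i \<inter> bags ! l"
      then have "x \<in> bag i" "x \<in> bag l" using nth[of i] nth[of l] len by auto
      then have "x \<in> bag j" using ijl by (auto simp: bag_def)
      then show "x \<in> bags ! j" using nth[of j] ijl len by simp
    qed
  qed
  then have "pathwidth (layered_graph n L) \<le> decomposition_width bags"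
    unfolding pathwidth_def by (intro Least_le) auto
  also have "\<dots> \<le> 3 * n - 1"
  proof -
    have "card (bag l) \<le> 3 * n" for l
    proof -
      have "bag l = {x \<in> V. x div n = 0} \<union> ({x \<in> V. x div n = l} \<union> {x \<in> V. x div n = Suc l})"
        by (auto simp: bag_def)
      then have "card (bag l) \<le> card {x \<in> V. x div n = 0} + (card {x \<in> V. x div n = l} + card {x \<in> V. x div n = Suc l})"
        by (metis (no_types, lifting) add_left_mono card_Un_le order_trans)
      then show ?thesis using card_layer_le[OF n, of V 0] card_layer_le[OF n, of V l] card_layer_le[OF n, of V "Suc l"]
        by linarith
    qed
    then have "Max (card ` set bags) \<le> 3 * n" using L by (subst Max_le_iff) (auto simp: set lessThan_empty_iff)
    then show ?thesis by (simp add: decomposition_width_def)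
  qed
  finally show ?thesis .
qed

text \<open>\<open>s\<close> rounds of the return map are \<open>s * L\<close> steps in the graph,
  fewer than its \<open>L * n\<close> vertices.\<close>

lemma step_arcs_no_return:
  assumes perm: "\<And>l. l < L \<Longrightarrow> \<sigma> l permutes {..<n}"
    and us: "us \<in> hamiltonian_cycles (layered_graph n L)" "cycle_arcs us = step_arcs n L \<sigma> {..<L * n}"
    and li: "l < L" "i < n" and s: "0 < s" "s < n"
  shows "(layers_comp L \<sigma> l L ^^ s) i \<noteq> i"
proof
  assume ret: "(layers_comp L \<sigma> l L ^^ s) i = i"
  have L: "0 < L" using li by simp
  have "(layer_step n L \<sigma> ^^ (s * L)) (l * n + i) \<noteq> l * n + i"
  proof (rule hamiltonian_no_return[OF us(1)])
    show "set_mset (cycle_arcs us) \<subseteq> {(u, layer_step n L \<sigma> u) |u. True}"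
      by (auto simp: us(2) step_arcs_def)
    show "l * n + i \<in> pverts (layered_graph n L)"
      using layer_index_less[OF li(2,1)] by (simp add: layered_graph_def)
    show "0 < s * L" "s * L < card (pverts (layered_graph n L))"
      using s L by (simp_all add: card_verts_layered_graph)
  qed
  then show False
    using ret li by (simp add: funpow_layer_step[OF perm L li(2,1)] layers_comp_times)
qed

abbreviation perm_tuples :: "nat \<Rightarrow> nat \<Rightarrow> (nat \<Rightarrow> nat \<Rightarrow> nat) set" where
  "perm_tuples n L \<equiv> {..<L} \<rightarrow>\<^sub>E {p. p permutes {..<n}}"

text \<open>The return map of layer 0 is an n-cycle, expressed through the orbit of 0.\<close>

definition cyclic_tuples :: "nat \<Rightarrow> nat \<Rightarrow> (nat \<Rightarrow> nat \<Rightarrow> nat) set" where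
  "cyclic_tuples n L = {\<sigma> \<in> perm_tuples n L.
     (layers_comp L \<sigma> 0 L ^^ n) 0 = 0 \<and> (\<forall>j<n. \<exists>k<n. (layers_comp L \<sigma> 0 L ^^ k) 0 = j)}"

lemma cyclic_tuple_hamiltonian:
  assumes \<sigma>: "\<sigma> \<in> cyclic_tuples n L" and n: "0 < n" and L: "0 < L"
  shows "\<exists>us\<in>hamiltonian_cycles (layered_graph n L). cycle_arcs us = step_arcs n L \<sigma> {..<L * n}"
proof -
  let ?G = "layered_graph n L" and ?g = "layer_step n L \<sigma>" and ?z = "layers_comp L \<sigma> 0 L"
  have perm: "\<sigma> l permutes {..<n}" if "l < L" for l using \<sigma> that by (auto simp: cyclic_tuples_def)
  have pow: "(?g ^^ c) 0 = (c mod L) * n + layers_comp L \<sigma> 0 c 0" for c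
    using funpow_layer_step[OF perm L n L, where c = c] by simp
  have verts: "pverts ?G = {..<L * n}" by (simp add: layered_graph_def)
  have "\<exists>us\<in>hamiltonian_cycles ?G. cycle_arcs us = mset_set ((\<lambda>u. (u, ?g u)) ` pverts ?G)"
  proof (rule orbit_hamiltonian)
    show "finite (pverts ?G)" "0 < card (pverts ?G)" "0 \<in> pverts ?G"
      using n L by (simp_all add: finite_verts_layered_graph card_verts_layered_graph verts)
    show "(?g ^^ card (pverts ?G)) 0 = 0"
      using \<sigma> by (simp add: card_verts_layered_graph pow mult.commute[of L n] layers_comp_times cyclic_tuples_def)
    fix v assume "v \<in> pverts ?G"
    then have v: "v < L * n" by (simp add: verts)
    have gv: "?g v < L * n" by (rule layer_step_less[OF perm L v])
    then show "?g v \<in> pverts ?G" by (simp add: verts)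
    have "\<sigma> (v div n) (v mod n) < n"
      using permutes_in_image[OF perm[OF layer_div_less[OF v]]] layer_mod_less[OF v] by simp
    then have "?g v div n = Suc (v div n) mod L" unfolding layer_step_def by (rule layer_div_mod)
    then show "(v, ?g v) \<in> parcs ?G" using v gv by (simp add: layered_graph_def)
    define l where "l = v div n"
    have l: "l < L" using layer_div_less[OF v] by (simp add: l_def)
    have bij: "layers_comp L \<sigma> 0 l permutes {..<n}" by (rule layers_comp_permutes[OF perm L])
    have "v mod n \<in> layers_comp L \<sigma> 0 l ` {..<n}"
      using layer_mod_less[OF v] permutes_image[OF bij] by simp
    then obtain j where j: "j < n" "layers_comp L \<sigma> 0 l j = v mod n" by auto
    obtain k where k: "k < n" "(?z ^^ k) 0 = j" using \<sigma> j(1) by (auto simp: cyclic_tuples_def)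
    \<comment> \<open>\<open>k\<close> full rounds lead from 0 to \<open>j\<close> in layer 0, and
      \<open>l\<close> further steps lead from there to \<open>v\<close>.\<close>
    have "(?g ^^ (k * L + l)) 0 = l * n + layers_comp L \<sigma> (0 + k * L) l (layers_comp L \<sigma> 0 (k * L) 0)"
      using l by (simp add: pow layers_comp_add[of L \<sigma> 0 "k * L" l])
    also have "\<dots> = v"
      using k j by (simp only: layers_comp_periodic layers_comp_times) (simp add: l_def)
    finally have "(?g ^^ (k * L + l)) 0 = v" .
    moreover have "k * L + l < card (pverts ?G)"
      using layer_index_less[OF l k(1)] by (simp add: card_verts_layered_graph mult.commute)
    ultimately show "\<exists>t<card (pverts ?G). (?g ^^ t) 0 = v" by blast
  qed
  then show ?thesis by (simp add: step_arcs_def verts)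
qed

section \<open>Counting the cyclic tuples\<close>

definition rotation :: "nat \<Rightarrow> nat \<Rightarrow> nat" where
  "rotation n i = (if i < n then Suc i mod n else i)"

lemma rotation_permutes: "rotation n permutes {..<n}"
proof (rule bij_imp_permutes)
  have inj: "inj_on (rotation n) {..<n}"
  proof (rule inj_onI)
    fix i j assume "i \<in> {..<n}" "j \<in> {..<n}" "rotation n i = rotation n j"
    then show "i = j" by (cases "Suc i = n"; cases "Suc j = n") (auto simp: rotation_def)
  qed
  moreover have "rotation n ` {..<n} \<subseteq> {..<n}" by (auto simp: rotation_def)
  ultimately show "bij_betw (rotation n) {..<n} {..<n}"
    by (simp add: bij_betw_def endo_inj_surj)
qed (simp add: rotation_def)

lemma funpow_rotation: "k < n \<Longrightarrow> (rotation n ^^ k) 0 = k"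
  by (induction k) (simp_all add: rotation_def)

lemma funpow_conj:
  assumes "g permutes V"
  shows "(g \<circ> r \<circ> inv g) ^^ k = g \<circ> r ^^ k \<circ> inv g"
proof (induction k)
  case 0
  show ?case using permutes_inv_o[OF assms] by simp
next
  case (Suc k)
  have "(g \<circ> r \<circ> inv g) ^^ Suc k = (g \<circ> r \<circ> inv g) \<circ> (g \<circ> r ^^ k \<circ> inv g)"
    by (simp only: funpow.simps Suc)
  also have "\<dots> = g \<circ> r \<circ> (inv g \<circ> g) \<circ> r ^^ k \<circ> inv g" by (simp only: comp_assoc)
  also have "\<dots> = g \<circ> r ^^ Suc k \<circ> inv g"
    by (simp only: permutes_inv_o[OF assms] comp_id funpow.simps comp_assoc)
  finally show ?case .
qed

text \<open>All layers but the last are free, and the last one is solved for so that the return map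
  is a prescribed n-cycle. The (n-1)! prescribed cycles are the conjugates of the rotation by
  permutations \<open>g\<close> that fix 0; \<open>g\<close> is recovered from its cycle because
  \<open>g k\<close> is the \<open>k\<close>-th iterate at 0.\<close>

lemma card_cyclic_tuples:
  assumes n: "0 < n" and L: "0 < L"
  shows "fact n ^ L \<le> n * card (cyclic_tuples n L)"
proof -
  define perms where "perms = {p. p permutes {..<n}}"
  define fixing where "fixing = {g. g permutes {1..<n}}"
  define z where "z g = g \<circ> rotation n \<circ> inv g" for g :: "nat \<Rightarrow> nat"
  define \<Phi> where "\<Phi> = (\<lambda>(\<tau> :: nat \<Rightarrow> nat \<Rightarrow> nat, g). \<lambda>l\<in>{..<L}. if l = L - 1 then z g \<circ> inv (layers_comp L \<tau> 0 (L - 1)) else \<tau> l)"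
  let ?D = "({..<L - 1} \<rightarrow>\<^sub>E perms) \<times> fixing"
  have fix_perm: "g permutes {..<n}" "g 0 = 0" if "g \<in> fixing" for g
    using that by (auto simp: fixing_def permutes_not_in intro: permutes_subset)
  have z_perm: "z g permutes {..<n}" if "g \<in> fixing" for g
    unfolding z_def using fix_perm[OF that] rotation_permutes by (intro permutes_compose permutes_inv)
  have z_pow: "(z g ^^ k) 0 = g ((rotation n ^^ k) 0)" if "g \<in> fixing" for g k
  proof -
    have "inv g 0 = 0" using fix_perm[OF that] by (metis permutes_inverses(2))
    then show ?thesis unfolding z_def funpow_conj[OF fix_perm(1)[OF that]] by simp
  qed
  have comp_\<tau>: "layers_comp L \<tau> 0 (L - 1) permutes {..<n}" if "\<tau> \<in> {..<L - 1} \<rightarrow>\<^sub>E perms" for \<tau>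
  proof -
    have "layers_comp L (\<lambda>l. if l < L - 1 then \<tau> l else id) 0 (L - 1) permutes {..<n}"
      by (rule layers_comp_permutes) (use that L in \<open>auto simp: perms_def permutes_id\<close>)
    also have "layers_comp L (\<lambda>l. if l < L - 1 then \<tau> l else id) 0 (L - 1) = layers_comp L \<tau> 0 (L - 1)"
      by (rule layers_comp_cong) auto
    finally show ?thesis .
  qed
  have comp_\<Phi>: "layers_comp L (\<Phi> (\<tau>, g)) 0 L = z g" if "\<tau> \<in> {..<L - 1} \<rightarrow>\<^sub>E perms" "g \<in> fixing" for \<tau> g
  proof -
    have eq: "layers_comp L (\<Phi> (\<tau>, g)) 0 (L - 1) = layers_comp L \<tau> 0 (L - 1)"
      by (rule layers_comp_cong) (auto simp: \<Phi>_def)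
    have "layers_comp L (\<Phi> (\<tau>, g)) 0 (Suc (L - 1)) = \<Phi> (\<tau>, g) (L - 1) \<circ> layers_comp L \<tau> 0 (L - 1)"
      unfolding layers_comp.simps eq using L by simp
    also have "\<dots> = z g \<circ> (inv (layers_comp L \<tau> 0 (L - 1)) \<circ> layers_comp L \<tau> 0 (L - 1))"
      using L by (simp add: \<Phi>_def comp_assoc)
    also have "\<dots> = z g" using permutes_inv_o[OF comp_\<tau>[OF that(1)]] by simp
    finally show ?thesis using L by simp
  qed
  have inj: "inj_on \<Phi> ?D"
  proof (rule inj_onI)
    fix p p' assume p: "p \<in> ?D" "p' \<in> ?D" and eq: "\<Phi> p = \<Phi> p'"
    obtain \<tau> g \<tau>' g' where pp: "p = (\<tau>, g)" "p' = (\<tau>', g')" by fastforce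
    have t: "\<tau> \<in> {..<L - 1} \<rightarrow>\<^sub>E perms" "\<tau>' \<in> {..<L - 1} \<rightarrow>\<^sub>E perms" and g: "g \<in> fixing" "g' \<in> fixing"
      using p by (auto simp: pp)
    have zz: "z g = z g'" using comp_\<Phi>[OF t(1) g(1)] comp_\<Phi>[OF t(2) g(2)] eq by (simp add: pp)
    have "g k = g' k" for k
    proof (cases "k < n")
      case True
      then show ?thesis using z_pow[OF g(1), of k] z_pow[OF g(2), of k] zz by (simp add: funpow_rotation)
    next
      case False
      then show ?thesis using fix_perm[OF g(1)] fix_perm[OF g(2)] by (simp add: permutes_not_in)
    qed
    then have "g = g'" by auto
    moreover have "\<tau> = \<tau>'"
    proof (rule PiE_ext[OF t])
      fix l assume "l \<in> {..<L - 1}"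
      then show "\<tau> l = \<tau>' l" using fun_cong[OF eq, of l] by (simp add: \<Phi>_def pp split: if_splits)
    qed
    ultimately show "p = p'" by (simp add: pp)
  qed
  have sub: "\<Phi> ` ?D \<subseteq> cyclic_tuples n L"
  proof
    fix \<sigma> assume "\<sigma> \<in> \<Phi> ` ?D"
    then obtain \<tau> g where tg: "\<tau> \<in> {..<L - 1} \<rightarrow>\<^sub>E perms" "g \<in> fixing" and \<sigma>: "\<sigma> = \<Phi> (\<tau>, g)" by auto
    have "\<sigma> \<in> {..<L} \<rightarrow>\<^sub>E perms"
    proof (rule PiE_I)
      fix l assume l: "l \<in> {..<L}"
      show "\<sigma> l \<in> perms"
      proof (cases "l = L - 1")
        case True
        then have eq: "\<sigma> l = z g \<circ> inv (layers_comp L \<tau> 0 (L - 1))"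
          using l unfolding \<sigma> \<Phi>_def by simp
        have "z g \<circ> inv (layers_comp L \<tau> 0 (L - 1)) permutes {..<n}"
          by (rule permutes_compose[OF permutes_inv[OF comp_\<tau>[OF tg(1)]] z_perm[OF tg(2)]])
        then show ?thesis unfolding eq perms_def mem_Collect_eq .
      next
        case False
        then have eq: "\<sigma> l = \<tau> l" using l unfolding \<sigma> \<Phi>_def by simp
        have "l \<in> {..<L - 1}" using False l by auto
        then show ?thesis unfolding eq by (rule PiE_mem[OF tg(1)])
      qed
    next
      fix l assume "l \<notin> {..<L}"
      then show "\<sigma> l = undefined" unfolding \<sigma> \<Phi>_def by simp
    qed
    moreover have "(z g ^^ n) 0 = 0"
    proof -
      have "(rotation n ^^ Suc (n - 1)) 0 = 0"
        unfolding funpow.simps comp_apply using n by (simp add: funpow_rotation rotation_def)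
      then show ?thesis using z_pow[OF tg(2), of n] fix_perm[OF tg(2)] n by simp
    qed
    moreover have "\<exists>k<n. (z g ^^ k) 0 = j" if "j < n" for j
    proof -
      have "j \<in> g ` {..<n}" using that permutes_image[OF fix_perm(1)[OF tg(2)]] by simp
      then obtain k where "k < n" "g k = j" by auto
      then show ?thesis using z_pow[OF tg(2), of k] by (auto simp: funpow_rotation)
    qed
    moreover have "layers_comp L \<sigma> 0 L = z g" unfolding \<sigma> by (rule comp_\<Phi>[OF tg])
    ultimately show "\<sigma> \<in> cyclic_tuples n L"
      unfolding cyclic_tuples_def perms_def by simp
  qed
  have "finite (cyclic_tuples n L)"
    by (rule finite_subset[of _ "perm_tuples n L"])
       (auto simp: cyclic_tuples_def finite_permutations intro!: finite_PiE)
  then have "card ?D \<le> card (cyclic_tuples n L)" using inj sub by (intro card_inj_on_le) auto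
  moreover have "card perms = fact n" unfolding perms_def by (rule card_permutations) auto
  moreover have "card fixing = fact (n - 1)" unfolding fixing_def by (rule card_permutations) auto
  ultimately have "fact n ^ (L - 1) * fact (n - 1) \<le> card (cyclic_tuples n L)"
    by (simp add: card_cartesian_product card_PiE)
  then have "n * (fact n ^ (L - 1) * fact (n - 1)) \<le> n * card (cyclic_tuples n L)" by (rule mult_left_mono) simp
  moreover have "n * (fact n ^ (L - 1) * fact (n - 1)) = (fact n ^ L :: nat)"
    using n L fact_reduce[OF n, where 'a = nat] power_minus_mult[OF L, of "fact n :: nat"] by (simp add: mult_ac)
  ultimately show ?thesis by linarith
qed

lemma inj_on_step_arcs:
  assumes L: "0 < L"
  shows "inj_on (\<lambda>\<sigma>. step_arcs n L \<sigma> {..<L * n}) (perm_tuples n L)"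
proof (rule inj_onI)
  fix \<sigma> \<sigma>' assume s: "\<sigma> \<in> perm_tuples n L" "\<sigma>' \<in> perm_tuples n L"
    and eq: "step_arcs n L \<sigma> {..<L * n} = step_arcs n L \<sigma>' {..<L * n}"
  have "set_mset (step_arcs n L \<sigma> {..<L * n}) = set_mset (step_arcs n L \<sigma>' {..<L * n})" using eq by simp
  then have arcs: "(\<lambda>u. (u, layer_step n L \<sigma> u)) ` {..<L * n} = (\<lambda>u. (u, layer_step n L \<sigma>' u)) ` {..<L * n}"
    by (simp add: step_arcs_def)
  have step: "layer_step n L \<sigma> u = layer_step n L \<sigma>' u" if "u < L * n" for u
  proof -
    have "(u, layer_step n L \<sigma> u) \<in> (\<lambda>u. (u, layer_step n L \<sigma>' u)) ` {..<L * n}"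
      using that unfolding arcs[symmetric] by simp
    then show ?thesis by auto
  qed
  show "\<sigma> = \<sigma>'"
  proof (rule PiE_ext[OF s])
    fix l assume l: "l \<in> {..<L}"
    then have p: "\<sigma> l permutes {..<n}" "\<sigma>' l permutes {..<n}" using s by auto
    show "\<sigma> l = \<sigma>' l"
    proof
      fix i show "\<sigma> l i = \<sigma>' l i"
      proof (cases "i < n")
        case True
        then show ?thesis using step[OF layer_index_less[of i n l L]] l
          by (simp add: layer_step_def layer_div_mod)
      next
        case False
        then show ?thesis using p by (simp add: permutes_not_in)
      qed
    qed
  qed
qed

section \<open>Rectangles of Hamiltonian cycles\<close>

text \<open>Composing with the transposition of a point of \<open>S\<close> and a point outside
  changes the image of \<open>S\<close>; so it maps these permutations injectively to
  others.\<close>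

lemma card_perms_image_half:
  assumes S: "S \<subseteq> {..<n}" "S \<noteq> {}" "S \<noteq> {..<n}"
  shows "2 * card {p. p permutes {..<n} \<and> p ` S = E} \<le> fact n"
proof -
  define X where "X = {p. p permutes {..<n} \<and> p ` S = E}"
  obtain i j where i: "i \<in> S" and j: "j < n" "j \<notin> S" using S by blast
  define sw where "sw = transpose i j"
  define Y where "Y = (\<lambda>p. p \<circ> sw) ` X"
  have sw: "sw permutes {..<n}" using i j S unfolding sw_def by (intro permutes_swap_id) auto
  have "inj_on (\<lambda>p. p \<circ> sw) X"
  proof (rule inj_onI)
    fix p p' :: "nat \<Rightarrow> nat" assume "p \<circ> sw = p' \<circ> sw"
    then have "p \<circ> (sw \<circ> sw) = p' \<circ> (sw \<circ> sw)" by (simp flip: comp_assoc)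
    then show "p = p'" by (simp add: sw_def)
  qed
  then have card_Y: "card Y = card X" unfolding Y_def by (rule card_image)
  have disj: "X \<inter> Y = {}"
  proof (rule ccontr)
    assume "X \<inter> Y \<noteq> {}"
    then obtain p where "p \<in> X" "p \<circ> sw \<in> X" unfolding Y_def by blast
    then have p: "p permutes {..<n}" "p ` S = E" "(p \<circ> sw) ` S = E" unfolding X_def by blast+
    have "(p \<circ> sw) i = p j" by (simp add: sw_def)
    then have "p j \<in> p ` S" using p i by (metis imageI)
    then have "j \<in> S" using permutes_inj[OF p(1)] by (auto dest: injD)
    then show False using j by simp
  qed
  have sub: "X \<union> Y \<subseteq> {p. p permutes {..<n}}"
    using permutes_compose[OF sw] by (auto simp: X_def Y_def)
  have fin: "finite {p. p permutes {..<n}}" by (simp add: finite_permutations)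
  have "finite X" "finite Y" using finite_subset[OF _ fin] sub by blast+
  then have "card X + card Y = card (X \<union> Y)" using disj by (simp add: card_Un_disjoint)
  also have "\<dots> \<le> card {p. p permutes {..<n}}" by (rule card_mono[OF fin sub])
  also have "\<dots> = fact n" by (rule card_permutations) auto
  finally show ?thesis using card_Y by (simp add: X_def)
qed

text \<open>A part of the graph of a function is determined by its tails. Hence a Hamiltonian cycle
  splits in only one way once the tails on one side are known.\<close>

lemma mset_set_sub_graph:
  assumes "a + b = mset_set ((\<lambda>u. (u, g u)) ` V)" "finite V"
  shows "a = mset_set ((\<lambda>u. (u, g u)) ` set_mset (image_mset fst a))"
proof -
  have le: "count a x \<le> count (mset_set ((\<lambda>u. (u, g u)) ` V)) x" for x
    unfolding assms(1)[symmetric] by simp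
  have "count a x \<le> 1" for x using le[of x] by (auto simp: count_mset_set' split: if_splits)
  then have a: "a = mset_set (set_mset a)"
    by (intro multiset_eqI) (metis count_eq_zero_iff count_greater_eq_one_iff count_mset_set(1,3) finite_set_mset le_antisym)
  have "x \<in> (\<lambda>u. (u, g u)) ` V" if "x \<in># a" for x
  proof -
    have "x \<in># mset_set ((\<lambda>u. (u, g u)) ` V)" unfolding assms(1)[symmetric] using that by simp
    then show ?thesis using assms(2) by simp
  qed
  then have "set_mset a = (\<lambda>u. (u, g u)) ` fst ` set_mset a" by force
  then show ?thesis using a by simp
qed

locale rectangle =
  fixes n L :: nat and A B :: "(nat \<times> nat) multiset set"
  assumes n: "0 < n" and L: "0 < L"
    and rect: "\<And>a b. a \<in> A \<Longrightarrow> b \<in> B \<Longrightarrow> \<exists>us\<in>hamiltonian_cycles (layered_graph n L). a + b = cycle_arcs us"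
begin

definition "tuples = perm_tuples n L"

definition "covered = {\<sigma> \<in> tuples. \<exists>a\<in>A. \<exists>b\<in>B. a + b = step_arcs n L \<sigma> {..<L * n}}"

lemma tuples_perm: "\<sigma> \<in> tuples \<Longrightarrow> l < L \<Longrightarrow> \<sigma> l permutes {..<n}"
  by (auto simp: tuples_def)

lemma finite_tuples: "finite tuples"
  by (simp add: tuples_def finite_PiE finite_permutations)

lemma finite_covered: "finite covered"
  using finite_tuples by (simp add: covered_def)

lemma fst_snd_sum:
  assumes "a \<in> A" "b \<in> B"
  shows "image_mset fst a + image_mset fst b = mset_set {..<L * n}"
    and "image_mset snd a + image_mset snd b = mset_set {..<L * n}"
proof -
  obtain us where us: "us \<in> hamiltonian_cycles (layered_graph n L)" "a + b = cycle_arcs us"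
    using rect[OF assms] by auto
  have "image_mset fst (a + b) = mset_set {..<L * n}" "image_mset snd (a + b) = mset_set {..<L * n}"
    using hamiltonian_fst_snd[OF us(1) finite_verts_layered_graph] us(2) by (simp_all add: layered_graph_def)
  then show "image_mset fst a + image_mset fst b = mset_set {..<L * n}"
    and "image_mset snd a + image_mset snd b = mset_set {..<L * n}" by simp_all
qed

text \<open>
  In a rectangle the tails and the heads of the arcs contributed by each side are determined by
  the other side, hence constant.
\<close>

lemma constant_sides:
  assumes "A \<noteq> {}" "B \<noteq> {}"
  obtains D E where "D \<subseteq> {..<L * n}"
    "\<And>a. a \<in> A \<Longrightarrow> image_mset fst a = mset_set D \<and> image_mset snd a = mset_set E"
    "\<And>b. b \<in> B \<Longrightarrow> image_mset fst b = mset_set ({..<L * n} - D)"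
proof -
  let ?V = "{..<L * n}"
  obtain a0 b0 where ab: "a0 \<in> A" "b0 \<in> B" using assms by auto
  have part: "\<exists>X\<subseteq>?V. x = mset_set X \<and> y = mset_set (?V - X)" if "x + y = mset_set ?V" for x y :: "nat multiset"
  proof -
    have c: "count x v + count y v = (if v \<in> ?V then 1 else 0)" for v
      using arg_cong[OF that, of "\<lambda>m. count m v"] by (simp add: count_mset_set')
    have "x = mset_set (set_mset x)"
    proof (rule multiset_eqI)
      fix v show "count x v = count (mset_set (set_mset x)) v"
        using c[of v] by (cases "v \<in># x") (auto simp: count_mset_set' not_in_iff split: if_splits simp flip: count_greater_zero_iff)
    qed
    moreover have "y = mset_set (?V - set_mset x)"
    proof (rule multiset_eqI)
      fix v show "count y v = count (mset_set (?V - set_mset x)) v"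
        using c[of v] by (cases "v \<in># x") (auto simp: count_mset_set' not_in_iff split: if_splits simp flip: count_greater_zero_iff)
    qed
    moreover have "set_mset x \<subseteq> ?V"
    proof
      fix v assume "v \<in># x"
      then have "count x v \<noteq> 0" unfolding count_eq_zero_iff by simp
      then show "v \<in> ?V" using c[of v] by (metis add_is_0)
    qed
    ultimately show ?thesis by blast
  qed
  obtain D where D: "D \<subseteq> ?V" "image_mset fst a0 = mset_set D" "image_mset fst b0 = mset_set (?V - D)"
    using part[OF fst_snd_sum(1)[OF ab]] by auto
  obtain E where E: "image_mset snd a0 = mset_set E" "image_mset snd b0 = mset_set (?V - E)"
    using part[OF fst_snd_sum(2)[OF ab]] by auto
  show ?thesis
  proof (rule that[OF D(1)])
    fix a assume "a \<in> A"
    then show "image_mset fst a = mset_set D \<and> image_mset snd a = mset_set E"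
      using fst_snd_sum[OF \<open>a \<in> A\<close> ab(2)] fst_snd_sum[OF ab] D E by (metis add_right_cancel)
  next
    fix b assume "b \<in> B"
    then show "image_mset fst b = mset_set (?V - D)"
      using fst_snd_sum(1)[OF ab(1) \<open>b \<in> B\<close>] fst_snd_sum(1)[OF ab] D by (metis add_left_cancel)
  qed
qed

end

locale rectangle_sides = rectangle +
  fixes D E :: "nat set"
  assumes D: "D \<subseteq> {..<L * n}"
    and A_sides: "\<And>a. a \<in> A \<Longrightarrow> image_mset fst a = mset_set D \<and> image_mset snd a = mset_set E"
    and B_sides: "\<And>b. b \<in> B \<Longrightarrow> image_mset fst b = mset_set ({..<L * n} - D)"
begin

definition "layer_part l = {i \<in> {..<n}. l * n + i \<in> D}"

definition "mixed = {l \<in> {..<L}. layer_part l \<noteq> {} \<and> layer_part l \<noteq> {..<n}}"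

lemma finite_D: "finite D"
  using D finite_subset by blast

lemma covered_sides:
  assumes "\<sigma> \<in> covered"
  shows "step_arcs n L \<sigma> D \<in> A" "step_arcs n L \<sigma> ({..<L * n} - D) \<in> B"
proof -
  obtain a b where ab: "a \<in> A" "b \<in> B" "a + b = step_arcs n L \<sigma> {..<L * n}" using assms by (auto simp: covered_def)
  have "a = mset_set ((\<lambda>u. (u, layer_step n L \<sigma> u)) ` set_mset (image_mset fst a))"
    by (rule mset_set_sub_graph[of a b _ "{..<L * n}"]) (use ab in \<open>auto simp: step_arcs_def\<close>)
  then have "a = step_arcs n L \<sigma> D" using A_sides[OF ab(1)] finite_D by (simp add: step_arcs_def)
  then show "step_arcs n L \<sigma> D \<in> A" using ab by simp
  have "b = mset_set ((\<lambda>u. (u, layer_step n L \<sigma> u)) ` set_mset (image_mset fst b))"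
    by (rule mset_set_sub_graph[of b a _ "{..<L * n}"]) (use ab in \<open>auto simp: step_arcs_def add.commute\<close>)
  then have "b = step_arcs n L \<sigma> ({..<L * n} - D)" using B_sides[OF ab(2)] by (simp add: step_arcs_def)
  then show "step_arcs n L \<sigma> ({..<L * n} - D) \<in> B" using ab by simp
qed

text \<open>The right side does not mention \<open>\<sigma>\<close>: all covered tuples send the
  part to the same set. Finiteness of \<open>E\<close> is not among the hypotheses, and
  \<open>set_mset (mset_set E)\<close> stands for the set of heads, whether or not \<open>E\<close>
  is finite.\<close>

lemma covered_layer_part_image:
  assumes \<sigma>: "\<sigma> \<in> covered" and l: "l < L"
  shows "\<sigma> l ` layer_part l = {j \<in> {..<n}. (Suc l mod L) * n + j \<in> set_mset (mset_set E)}"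
proof -
  have perm: "\<sigma> l permutes {..<n}" if "l < L" for l
    using \<sigma> that tuples_perm by (auto simp: covered_def)
  have "image_mset snd (step_arcs n L \<sigma> D) = mset_set E" using A_sides covered_sides[OF \<sigma>] by blast
  then have "set_mset (image_mset snd (step_arcs n L \<sigma> D)) = set_mset (mset_set E)" by simp
  then have E: "set_mset (mset_set E) = layer_step n L \<sigma> ` D"
    using finite_D by (simp add: step_arcs_def image_image)
  show ?thesis unfolding E
  proof (intro equalityI subsetI)
    fix j assume "j \<in> \<sigma> l ` layer_part l"
    then obtain i where i: "i < n" "l * n + i \<in> D" "j = \<sigma> l i" by (auto simp: layer_part_def)
    then have "j < n" using permutes_in_image[OF perm[OF l]] by simp
    moreover have "layer_step n L \<sigma> (l * n + i) = (Suc l mod L) * n + j"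
      unfolding layer_step_def layer_div_mod[OF i(1)] i(3) ..
    ultimately show "j \<in> {j \<in> {..<n}. (Suc l mod L) * n + j \<in> layer_step n L \<sigma> ` D}"
      using i(2) by (metis (mono_tags, lifting) image_eqI lessThan_iff mem_Collect_eq)
  next
    fix j assume "j \<in> {j \<in> {..<n}. (Suc l mod L) * n + j \<in> layer_step n L \<sigma> ` D}"
    then obtain u where j: "j < n" and u: "u \<in> D" "(Suc l mod L) * n + j = layer_step n L \<sigma> u" by auto
    have uV: "u < L * n" using u(1) D by auto
    define l' i where "l' = u div n" and "i = u mod n"
    have l': "l' < L" and i: "i < n" and u_eq: "u = l' * n + i"
      using layer_div_less[OF uV] layer_mod_less[OF uV] by (auto simp: l'_def i_def)
    have less: "\<sigma> l' i < n" using permutes_in_image[OF perm[OF l']] i by simp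
    have eq: "(Suc l mod L) * n + j = (Suc l' mod L) * n + \<sigma> l' i"
      using u(2) by (simp add: layer_step_def l'_def i_def)
    have "Suc l mod L = Suc l' mod L" "j = \<sigma> l' i"
      using arg_cong[OF eq, of "\<lambda>x. x div n"] arg_cong[OF eq, of "\<lambda>x. x mod n"] layer_div_mod[OF j] layer_div_mod[OF less]
      by metis+
    moreover have "l = l'"
      using \<open>Suc l mod L = Suc l' mod L\<close> l l' by (cases "Suc l = L"; cases "Suc l' = L") auto
    ultimately show "j \<in> \<sigma> l ` layer_part l" using u(1) i by (auto simp: layer_part_def u_eq)
  qed
qed

text \<open>In a mixed layer the image of a proper nonempty part is prescribed, which at least
  halves the choices.\<close>

lemma card_covered_mixed: "2 ^ card mixed * card covered \<le> fact n ^ L"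
proof -
  define E' where "E' l = {j \<in> {..<n}. (Suc l mod L) * n + j \<in> set_mset (mset_set E)}" for l
  define R where "R l = (if l \<in> mixed then {p. p permutes {..<n} \<and> p ` layer_part l = E' l} else {p. p permutes {..<n}})" for l
  have finR: "finite (R l)" for l
    by (rule finite_subset[of _ "{p. p permutes {..<n}}"]) (auto simp: R_def finite_permutations)
  have "covered \<subseteq> PiE {..<L} R"
  proof
    fix \<sigma> assume \<sigma>: "\<sigma> \<in> covered"
    then have t: "\<sigma> \<in> tuples" by (simp add: covered_def)
    show "\<sigma> \<in> PiE {..<L} R"
    proof (rule PiE_I)
      fix l assume "l \<in> {..<L}"
      then show "\<sigma> l \<in> R l" using tuples_perm[OF t] covered_layer_part_image[OF \<sigma>] by (auto simp: R_def E'_def)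
    next
      fix l assume "l \<notin> {..<L}"
      then show "\<sigma> l = undefined" using t by (auto simp: tuples_def PiE_iff extensional_def)
    qed
  qed
  then have "card covered \<le> (\<Prod>l<L. card (R l))"
    using card_mono[of "PiE {..<L} R" covered] finR by (simp add: finite_PiE card_PiE)
  then have "2 ^ card mixed * card covered \<le> 2 ^ card mixed * (\<Prod>l<L. card (R l))" by simp
  also have "\<dots> = (\<Prod>l<L. (if l \<in> mixed then 2 else 1) * card (R l))"
  proof -
    have "(\<Prod>l<L. if l \<in> mixed then 2 else (1::nat)) = 2 ^ card mixed"
      by (simp add: prod.If_cases mixed_def Int_def)
    then show ?thesis by (simp add: prod.distrib)
  qed
  also have "\<dots> \<le> (\<Prod>l<L. fact n)"
  proof (rule prod_mono, intro conjI)
    fix l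
    show "(if l \<in> mixed then 2 else 1) * card (R l) \<le> fact n"
    proof (cases "l \<in> mixed")
      case True
      then show ?thesis using card_perms_image_half[of "layer_part l" n "E' l"]
        by (auto simp: R_def mixed_def layer_part_def)
    next
      case False
      then show ?thesis using card_permutations[of "{..<n}" n] by (simp add: R_def)
    qed
  qed simp
  finally show ?thesis by simp
qed

text \<open>Fix the permutations of all other layers. Membership in \<open>A\<close> constrains only
  the permutation \<open>p\<close> of layer \<open>l1\<close>, and membership in \<open>B\<close>
  only the permutation \<open>p'\<close> of layer \<open>l2\<close>; any admissible two combine to a
  Hamiltonian cycle. Up to fixed factors around \<open>p'\<close>, the return map of
  \<open>l1\<close> is their composition, so \<open>bound\<close> applies for each choice of the
  rest.\<close>

lemma card_covered_pure:
  assumes bound: "\<And>P R. no_return_rectangle {..<n} P R \<Longrightarrow> real (card P) * real (card R) * x \<le> fact n ^ 2"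
    and x: "0 < x"
    and l1: "l1 < L" "layer_part l1 = {..<n}" and l2: "l2 < L" "layer_part l2 = {}"
  shows "real (card covered) * x \<le> fact n ^ L"
proof -
  define perms where "perms = {p. p permutes {..<n}}"
  define rest where "rest = ({..<L} - {l1, l2}) \<rightarrow>\<^sub>E perms"
  \<comment> \<open>\<open>id\<close> is a placeholder: arcs leaving \<open>D\<close> do not start
    in layer \<open>l2\<close>, and the remaining arcs do not start in layer
    \<open>l1\<close>.\<close>
  define P where "P \<tau> = {p \<in> perms. step_arcs n L (\<tau>(l1 := p, l2 := id)) D \<in> A}" for \<tau>
  define P' where "P' \<tau> = {p \<in> perms. step_arcs n L (\<tau>(l1 := id, l2 := p)) ({..<L * n} - D) \<in> B}" for \<tau>
  have ne: "l1 \<noteq> l2" using l1 l2 n by (auto simp: lessThan_empty_iff)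
  have fin_perms: "finite perms" by (simp add: perms_def finite_permutations)
  have fin_rest: "finite rest" using fin_perms by (simp add: rest_def finite_PiE)
  have arcs_cong: "step_arcs n L \<sigma> X = step_arcs n L \<sigma>' X" if "\<And>u. u \<in> X \<Longrightarrow> \<sigma> (u div n) = \<sigma>' (u div n)" for \<sigma> \<sigma>' X
    unfolding step_arcs_def layer_step_def using that by (metis (no_types, lifting) image_cong)
  have D_l2: "u div n \<noteq> l2" if "u \<in> D" for u
  proof
    assume "u div n = l2"
    then have "u mod n \<in> layer_part l2" using that n by (simp add: layer_part_def flip: \<open>u div n = l2\<close>)
    then show False using l2 by simp
  qed
  have D_l1: "u div n \<noteq> l1" if "u \<in> {..<L * n} - D" for u
  proof
    assume "u div n = l1"
    then have "u mod n \<in> layer_part l1" using l1 n by simp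
    then have "u \<in> D" by (simp add: layer_part_def flip: \<open>u div n = l1\<close>)
    then show False using that by simp
  qed
  have PD: "step_arcs n L (\<tau>(l1 := p, l2 := p')) D = step_arcs n L (\<tau>(l1 := p, l2 := id)) D" for \<tau> p p'
    by (rule arcs_cong) (use D_l2 in auto)
  have PD': "step_arcs n L (\<tau>(l1 := p, l2 := p')) ({..<L * n} - D) = step_arcs n L (\<tau>(l1 := id, l2 := p')) ({..<L * n} - D)" for \<tau> p p'
    by (rule arcs_cong) (use D_l1 in auto)
  have rect_bound: "real (card (P \<tau>)) * real (card (P' \<tau>)) * x \<le> fact n ^ 2" if \<tau>: "\<tau> \<in> rest" for \<tau>
  proof -
    \<comment> \<open>The cyclic distance from \<open>l1\<close> to \<open>l2\<close>. Below,
      \<open>W1\<close> composes the layers strictly between \<open>l1\<close> and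
      \<open>l2\<close>, and \<open>W2\<close> those strictly between \<open>l2\<close> and the
      return to \<open>l1\<close>.\<close>
    define d where "d = (l2 + L - l1) mod L"
    have d: "0 < d" "d < L" "(l1 + d) mod L = l2"
      using l1(1) l2(1) ne by (auto simp: d_def mod_if split: if_splits)
    define \<tau>0 where "\<tau>0 = \<tau>(l1 := id, l2 := id)"
    define W1 where "W1 = layers_comp L \<tau>0 (l1 + 1) (d - 1)"
    define W2 where "W2 = layers_comp L \<tau>0 (l1 + (d + 1)) (L - d - 1)"
    have \<tau>0_perm: "\<tau>0 l permutes {..<n}" if "l < L" for l
      using \<tau> that by (auto simp: \<tau>0_def rest_def perms_def permutes_id)
    have W: "W1 permutes {..<n}" "W2 permutes {..<n}"
      unfolding W1_def W2_def by (intro layers_comp_permutes \<tau>0_perm L; assumption)+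
    have not_l1: "(l1 + t) mod L \<noteq> l1" if "0 < t" "t < L" for t
      using that l1(1) by (auto simp: mod_if split: if_splits)
    have not_l2: "(l1 + t) mod L \<noteq> l2" if "t < L" "t \<noteq> d" for t
      using that l1(1) d by (auto simp: mod_if split: if_splits)
    have comp: "layers_comp L (\<tau>(l1 := p, l2 := p')) l1 L = W2 \<circ> p' \<circ> W1 \<circ> p" for p p'
    proof -
      let ?s = "\<tau>(l1 := p, l2 := p')"
      have "layers_comp L ?s l1 L = layers_comp L ?s l1 (1 + (d - 1) + 1 + (L - d - 1))" using d by simp
      also have "\<dots> = layers_comp L ?s (l1 + (1 + (d - 1) + 1)) (L - d - 1) \<circ>
          (layers_comp L ?s (l1 + (1 + (d - 1))) 1 \<circ> (layers_comp L ?s (l1 + 1) (d - 1) \<circ> layers_comp L ?s l1 1))"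
        by (simp only: layers_comp_add)
      also have "layers_comp L ?s (l1 + (1 + (d - 1) + 1)) (L - d - 1) = W2"
      proof -
        have "layers_comp L ?s (l1 + (d + 1)) (L - d - 1) = W2"
          unfolding W2_def
        proof (rule layers_comp_cong)
          fix t assume "t < L - d - 1"
          then show "?s ((l1 + (d + 1) + t) mod L) = \<tau>0 ((l1 + (d + 1) + t) mod L)"
            using not_l1[of "d + 1 + t"] not_l2[of "d + 1 + t"] by (simp add: \<tau>0_def add.assoc)
        qed
        then show ?thesis using d by simp
      qed
      also have "layers_comp L ?s (l1 + 1) (d - 1) = W1"
        unfolding W1_def
      proof (rule layers_comp_cong)
        fix t assume "t < d - 1"
        then show "?s ((l1 + 1 + t) mod L) = \<tau>0 ((l1 + 1 + t) mod L)"
          using not_l1[of "1 + t"] not_l2[of "1 + t"] d by (simp add: \<tau>0_def add.assoc)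
      qed
      also have "layers_comp L ?s (l1 + (1 + (d - 1))) 1 = p'" using d by simp
      also have "layers_comp L ?s l1 1 = p" using l1 ne by simp
      finally show ?thesis by (simp only: comp_assoc)
    qed
    \<comment> \<open>The fixed permutations are moved into the second side, which keeps its
      cardinality since they are invertible.\<close>
    define R where "R = (\<lambda>p'. W2 \<circ> p' \<circ> W1) ` P' \<tau>"
    have card_R: "card R = card (P' \<tau>)"
      unfolding R_def
    proof (rule card_image, rule inj_onI)
      fix p q assume "W2 \<circ> p \<circ> W1 = W2 \<circ> q \<circ> W1"
      then have "inv W2 \<circ> (W2 \<circ> p \<circ> W1) \<circ> inv W1 = inv W2 \<circ> (W2 \<circ> q \<circ> W1) \<circ> inv W1" by simp
      then have "(inv W2 \<circ> W2) \<circ> p \<circ> (W1 \<circ> inv W1) = (inv W2 \<circ> W2) \<circ> q \<circ> (W1 \<circ> inv W1)"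
        by (simp only: comp_assoc)
      then show "p = q" using permutes_inv_o[OF W(1)] permutes_inv_o[OF W(2)] by simp
    qed
    have "real (card (P \<tau>)) * real (card R) * x \<le> fact n ^ 2"
    proof (rule bound, unfold no_return_rectangle_def, intro conjI)
      show "\<forall>\<pi>\<in>P \<tau>. \<pi> permutes {..<n}" by (simp add: P_def perms_def)
      show "\<forall>\<rho>\<in>R. \<rho> permutes {..<n}"
        using W by (auto simp: R_def P'_def perms_def intro!: permutes_compose)
      show "\<forall>\<pi>\<in>P \<tau>. \<forall>\<rho>\<in>R. \<forall>i\<in>{..<n}. \<forall>s. 0 < s \<and> s < card {..<n} \<longrightarrow> ((\<rho> \<circ> \<pi>) ^^ s) i \<noteq> i"
      proof (intro ballI allI impI)
        fix p \<rho> i s assume p: "p \<in> P \<tau>" and "\<rho> \<in> R" and "i \<in> {..<n}" "0 < s \<and> s < card {..<n}"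
        then have i: "i < n" and s: "0 < s \<and> s < n" by auto
        from \<open>\<rho> \<in> R\<close> obtain p' where p': "p' \<in> P' \<tau>" "\<rho> = W2 \<circ> p' \<circ> W1" by (auto simp: R_def)
        let ?s = "\<tau>(l1 := p, l2 := p')"
        have perm: "?s l permutes {..<n}" if "l < L" for l
          using \<tau> that p p' by (auto simp: P_def P'_def rest_def perms_def)
        have "step_arcs n L ?s D \<in> A" using p unfolding PD[of \<tau> p p'] by (simp add: P_def)
        moreover have "step_arcs n L ?s ({..<L * n} - D) \<in> B" using p' unfolding PD'[of \<tau> p p'] by (simp add: P'_def)
        ultimately obtain us where us: "us \<in> hamiltonian_cycles (layered_graph n L)"
          "step_arcs n L ?s D + step_arcs n L ?s ({..<L * n} - D) = cycle_arcs us" using rect by blast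
        have "step_arcs n L ?s D + step_arcs n L ?s ({..<L * n} - D) = step_arcs n L ?s {..<L * n}"
        proof -
          let ?f = "\<lambda>u. (u, layer_step n L ?s u)"
          have "?f ` {..<L * n} = ?f ` D \<union> ?f ` ({..<L * n} - D)" using D by blast
          moreover have "?f ` D \<inter> ?f ` ({..<L * n} - D) = {}" by auto
          ultimately show ?thesis unfolding step_arcs_def using finite_D by (simp add: mset_set_Union)
        qed
        then have "cycle_arcs us = step_arcs n L ?s {..<L * n}" using us(2) by simp
        from step_arcs_no_return[OF perm us(1) this l1(1) i] s
        have "(layers_comp L ?s l1 L ^^ s) i \<noteq> i" by blast
        then show "((\<rho> \<circ> p) ^^ s) i \<noteq> i" unfolding comp p'(2) .
      qed
    qed
    then show ?thesis by (simp add: card_R)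
  qed
  define h where "h \<sigma> = (restrict \<sigma> ({..<L} - {l1, l2}), (\<sigma> l1, \<sigma> l2))" for \<sigma> :: "nat \<Rightarrow> nat \<Rightarrow> nat"
  have inj: "inj_on h covered"
  proof (rule inj_onI)
    fix \<sigma> \<sigma>' assume s: "\<sigma> \<in> covered" "\<sigma>' \<in> covered" and eq: "h \<sigma> = h \<sigma>'"
    then have t: "\<sigma> \<in> perm_tuples n L" "\<sigma>' \<in> perm_tuples n L"
      by (auto simp: covered_def tuples_def)
    show "\<sigma> = \<sigma>'"
    proof (rule PiE_ext[OF t])
      fix l assume l: "l \<in> {..<L}"
      show "\<sigma> l = \<sigma>' l"
      proof (cases "l = l1 \<or> l = l2")
        case True
        then show ?thesis using eq by (auto simp: h_def)
      next
        case False
        have "restrict \<sigma> ({..<L} - {l1, l2}) l = restrict \<sigma>' ({..<L} - {l1, l2}) l" using eq by (simp add: h_def)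
        then show ?thesis using False l by simp
      qed
    qed
  qed
  have sub: "h ` covered \<subseteq> (SIGMA \<tau> : rest. P \<tau> \<times> P' \<tau>)"
  proof
    fix y assume "y \<in> h ` covered"
    then obtain \<sigma> where \<sigma>: "\<sigma> \<in> covered" and y: "y = h \<sigma>" by auto
    define \<tau> where "\<tau> = restrict \<sigma> ({..<L} - {l1, l2})"
    have perm: "\<sigma> l permutes {..<n}" if "l < L" for l using \<sigma> that tuples_perm by (auto simp: covered_def)
    have same: "(\<tau>(l1 := \<sigma> l1, l2 := \<sigma> l2)) (u div n) = \<sigma> (u div n)" if "u \<in> {..<L * n}" for u
      using layer_div_less[of u L n] that by (auto simp: \<tau>_def)
    have "step_arcs n L (\<tau>(l1 := \<sigma> l1, l2 := \<sigma> l2)) D = step_arcs n L \<sigma> D"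
      by (rule arcs_cong) (rule same, use D in auto)
    then have "\<sigma> l1 \<in> P \<tau>"
      using covered_sides(1)[OF \<sigma>] perm[OF l1(1)] unfolding PD[of \<tau> "\<sigma> l1" "\<sigma> l2"] by (simp add: P_def perms_def)
    moreover have "step_arcs n L (\<tau>(l1 := \<sigma> l1, l2 := \<sigma> l2)) ({..<L * n} - D) = step_arcs n L \<sigma> ({..<L * n} - D)"
      by (rule arcs_cong) (rule same, auto)
    then have "\<sigma> l2 \<in> P' \<tau>"
      using covered_sides(2)[OF \<sigma>] perm[OF l2(1)] unfolding PD'[of \<tau> "\<sigma> l1" "\<sigma> l2"] by (simp add: P'_def perms_def)
    moreover have "\<tau> \<in> rest" using perm by (auto simp: \<tau>_def rest_def perms_def)
    ultimately show "y \<in> (SIGMA \<tau> : rest. P \<tau> \<times> P' \<tau>)" by (simp add: y h_def flip: \<tau>_def)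
  qed
  have finP: "finite (P \<tau>)" "finite (P' \<tau>)" for \<tau> using fin_perms by (auto simp: P_def P'_def)
  have "card covered \<le> card (SIGMA \<tau> : rest. P \<tau> \<times> P' \<tau>)"
    by (rule card_inj_on_le[OF inj sub]) (use fin_rest finP in auto)
  also have "\<dots> = (\<Sum>\<tau>\<in>rest. card (P \<tau>) * card (P' \<tau>))"
    using fin_rest finP by (simp add: card_cartesian_product)
  finally have "real (card covered) \<le> real (\<Sum>\<tau>\<in>rest. card (P \<tau>) * card (P' \<tau>))" by (rule of_nat_mono)
  then have "real (card covered) * x \<le> (\<Sum>\<tau>\<in>rest. real (card (P \<tau>)) * real (card (P' \<tau>))) * x"
    using x by (intro mult_right_mono) auto
  also have "\<dots> = (\<Sum>\<tau>\<in>rest. real (card (P \<tau>)) * real (card (P' \<tau>)) * x)" by (rule sum_distrib_right)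
  also have "\<dots> \<le> (\<Sum>\<tau>\<in>rest. fact n ^ 2)" by (intro sum_mono rect_bound)
  also have "\<dots> = real (card rest) * fact n ^ 2" by simp
  also have "real (card rest) = fact n ^ (L - 2)"
  proof -
    have "card ({..<L} - {l1, l2}) = L - 2" using l1 l2 ne by (subst card_Diff_subset) auto
    moreover have "card perms = fact n" unfolding perms_def by (rule card_permutations) auto
    ultimately show ?thesis by (simp add: rest_def card_PiE)
  qed
  also have "fact n ^ (L - 2) * fact n ^ 2 = (fact n ^ L :: real)"
  proof -
    have "L = L - 2 + 2" using l1(1) l2(1) ne by linarith
    then show ?thesis by (metis power_add)
  qed
  finally show ?thesis .
qed

lemma card_D: "card D = (\<Sum>l<L. card (layer_part l))"
proof -
  have "D = (\<Union>l\<in>{..<L}. (\<lambda>i. l * n + i) ` layer_part l)"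
  proof (intro equalityI subsetI)
    fix u assume u: "u \<in> D"
    then have uV: "u < L * n" using D by auto
    have "u = (u div n) * n + u mod n" by simp
    moreover have "u mod n \<in> layer_part (u div n)" using u layer_mod_less[OF uV] by (simp add: layer_part_def)
    ultimately show "u \<in> (\<Union>l\<in>{..<L}. (\<lambda>i. l * n + i) ` layer_part l)"
      using layer_div_less[OF uV] by blast
  qed (auto simp: layer_part_def)
  then have "card D = card (\<Union>l\<in>{..<L}. (\<lambda>i. l * n + i) ` layer_part l)" by simp
  also have "\<dots> = (\<Sum>l<L. card ((\<lambda>i. l * n + i) ` layer_part l))"
  proof (rule card_UN_disjoint)
    show "\<forall>l\<in>{..<L}. finite ((\<lambda>i. l * n + i) ` layer_part l)" by (simp add: layer_part_def)
    show "\<forall>l\<in>{..<L}. \<forall>l'\<in>{..<L}. l \<noteq> l' \<longrightarrow> (\<lambda>i. l * n + i) ` layer_part l \<inter> (\<lambda>i. l' * n + i) ` layer_part l' = {}"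
    proof (intro ballI impI, rule ccontr)
      fix l l' assume "l \<noteq> l'" and "(\<lambda>i. l * n + i) ` layer_part l \<inter> (\<lambda>i. l' * n + i) ` layer_part l' \<noteq> {}"
      then obtain i i' where "i < n" "i' < n" "l * n + i = l' * n + i'" by (auto simp: layer_part_def)
      then show False using \<open>l \<noteq> l'\<close> layer_div_mod(1) by metis
    qed
  qed simp
  also have "\<dots> = (\<Sum>l<L. card (layer_part l))" by (simp add: card_image)
  finally show ?thesis .
qed

text \<open>As \<open>D\<close> contains between one and two thirds of the vertices, at most two
  thirds of the layers are full and at most two thirds are empty. With fewer than one third mixed,
  both kinds must occur.\<close>

lemma exists_pure_layers:
  assumes bal: "L * n \<le> 3 * card D" "3 * card D \<le> 2 * (L * n)" and mixed: "3 * card mixed < L"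
  obtains l1 l2 where "l1 < L" "layer_part l1 = {..<n}" "l2 < L" "layer_part l2 = {}"
proof -
  define full where "full = {l \<in> {..<L}. layer_part l = {..<n}}"
  define none where "none = {l \<in> {..<L}. layer_part l = {}}"
  have part: "{..<L} = full \<union> none \<union> mixed" by (auto simp: full_def none_def mixed_def)
  have "card {..<L} \<le> card full + card none + card mixed"
    unfolding part by (intro order_trans[OF card_Un_le] add_right_mono card_Un_le)
  then have total: "L \<le> card full + card none + card mixed" by simp
  have sec_le: "card (layer_part l) \<le> n" for l using card_mono[of "{..<n}" "layer_part l"] by (auto simp: layer_part_def)
  have "card full * n = (\<Sum>l\<in>full. card (layer_part l))" by (simp add: full_def)
  also have "\<dots> \<le> card D" unfolding card_D by (rule sum_mono2) (auto simp: full_def)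
  finally have "3 * (card full * n) \<le> 2 * (L * n)" using bal by linarith
  then have "(3 * card full) * n \<le> (2 * L) * n" by (simp add: mult_ac)
  then have full_le: "3 * card full \<le> 2 * L" using n by simp
  have "card D + card none * n = (\<Sum>l\<in>{..<L} - none. card (layer_part l)) + card none * n"
    unfolding card_D by (simp add: none_def, intro sum.mono_neutral_right) auto
  also have "\<dots> \<le> (\<Sum>l\<in>{..<L} - none. n) + card none * n" by (intro add_right_mono sum_mono sec_le)
  also have "\<dots> = (card ({..<L} - none) + card none) * n" by (simp add: add_mult_distrib)
  also have "card ({..<L} - none) + card none = L"
  proof -
    have "none \<subseteq> {..<L}" by (auto simp: none_def)
    then show ?thesis using card_mono[of "{..<L}" none] by (simp add: card_Diff_subset finite_subset)
  qed
  finally have "3 * (card none * n) \<le> 2 * (L * n)" using bal by linarith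
  then have "(3 * card none) * n \<le> (2 * L) * n" by (simp add: mult_ac)
  then have none_le: "3 * card none \<le> 2 * L" using n by simp
  have "card full \<noteq> 0" "card none \<noteq> 0" using total full_le none_le mixed by linarith+
  then obtain l1 l2 where "l1 \<in> full" "l2 \<in> none" by (metis card.empty equals0I)
  then show ?thesis using that by (auto simp: full_def none_def)
qed

end

section \<open>The lower bound\<close>

text \<open>No rectangle covers more than the fraction \<open>1 / x\<close> of the
  \<open>fact n ^ L\<close> tuples, while at least the fraction \<open>1 / n\<close> of them gives
  Hamiltonian cycles.\<close>

lemma layered_circuit_size:
  fixes C :: "('n, nat \<times> nat) circuit"
  assumes n: "0 < n" and x: "0 < x" "x \<le> 2 ^ (n ^ 2)"
    and bound: "\<And>P R. no_return_rectangle {..<n} P R \<Longrightarrow> real (card P) * real (card R) * x \<le> fact n ^ 2"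
    and C: "tropical_circuit X C" "calculates C (DTSP (layered_graph n (3 * n ^ 2)))"
  shows "x \<le> real n * real (circuit_size C)"
proof -
  define L where "L = 3 * n ^ 2"
  define G where "G = layered_graph n L"
  define arcs where "arcs \<sigma> = step_arcs n L \<sigma> {..<L * n}" for \<sigma>
  define H where "H = arcs ` cyclic_tuples n L"
  have L: "0 < L" using n by (simp add: L_def)
  have N2: "2 \<le> L * n"
  proof -
    have "1 \<le> n ^ 3" using n by simp
    then have "2 \<le> 3 * n ^ 3" by linarith
    then show ?thesis by (simp add: L_def power2_eq_square power3_eq_cube)
  qed
  have sub: "cyclic_tuples n L \<subseteq> perm_tuples n L" by (auto simp: cyclic_tuples_def)
  have fin: "finite (cyclic_tuples n L)"
    by (rule finite_subset[OF sub]) (simp add: finite_PiE finite_permutations)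
  have card_H: "card H = card (cyclic_tuples n L)"
    unfolding H_def arcs_def by (intro card_image inj_on_subset[OF inj_on_step_arcs[OF L] sub])
  have many: "fact n ^ L \<le> n * card H" using card_cyclic_tuples[OF n L] by (simp add: card_H)
  have ham: "\<exists>us\<in>hamiltonian_cycles G. arcs \<sigma> = cycle_arcs us" if "\<sigma> \<in> cyclic_tuples n L" for \<sigma>
    using cyclic_tuple_hamiltonian[OF that n L] unfolding G_def arcs_def by metis
  have "H \<noteq> {}"
  proof
    assume "H = {}"
    then have "fact n ^ L \<le> (0 :: nat)" using many by simp
    then show False by simp
  qed
  then have ham_ne: "hamiltonian_cycles G \<noteq> {}" using ham by (auto simp: H_def)
  have produced: "produces C (out_node C) m \<longleftrightarrow> (\<exists>us\<in>hamiltonian_cycles G. m = cycle_arcs us)" for m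
    by (rule DTSP_circuit_produces) (use C ham_ne in \<open>auto simp: G_def L_def finite_verts_layered_graph\<close>)
  have rect_bound: "real (card (H \<inter> balanced_products C (L * n) q)) \<le> fact n ^ L / x" for q
  proof -
    define A where "A = {a. produces C q a \<and> L * n \<le> 3 * size a \<and> 3 * size a \<le> 2 * (L * n)}"
    define B where "B = {c. completes C q c}"
    interpret rectangle n L A B
    proof
      fix a b assume "a \<in> A" "b \<in> B"
      then have "produces C (out_node C) (a + b)" by (auto simp: A_def B_def intro: produces_completes)
      then show "\<exists>us\<in>hamiltonian_cycles (layered_graph n L). a + b = cycle_arcs us"
        using produced by (simp add: G_def)
    qed (use n L in auto)
    have "H \<inter> balanced_products C (L * n) q \<subseteq> arcs ` covered"
    proof
      fix m assume "m \<in> H \<inter> balanced_products C (L * n) q"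
      then obtain \<sigma> a c where \<sigma>: "\<sigma> \<in> cyclic_tuples n L" "m = arcs \<sigma>" and "a \<in> A" "c \<in> B" "a + c = m"
        by (auto simp: H_def A_def B_def balanced_products_def)
      then have "\<sigma> \<in> covered" using sub unfolding covered_def tuples_def arcs_def by blast
      then show "m \<in> arcs ` covered" using \<sigma>(2) by simp
    qed
    then have "card (H \<inter> balanced_products C (L * n) q) \<le> card covered"
      using card_mono[OF finite_imageI[OF finite_covered]] card_image_le[OF finite_covered] order_trans by blast
    moreover have "real (card covered) * x \<le> fact n ^ L"
    proof (cases "covered = {}")
      case False
      then have "A \<noteq> {}" "B \<noteq> {}" by (auto simp: covered_def)
      then obtain D E where DE: "D \<subseteq> {..<L * n}"
        "\<And>a. a \<in> A \<Longrightarrow> image_mset fst a = mset_set D \<and> image_mset snd a = mset_set E"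
        "\<And>b. b \<in> B \<Longrightarrow> image_mset fst b = mset_set ({..<L * n} - D)"
        by (rule constant_sides) (rule that)
      interpret rectangle_sides n L A B D E by unfold_locales (use DE in auto)
      obtain a where a: "a \<in> A" using \<open>A \<noteq> {}\<close> by auto
      have "size a = size (image_mset fst a)" by simp
      also have "\<dots> = card D" using A_sides[OF a] by simp
      finally have bal: "L * n \<le> 3 * card D" "3 * card D \<le> 2 * (L * n)" using a by (auto simp: A_def)
      show ?thesis
      proof (cases "3 * card mixed < L")
        case True
        from bal True obtain l1 l2 where "l1 < L" "layer_part l1 = {..<n}" "l2 < L" "layer_part l2 = {}"
          by (rule exists_pure_layers)
        then show ?thesis by (intro card_covered_pure[OF bound x(1)])
      next
        case False
        \<comment> \<open>This case dictates the number of layers: a third of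
          \<open>3 * n ^ 2\<close> mixed layers gains \<open>2 ^ (n ^ 2)\<close>, which is at least
          \<open>x\<close>.\<close>
        then have "n ^ 2 \<le> card mixed" by (simp add: L_def)
        then have "x \<le> 2 ^ card mixed" using x(2) power_increasing[of "n ^ 2" "card mixed" "2 :: real"] by linarith
        then have "real (card covered) * x \<le> real (card covered) * 2 ^ card mixed" by (intro mult_left_mono) auto
        also have "\<dots> = real (2 ^ card mixed * card covered)" by simp
        also have "\<dots> \<le> real (fact n ^ L)" using card_covered_mixed by (rule of_nat_mono)
        finally show ?thesis by simp
      qed
    qed simp
    ultimately have "real (card (H \<inter> balanced_products C (L * n) q)) * x \<le> fact n ^ L"
      using x(1) by (meson mult_right_mono of_nat_mono order_trans less_imp_le)
    then show ?thesis using x(1) by (simp add: pos_le_divide_eq)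
  qed
  have "real (card H) \<le> real (circuit_size C) * (fact n ^ L / x)"
  proof (rule card_produced_le[OF C(1) N2])
    show "finite H" using fin by (simp add: H_def)
    fix m assume "m \<in> H"
    then obtain us where us: "us \<in> hamiltonian_cycles G" "m = cycle_arcs us" using ham by (auto simp: H_def)
    then show "produces C (out_node C) m \<and> size m = L * n"
      using produced size_cycle_arcs[OF us(1)] by (auto simp: G_def card_verts_layered_graph)
  qed (rule rect_bound)
  then have "real (card H) * x \<le> real (circuit_size C) * fact n ^ L"
    using x(1) by (simp add: field_simps)
  then have "real n * (real (card H) * x) \<le> real n * (real (circuit_size C) * fact n ^ L)"
    by (rule mult_left_mono) simp
  then have "real n * real (card H) * x \<le> real n * real (circuit_size C) * fact n ^ L"
    by (simp only: mult.assoc)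
  moreover have "fact n ^ L \<le> real n * real (card H)"
    using of_nat_mono[OF many, where 'a = real] by simp
  then have "fact n ^ L * x \<le> real n * real (card H) * x" using x(1) by (intro mult_right_mono) auto
  ultimately have "fact n ^ L * x \<le> real n * real (circuit_size C) * fact n ^ L" by linarith
  then have "x * fact n ^ L \<le> real n * real (circuit_size C) * fact n ^ L"
    by (simp only: mult.commute[of _ x])
  then show ?thesis by simp
qed

lemma hamiltonian_layered_graph:
  assumes "0 < n" "0 < L"
  shows "hamiltonian_cycles (layered_graph n L) \<noteq> {}"
proof -
  have "cyclic_tuples n L \<noteq> {}" using card_cyclic_tuples[OF assms] by (auto simp: not_le)
  then show ?thesis using cyclic_tuple_hamiltonian[OF _ assms] by blast
qed

lemma pathwidth_loop: "pathwidth (layered_graph 1 1) = 0"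
proof -
  have "path_decomposition (layered_graph 1 1) [{0}]"
    by (auto simp: path_decomposition_def layered_graph_def)
  moreover have "decomposition_width [{0 :: nat}] = 0" by (simp add: decomposition_width_def)
  ultimately have "pathwidth (layered_graph 1 1) \<le> 0"
    unfolding pathwidth_def by (intro Least_le) auto
  then show ?thesis by simp
qed

text \<open>Nonempty \<open>hamiltonian_cycles G\<close> ensures that \<open>DTSP G\<close> is a
  genuine maximum. The layered graph has 3 n^3 vertices with 3 n at most \<open>k\<close>, hence
  exponent 3. For the finitely many \<open>k\<close> below the threshold a single vertex with a loop
  serves, and the bound there is \<open>2 powr 0\<close>, at most the size of any circuit.\<close>

theorem theorem1p2:
  shows "\<exists>(c::real) > 0. \<exists>f :: nat \<Rightarrow> real.
           (\<forall>k. f k \<ge> 0) \<and> f \<in> \<Omega>(\<lambda>k. real k * log 2 (log 2 (real k))) \<and>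
           (\<forall>k\<ge>1. \<exists>G :: nat pair_pre_digraph.
              pair_fin_digraph G \<and>
              hamiltonian_cycles G \<noteq> {} \<and>
              pathwidth G \<le> k \<and>
              real (card (pverts G)) \<le> real k powr c \<and>
              (\<forall>C :: (nat, nat \<times> nat) circuit.
                 tropical_circuit (parcs G) C \<and> calculates C (DTSP G) \<longrightarrow>
                 real (circuit_size C) \<ge> 2 powr f k))"
proof -
  define x where "x n = (ln (real n) powr (1 / 64)) ^ n" for n :: nat
  have "eventually (\<lambda>n :: nat. 0 < ln (real n) powr (1 / 64) \<and> ln (real n) powr (1 / 64) \<le> 2 ^ n \<and> 1 \<le> n) at_top"
    by (intro eventually_conj eventually_ge_at_top; real_asymp)
  from eventually_conj[OF eventually_no_return_rectangle_bound[where 'a = nat] this]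
  obtain n0 where n0: "\<forall>n\<ge>n0.
      (\<forall>(V :: nat set) P R. finite V \<and> card V = n \<and> no_return_rectangle V P R
        \<longrightarrow> real (card P) * real (card R) * (ln (real n) powr (1 / 64)) ^ n \<le> fact n ^ 2) \<and>
      0 < ln (real n) powr (1 / 64) \<and> ln (real n) powr (1 / 64) \<le> 2 ^ n \<and> 1 \<le> n"
    unfolding eventually_at_top_linorder by (elim exE)
  define f where "f k = (if k div 3 < n0 then 0 else max 0 (log 2 (x (k div 3) / real (k div 3))))" for k :: nat
  have f_nonneg: "\<forall>k. f k \<ge> 0" by (simp add: f_def)
  \<comment> \<open>The leading constant is 1/192: a third from \<open>k div 3\<close> and 1/64 from
    the exponent in \<open>x\<close>. The constant 1/400 leaves room for rounding, for the term
    \<open>log 2 (real k)\<close> and for the change of base inside the double logarithm.\<close>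
  have "eventually (\<lambda>k. 1 / 400 * norm (real k * log 2 (log 2 (real k))) \<le> norm (f k)) at_top"
  proof -
    have "eventually (\<lambda>k :: nat. 0 \<le> real k * log 2 (log 2 (real k)) \<and> 1 < real k / 3 - 1 \<and> 1 \<le> ln (real k / 3 - 1) \<and>
        1 / 400 * (real k * log 2 (log 2 (real k)))
        \<le> (real k / 3 - 1) / 64 * log 2 (ln (real k / 3 - 1)) - log 2 (real k)) at_top"
      by (intro eventually_conj; real_asymp)
    moreover have "eventually (\<lambda>k. 3 * n0 \<le> k) at_top" by (rule eventually_ge_at_top)
    ultimately show ?thesis
    proof eventually_elim
      case (elim k)
      define n where "n = k div 3"
      define y where "y = real k / 3 - 1"
      have n: "n0 \<le> n" using elim by (simp add: n_def)
      have y: "1 < y" "1 \<le> ln y" using elim by (auto simp: y_def)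
      have yn: "y \<le> real n" and nk: "real n \<le> real k"
        unfolding y_def n_def by linarith+
      have ln_n: "ln y \<le> ln (real n)" using y yn by simp
      have ln1: "1 \<le> ln (real n)" using ln_n y by linarith
      have "log 2 (x n / real n) = real n / 64 * log 2 (ln (real n)) - log 2 (real n)"
        using ln1 y yn by (simp add: x_def log_divide log_nat_power log_powr)
      moreover have "y / 64 * log 2 (ln y) \<le> real n / 64 * log 2 (ln (real n))"
        using y yn ln_n by (intro mult_mono) auto
      moreover have "log 2 (real n) \<le> log 2 (real k)" using y yn nk by simp
      ultimately have "1 / 400 * (real k * log 2 (log 2 (real k))) \<le> log 2 (x n / real n)"
        using elim unfolding y_def by linarith
      also have "\<dots> \<le> f k" using n by (simp add: f_def n_def)
      finally show ?case using elim f_nonneg by simp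
    qed
  qed
  then have f_omega: "f \<in> \<Omega>(\<lambda>k. real k * log 2 (log 2 (real k)))"
    by (rule landau_omega.bigI[rotated]) simp
  have "\<exists>G :: nat pair_pre_digraph.
              pair_fin_digraph G \<and>
              hamiltonian_cycles G \<noteq> {} \<and>
              pathwidth G \<le> k \<and>
              real (card (pverts G)) \<le> real k powr 3 \<and>
              (\<forall>C :: (nat, nat \<times> nat) circuit.
                 tropical_circuit (parcs G) C \<and> calculates C (DTSP G) \<longrightarrow>
                 real (circuit_size C) \<ge> 2 powr f k)" if k: "1 \<le> k" for k
  proof -
    have size_pos: "1 \<le> real (circuit_size C)" if "tropical_circuit X C" for X and C :: "(nat, nat \<times> nat) circuit"
    proof -
      have "finite (nodes C)" "nodes C \<noteq> {}" using that by (auto simp: tropical_circuit_def)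
      then have "0 < card (nodes C)" by (simp add: card_gt_0_iff)
      then show ?thesis by (simp add: circuit_size_def)
    qed
    define n where "n = k div 3"
    show ?thesis
    proof (cases "n < n0")
      case True
      show ?thesis
      proof (intro exI[of _ "layered_graph 1 1"] conjI allI impI)
        show "real (card (pverts (layered_graph 1 1))) \<le> real k powr 3"
          using k by (simp add: card_verts_layered_graph ge_one_powr_ge_zero)
        show "2 powr f k \<le> real (circuit_size C)"
          if "tropical_circuit (parcs (layered_graph 1 1)) C \<and> calculates C (DTSP (layered_graph 1 1))"
          for C :: "(nat, nat \<times> nat) circuit"
          using True size_pos that by (auto simp: f_def n_def)
      qed (simp_all add: pair_fin_digraph_layered_graph hamiltonian_layered_graph pathwidth_loop del: One_nat_def)
    next
      case False
      then have "n0 \<le> n" by simp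
      note n0 = n0[rule_format, OF this]
      have n: "0 < n" using n0 by simp
      have n3: "3 * n \<le> k" by (simp add: n_def)
      have xpos: "0 < x n" using n0 by (simp add: x_def)
      have "x n \<le> (2 ^ n) ^ n" unfolding x_def using n0 by (intro power_mono) auto
      then have x_le: "x n \<le> 2 ^ (n ^ 2)" by (simp add: power2_eq_square power_mult)
      let ?G = "layered_graph n (3 * n ^ 2)"
      show ?thesis
      proof (intro exI[of _ ?G] conjI allI impI)
        show "pair_fin_digraph ?G" by (rule pair_fin_digraph_layered_graph)
        show "hamiltonian_cycles ?G \<noteq> {}" using n by (intro hamiltonian_layered_graph) auto
        have "1 \<le> n ^ 2" using n by simp
        then have "2 \<le> 3 * n ^ 2" by linarith
        then have "pathwidth ?G \<le> 3 * n - 1" by (rule pathwidth_layered_graph[OF n])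
        then show "pathwidth ?G \<le> k" using n3 by linarith
        have "3 * n ^ 2 * n \<le> (3 * n) ^ 3" by (simp add: power2_eq_square power3_eq_cube)
        also have "\<dots> \<le> k ^ 3" using n3 by (rule power_mono) simp
        finally have "real (3 * n ^ 2 * n) \<le> real (k ^ 3)" by (rule of_nat_mono)
        also have "\<dots> = real k powr 3" using k by (simp add: powr_numeral)
        finally show "real (card (pverts ?G)) \<le> real k powr 3" by (simp add: card_verts_layered_graph)
      next
        fix C :: "(nat, nat \<times> nat) circuit"
        assume C: "tropical_circuit (parcs ?G) C \<and> calculates C (DTSP ?G)"
        have "x n \<le> real n * real (circuit_size C)"
        proof (rule layered_circuit_size[OF n xpos x_le])
          fix P R :: "(nat \<Rightarrow> nat) set"
          assume "no_return_rectangle {..<n} P R"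
          then show "real (card P) * real (card R) * x n \<le> fact n ^ 2"
            using n0 unfolding x_def by (metis (no_types, lifting) card_lessThan finite_lessThan)
        qed (use C in auto)
        then have le: "x n / real n \<le> real (circuit_size C)" using n by (simp add: field_simps)
        have "2 powr log 2 (x n / real n) = x n / real n" using xpos n by simp
        then have "2 powr max 0 (log 2 (x n / real n)) \<le> real (circuit_size C)"
          using le size_pos C by (auto simp: max_def)
        then show "2 powr f k \<le> real (circuit_size C)" using False by (simp add: f_def n_def)
      qed
    qed
  qed
  then show ?thesis using f_nonneg f_omega by (intro exI[of _ 3] exI[of _ f]) auto
qed

end
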